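(* Let $\alpha$, $\beta$, $\gamma$ be partitions of the same size. If $\langle\phi^{n\alpha}\otimes\phi^{n\beta},\chi^{n\gamma}\rangle=1$ for all $n\in\mathbb{N}$, then there is a unique matrix $A\in\mathsf{P}(\gamma)\cap\mathsf{M}(\alpha,\beta)$. Besides, $A$ is additive and $K_{n\gamma,\,\pi(nA)}=1$ for all $n\in\mathbb{N}$.
   Context: $\mathbb{N}$ is the set of positive integers. A partition is a weakly decreasing sequence of positive integers; its size is the sum of its parts and its length is the number of its parts. $n\alpha$ is the partition $\alpha$ with every part multiplied by $n$. For a partition $\lambda$ of $m$, $\chi^\lambda$ is the irreducible complex character of the symmetric group $S_m$ associated to $\lambda$, and $\phi^\lambda=\mathrm{Ind}_{S_\lambda}^{S_m}(1_\lambda)$ is the permutation character induced from the trivial character of the Young subgroup $S_\lambda=S_{\lambda_1}\times S_{\lambda_2}\times\cdots$. $\langle\cdot,\cdot\rangle$ is the usual scalar product of complex characters. $K_{\lambda,\nu}$ is the Kostka number, the number of semistandard Young tableaux of shape $\lambda$ and content $\nu$. For partitions $\alpha$ (of length $p$) and $\beta$ (of length $q$) of the same size, $\mathsf{M}(\alpha,\beta)$ is the set of $p\times q$ matrices with nonnegative integer entries, row-sum vector $\alpha$ and column-sum vector $\beta$. For such a matrix $A$, $\pi(A)$ denotes the sequence of entries of $A$ arranged in weakly decreasing order, regarded as a partition (trailing zeros are disregarded). For $a\in\mathbb{R}^m$, the permutohedron $\mathsf{P}(a)$ is the convex hull in $\mathbb{R}^m$ of all vectors obtained by permuting the coordinates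 of $a$. In $\mathsf{P}(\gamma)\cap\mathsf{M}(\alpha,\beta)$ a $p\times q$ matrix is identified with the vector in $\mathbb{R}^{pq}$ obtained by listing its entries row by row, and $\gamma$ is regarded as a vector in $\mathbb{R}^{pq}$ by appending zeros (if $\gamma$ has more than $pq$ parts, the intersection is understood to be empty). A $p\times q$ matrix $A=(a_{i,j})$ with nonnegative integer entries is called additive if there exist real numbers $x_1,\dots,x_p,y_1,\dots,y_q$ such that $a_{i,j}>a_{k,l}$ implies $x_i+y_j>x_k+y_l$, for all $i,k\in\{1,\dots,p\}$ and all $j,l\in\{1,\dots,q\}$. *)

theory Defs
  imports
    "HOL-Analysis.Analysis"
    "HOL-Analysis.Finite_Function_Topology"
    "HOL-Combinatorics.Permutations"
    "HOL-Library.Function_Algebras"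
    "Jordan_Normal_Form.Matrix"
begin

definition is_partition :: "nat list \<Rightarrow> bool" where
  "is_partition l \<longleftrightarrow> sorted_wrt (\<ge>) l \<and> (\<forall>x\<in>set l. 0 < x)"

definition scale_partition :: "nat \<Rightarrow> nat list \<Rightarrow> nat list" where
  "scale_partition n l = map (\<lambda>x. n * x) l"

text \<open>
  The symmetric group \<open>S\<^sub>m\<close> consists of the permutations of \<open>{1..m}\<close>, as functions on \<^typ>\<open>nat\<close>
  that fix all other numbers. Class functions are represented by functions
  \<^typ>\<open>(nat \<Rightarrow> nat) \<Rightarrow> complex\<close>, of which only the values on \<open>S\<^sub>m\<close> matter.
\<close>

definition sym_grp :: "nat \<Rightarrow> (nat \<Rightarrow> nat) set" where
  "sym_grp m = {g. g permutes {1..m}}"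

definition char_inner ::
    "nat \<Rightarrow> ((nat \<Rightarrow> nat) \<Rightarrow> complex) \<Rightarrow> ((nat \<Rightarrow> nat) \<Rightarrow> complex) \<Rightarrow> complex" where
  "char_inner m \<phi> \<psi> = (\<Sum>g\<in>sym_grp m. \<phi> g * cnj (\<psi> g)) / of_nat (card (sym_grp m))"

definition char_tensor ::
    "((nat \<Rightarrow> nat) \<Rightarrow> complex) \<Rightarrow> ((nat \<Rightarrow> nat) \<Rightarrow> complex) \<Rightarrow> (nat \<Rightarrow> nat) \<Rightarrow> complex" where
  "char_tensor \<phi> \<psi> = (\<lambda>g. \<phi> g * \<psi> g)"

definition induced_char ::
    "(nat \<Rightarrow> nat) set \<Rightarrow> (nat \<Rightarrow> nat) set \<Rightarrow> ((nat \<Rightarrow> nat) \<Rightarrow> complex) \<Rightarrow> (nat \<Rightarrow> nat) \<Rightarrow> complex" where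
  "induced_char G H \<psi> = (\<lambda>g.
     (\<Sum>x\<in>{x \<in> G. inv_into UNIV x \<circ> g \<circ> x \<in> H}. \<psi> (inv_into UNIV x \<circ> g \<circ> x)) / of_nat (card H))"

definition young_subgroup :: "nat list \<Rightarrow> (nat \<Rightarrow> nat) set" where
  "young_subgroup l = {g \<in> sym_grp (sum_list l). \<forall>i<length l.
     g ` {sum_list (take i l)<..sum_list (take (Suc i) l)}
       = {sum_list (take i l)<..sum_list (take (Suc i) l)}}"

definition perm_char :: "nat list \<Rightarrow> (nat \<Rightarrow> nat) \<Rightarrow> complex" where
  "perm_char l = induced_char (sym_grp (sum_list l)) (young_subgroup l) (\<lambda>_. 1)"

definition fun_scale :: "complex \<Rightarrow> ('a \<Rightarrow> complex) \<Rightarrow> 'a \<Rightarrow> complex" where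
  "fun_scale c f = (\<lambda>x. c * f x)"

interpretation cfun: vector_space "fun_scale :: complex \<Rightarrow> ('a \<Rightarrow> complex) \<Rightarrow> 'a \<Rightarrow> complex"
  by standard (auto simp: fun_scale_def fun_eq_iff algebra_simps)

text \<open>Meant for a finite-dimensional subspace \<open>V\<close> that is invariant under the linear map \<open>f\<close>; the value
  then does not depend on the basis chosen.\<close>

definition trace_on ::
    "('a \<Rightarrow> complex) set \<Rightarrow> (('a \<Rightarrow> complex) \<Rightarrow> 'a \<Rightarrow> complex) \<Rightarrow> complex" where
  "trace_on V f =
     (let B = (SOME B. cfun.independent B \<and> cfun.span B = V)
      in \<Sum>b\<in>B. cfun.representation B (f b) b)"

text \<open>A tableau of shape \<open>l\<close> is the list of its rows; its tabloid is the list of its row sets.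
  The permutation module is realised inside \<^typ>\<open>nat set list \<Rightarrow> complex\<close>, a function being
  the family of its coefficients with respect to the basis of tabloids.\<close>

definition is_tableau :: "nat list \<Rightarrow> nat list list \<Rightarrow> bool" where
  "is_tableau l t \<longleftrightarrow>
     map length t = l \<and> distinct (concat t) \<and> set (concat t) = {1..sum_list l}"

definition tabloid :: "nat list list \<Rightarrow> nat set list" where
  "tabloid t = map set t"

definition tabloid_act :: "(nat \<Rightarrow> nat) \<Rightarrow> nat set list \<Rightarrow> nat set list" where
  "tabloid_act g T = map (\<lambda>R. g ` R) T"

definition module_act ::
    "(nat \<Rightarrow> nat) \<Rightarrow> (nat set list \<Rightarrow> complex) \<Rightarrow> nat set list \<Rightarrow> complex" where
  "module_act g f = (\<lambda>T. f (tabloid_act (inv_into UNIV g) T))"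

definition tableau_column :: "nat list list \<Rightarrow> nat \<Rightarrow> nat set" where
  "tableau_column t j = {t ! i ! j | i. i < length t \<and> j < length (t ! i)}"

definition column_group :: "nat list \<Rightarrow> nat list list \<Rightarrow> (nat \<Rightarrow> nat) set" where
  "column_group l t =
     {k \<in> sym_grp (sum_list l). \<forall>j. k ` tableau_column t j = tableau_column t j}"

definition polytabloid :: "nat list \<Rightarrow> nat list list \<Rightarrow> nat set list \<Rightarrow> complex" where
  "polytabloid l t = (\<lambda>T. \<Sum>k\<in>column_group l t.
     of_int (sign k) * (if T = tabloid_act k (tabloid t) then 1 else 0))"

definition specht_module :: "nat list \<Rightarrow> (nat set list \<Rightarrow> complex) set" where
  "specht_module l = cfun.span {polytabloid l t | t. is_tableau l t}"

text \<open>The irreducible character associated with a partition is the character of its Specht module,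
  in the convention in which the partition with a single part gives the trivial character.\<close>

definition irr_char :: "nat list \<Rightarrow> (nat \<Rightarrow> nat) \<Rightarrow> complex" where
  "irr_char l = (\<lambda>g. trace_on (specht_module l) (module_act g))"

definition is_ssyt :: "nat list \<Rightarrow> nat list \<Rightarrow> nat list list \<Rightarrow> bool" where
  "is_ssyt l \<nu> T \<longleftrightarrow>
     map length T = l \<and>
     (\<forall>R\<in>set T. sorted R) \<and>
     (\<forall>i j. Suc i < length T \<and> j < length (T ! i) \<and> j < length (T ! Suc i) \<longrightarrow>
        T ! i ! j < T ! Suc i ! j) \<and>
     set (concat T) \<subseteq> {1..length \<nu>} \<and>
     (\<forall>k<length \<nu>. count_list (concat T) (Suc k) = \<nu> ! k)"

definition kostka :: "nat list \<Rightarrow> nat list \<Rightarrow> nat" where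
  "kostka l \<nu> = card {T. is_ssyt l \<nu> T}"

definition margin_mats :: "nat list \<Rightarrow> nat list \<Rightarrow> nat mat set" where
  "margin_mats \<alpha> \<beta> = {A \<in> carrier_mat (length \<alpha>) (length \<beta>).
     (\<forall>i<length \<alpha>. (\<Sum>j<length \<beta>. A $$ (i, j)) = \<alpha> ! i) \<and>
     (\<forall>j<length \<beta>. (\<Sum>i<length \<alpha>. A $$ (i, j)) = \<beta> ! j)}"

definition mat_entries :: "'a mat \<Rightarrow> 'a list" where
  "mat_entries A = concat (mat_to_list A)"

definition mat_partition :: "nat mat \<Rightarrow> nat list" where
  "mat_partition A = rev (sort (filter (\<lambda>x. 0 < x) (mat_entries A)))"

definition additive_mat :: "nat mat \<Rightarrow> bool" where
  "additive_mat A \<longleftrightarrow> (\<exists>x y :: nat \<Rightarrow> real.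
     \<forall>i<dim_row A. \<forall>k<dim_row A. \<forall>j<dim_col A. \<forall>l<dim_col A.
       A $$ (i, j) > A $$ (k, l) \<longrightarrow> x i + y j > x k + y l)"

text \<open>Since the dimension varies, vectors in \<open>\<real>\<^sup>m\<close> are lists of length \<open>m\<close>, and \<open>\<real>\<^sup>m\<close> is embedded by
  \<^const>\<open>Poly_Mapping.nth\<close> (extension by zero) in the real vector space \<^typ>\<open>nat \<Rightarrow>\<^sub>0 real\<close>, where the
  convex hull is taken.\<close>

definition permutohedron :: "real list \<Rightarrow> real list set" where
  "permutohedron a = {v. length v = length a \<and>
     Poly_Mapping.nth v \<in> convex hull (Poly_Mapping.nth ` {b. mset b = mset a})}"

definition permutohedron_mats :: "nat list \<Rightarrow> nat list \<Rightarrow> nat list \<Rightarrow> nat mat set" where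
  "permutohedron_mats \<gamma> \<alpha> \<beta> = {A \<in> margin_mats \<alpha> \<beta>.
     length \<gamma> \<le> length \<alpha> * length \<beta> \<and>
     map real (mat_entries A) \<in>
       permutohedron (map real (\<gamma> @ replicate (length \<alpha> * length \<beta> - length \<gamma>) 0))}"

end

theory Submission
  imports Defs
begin

text \<open>
  Put \<open>m\<close> for the size of the partitions. The permutation character \<open>\<phi>\<^sup>\<alpha>\<close> counts the words of length \<open>m\<close> with content \<open>\<alpha>\<close>
  that a permutation fixes, so \<open>\<phi>\<^sup>\<alpha> \<otimes> \<phi>\<^sup>\<beta>\<close> counts the fixed words in the cells of a matrix whose content is a
  matrix with margins \<open>\<alpha>\<close> and \<open>\<beta>\<close>. Interchanging sums, the scalar product with \<open>\<chi>\<^sup>\<gamma>\<close> becomes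
  \<open>1/m!\<close> times the sum over these words \<open>w\<close> of the order of the stabilizer of \<open>w\<close> times the dimension of its fixed space in the
  Specht module of \<open>\<gamma>\<close> (\<open>char_inner_eq_sum_pair_words\<close>). By orbit-stabilizer, each content \<open>A\<close> contributes an
  average of these dimensions.

  Two facts about these dimensions carry the argument. First, a nonzero fixed vector forces the
  content to be dominated by \<open>\<gamma>\<close>, because a transposition inside a column acts by \<open>-1\<close> on a polytabloid
  (\<open>fixed_specht_nonzero_imp_dominated\<close>). Second, the dimension is at least the Kostka number, because the symmetrized
  polytabloids of semistandard tableaux form a triangular family (\<open>kostka_le_dim_fixed_specht\<close>). On the other side,
  a dominated content admits a semistandard tableau, and it is dominated if and only if it lies in the permutohedron; both come
  from the same induction (\<open>dominates_induct\<close>). If the scalar product is \<open>1\<close>, then exactly one matrix lies in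
  the permutohedron, and its Kostka number is \<open>1\<close> (\<open>multiplicity_one\<close>).

  This applies to every multiple of \<open>\<alpha>, \<beta>, \<gamma>\<close>. If \<open>A\<close> were not additive, then by Gordan's theorem over the integers some
  nontrivial sum of transfers of one unit from a larger to a smaller entry of \<open>A\<close> would have zero margins. Such transfers
  preserve domination by \<open>\<gamma>\<close>, so after scaling they lead to a second integral matrix with the margins of some \<open>C A\<close>
  in the permutohedron of \<open>C \<gamma>\<close> (\<open>non_additive_imp_other_majorized_mat\<close>), against uniqueness for the multiple \<open>C\<close>.
\<close>

section \<open>Traces and fixed vectors\<close>

lemma fun_scale_apply [simp]: "fun_scale c f x = c * f x"
  by (simp add: fun_scale_def)

lemma sum_fun_apply: "(\<Sum>i\<in>A. f i) x = (\<Sum>i\<in>A. f i x)"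
  for f :: "'i \<Rightarrow> 'a \<Rightarrow> complex"
  by (induction A rule: infinite_finite_induct) auto

definition fixed_vectors :: "'g set \<Rightarrow> ('g \<Rightarrow> ('a \<Rightarrow> complex) \<Rightarrow> 'a \<Rightarrow> complex) \<Rightarrow>
    ('a \<Rightarrow> complex) set \<Rightarrow> ('a \<Rightarrow> complex) set" where
  "fixed_vectors H \<rho> V = {v \<in> V. \<forall>h\<in>H. \<rho> h v = v}"

lemma basis_expansion:
  assumes "finite B" "cfun.independent B" "v \<in> cfun.span B"
  shows "(\<Sum>b\<in>B. fun_scale (cfun.representation B v b) b) = v"
  using cfun.sum_representation_eq[OF assms(2,3) assms(1) order_refl] .

text \<open>On \<open>V\<close> the operator \<open>P = (\<Sum>g\<in>H. \<rho> g)\<close> has its values in the space \<open>F\<close> of fixed vectors and multiplies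
  every vector of \<open>F\<close> by the order of \<open>H\<close>. Its trace, taken with respect to the basis \<open>B\<close> that happens to be
  chosen by \<^const>\<open>trace_on\<close>, can be rewritten in a basis \<open>C\<close> of \<open>F\<close>: expand \<open>P b\<close> in \<open>C\<close>, each \<open>c\<close> in
  \<open>B\<close>, and interchange the two sums. The result is the trace of a
  scalar on \<open>F\<close>, whatever \<open>B\<close> was.\<close>

lemma sum_trace_on_eq_dim_fixed:
  fixes \<rho> :: "'g \<Rightarrow> ('a \<Rightarrow> complex) \<Rightarrow> 'a \<Rightarrow> complex"
  assumes H: "finite H"
    and S: "finite S" "V = cfun.span S"
    and lin: "\<And>g. g \<in> H \<Longrightarrow> Vector_Spaces.linear fun_scale fun_scale (\<rho> g)"
    and inv: "\<And>g v. g \<in> H \<Longrightarrow> v \<in> V \<Longrightarrow> \<rho> g v \<in> V"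
    and absorb: "\<And>h v. h \<in> H \<Longrightarrow> v \<in> V \<Longrightarrow> \<rho> h (\<Sum>g\<in>H. \<rho> g v) = (\<Sum>g\<in>H. \<rho> g v)"
  shows "(\<Sum>g\<in>H. trace_on V (\<rho> g)) = of_nat (card H * cfun.dim (fixed_vectors H \<rho> V))"
proof -
  define B where "B = (SOME B. cfun.independent B \<and> cfun.span B = V)"
  have "\<exists>B. cfun.independent B \<and> cfun.span B = V"
    using cfun.basis_exists[of V] S(2) cfun.span_span cfun.span_mono
    by (metis cfun.span_superset cfun.span_subspace cfun.subspace_span)
  then have B: "cfun.independent B" "cfun.span B = V"
    unfolding B_def by (metis (mono_tags, lifting) someI_ex)+
  have finB: "finite B"
    using cfun.independent_span_bound[OF S(1) B(1)] B(2) S(2) cfun.span_superset by metis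
  let ?F = "fixed_vectors H \<rho> V"
  obtain C where C: "C \<subseteq> ?F" "cfun.independent C" "?F \<subseteq> cfun.span C" "card C = cfun.dim ?F"
    using cfun.basis_exists by blast
  have finC: "finite C"
    using cfun.independent_span_bound[OF S(1) C(2)] C(1) S(2) fixed_vectors_def by blast
  define P where "P v = (\<Sum>g\<in>H. \<rho> g v)" for v
  have PF: "P v \<in> ?F" if "v \<in> V" for v
    unfolding fixed_vectors_def P_def mem_Collect_eq
    using that inv absorb S(2) by (auto intro!: cfun.span_sum)
  have repP: "(\<Sum>g\<in>H. cfun.representation B (\<rho> g v) b) = cfun.representation B (P v) b"
    if "v \<in> V" for v b
    unfolding P_def
    by (subst cfun.representation_sum[OF B(1)]) (use inv that B(2) in auto)
  have "(\<Sum>g\<in>H. trace_on V (\<rho> g)) = (\<Sum>b\<in>B. \<Sum>g\<in>H. cfun.representation B (\<rho> g b) b)"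
    unfolding trace_on_def B_def[symmetric] Let_def by (rule sum.swap)
  also have "\<dots> = (\<Sum>b\<in>B. cfun.representation B (P b) b)"
    using B(2) cfun.span_superset by (intro sum.cong refl repP) blast
  also have "\<dots> = (\<Sum>b\<in>B. \<Sum>c\<in>C. cfun.representation C (P b) c * cfun.representation B c b)"
  proof (intro sum.cong refl)
    fix b assume "b \<in> B"
    then have "P b \<in> ?F" using PF B(2) cfun.span_superset by blast
    then have eq: "P b = (\<Sum>c\<in>C. fun_scale (cfun.representation C (P b) c) c)"
      using basis_expansion[OF finC C(2)] C(3) by (metis subsetD)
    have CB: "c \<in> cfun.span B" if "c \<in> C" for c using that C(1) B(2) by (auto simp: fixed_vectors_def)
    show "cfun.representation B (P b) b = (\<Sum>c\<in>C. cfun.representation C (P b) c * cfun.representation B c b)"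
      by (subst eq, subst cfun.representation_sum[OF B(1)])
        (auto simp: CB cfun.span_scale cfun.representation_scale[OF B(1)] sum_fun_apply)
  qed
  also have "\<dots> = (\<Sum>c\<in>C. \<Sum>b\<in>B. cfun.representation C (P b) c * cfun.representation B c b)"
    by (rule sum.swap)
  also have "\<dots> = (\<Sum>c\<in>C. cfun.representation C (P c) c)"
  proof (intro sum.cong refl)
    fix c assume c: "c \<in> C"
    then have "c \<in> V" using C(1) by (auto simp: fixed_vectors_def)
    then have "P c = P (\<Sum>b\<in>B. fun_scale (cfun.representation B c b) b)"
      using basis_expansion[OF finB B(1)] B(2) by simp
    also have "\<dots> = (\<Sum>g\<in>H. \<Sum>b\<in>B. fun_scale (cfun.representation B c b) (\<rho> g b))"
      unfolding P_def
    proof (intro sum.cong refl)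
      fix g assume "g \<in> H"
      then interpret g: Vector_Spaces.linear fun_scale fun_scale "\<rho> g" by (rule lin)
      show "\<rho> g (\<Sum>b\<in>B. fun_scale (cfun.representation B c b) b)
          = (\<Sum>b\<in>B. fun_scale (cfun.representation B c b) (\<rho> g b))"
        by (simp add: g.sum g.scale)
    qed
    also have "\<dots> = (\<Sum>b\<in>B. fun_scale (cfun.representation B c b) (P b))"
      unfolding P_def by (subst sum.swap) (simp add: cfun.scale_sum_right)
    finally have eq: "P c = \<dots>" .
    have PC: "P b \<in> cfun.span C" if "b \<in> B" for b
      using that PF B(2) C(3) cfun.span_superset by blast
    show "(\<Sum>b\<in>B. cfun.representation C (P b) c * cfun.representation B c b) = cfun.representation C (P c) c"
      by (subst eq, subst cfun.representation_sum[OF C(2)])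
        (auto simp: PC cfun.span_scale cfun.representation_scale[OF C(2)] sum_fun_apply mult.commute)
  qed
  also have "\<dots> = (\<Sum>c\<in>C. of_nat (card H))"
  proof (intro sum.cong refl)
    fix c assume c: "c \<in> C"
    have "P c = (\<Sum>g\<in>H. c)"
      unfolding P_def using c C(1) by (intro sum.cong) (auto simp: fixed_vectors_def)
    also have "\<dots> = fun_scale (of_nat (card H)) c"
      by (auto simp: fun_eq_iff sum_fun_apply)
    finally show "cfun.representation C (P c) c = of_nat (card H)"
      using c C(2) by (simp add: cfun.representation_scale cfun.span_base cfun.representation_basis)
  qed
  finally show ?thesis by (simp add: C(4) mult.commute)
qed

section \<open>The symmetric group acting on the Specht module\<close>

text \<open>The notation \<open>inv\<close> already denotes inversion in a group structure.\<close>

abbreviation finv :: "('a \<Rightarrow> 'a) \<Rightarrow> 'a \<Rightarrow> 'a" where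
  "finv g \<equiv> inv_into UNIV g"

lemma sym_grp_iff: "g \<in> sym_grp m \<longleftrightarrow> g permutes {1..m}"
  by (simp add: sym_grp_def)

lemma finite_sym_grp [simp]: "finite (sym_grp m)"
  by (simp add: sym_grp_def finite_permutations)

lemma card_sym_grp: "card (sym_grp m) = fact m"
  by (simp add: sym_grp_def card_permutations)

lemma sym_grp_bij: "g \<in> sym_grp m \<Longrightarrow> bij g"
  by (simp add: sym_grp_iff permutes_bij)

lemma sym_grp_id [simp]: "id \<in> sym_grp m"
  by (simp add: sym_grp_iff permutes_id)

lemma sym_grp_comp: "g \<in> sym_grp m \<Longrightarrow> h \<in> sym_grp m \<Longrightarrow> g \<circ> h \<in> sym_grp m"
  by (simp add: sym_grp_iff permutes_compose)

lemma sym_grp_inv: "g \<in> sym_grp m \<Longrightarrow> finv g \<in> sym_grp m"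
  by (simp add: sym_grp_iff permutes_inv)

lemma sym_grp_permutation: "g \<in> sym_grp m \<Longrightarrow> permutation g"
  using permutes_imp_permutation[of "{1..m}" g] by (simp add: sym_grp_iff)

lemma sym_grp_inv_comp [simp]: "g \<in> sym_grp m \<Longrightarrow> finv g \<circ> g = id" "g \<in> sym_grp m \<Longrightarrow> g \<circ> finv g = id"
  by (auto simp: sym_grp_iff permutes_inv_o)

text \<open>For a word \<open>w\<close> on the letters of a finite alphabet this is the Young subgroup of the level sets of \<open>w\<close> in
  \<open>{1..m}\<close>. Words on all of \<^typ>\<open>nat\<close> are harmless, since the members of \<open>S\<^sub>m\<close> fix every other number.\<close>

definition stab :: "nat \<Rightarrow> (nat \<Rightarrow> 'c) \<Rightarrow> (nat \<Rightarrow> nat) set" where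
  "stab m w = {g \<in> sym_grp m. w \<circ> g = w}"

lemma finite_stab [simp]: "finite (stab m w)"
  by (simp add: stab_def)

lemma id_in_stab [simp]: "id \<in> stab m w"
  by (simp add: stab_def)

lemma card_stab_pos: "card (stab m w) > 0"
  using id_in_stab finite_stab by (metis card_gt_0_iff empty_iff)

lemma stab_comp: "g \<in> stab m w \<Longrightarrow> h \<in> stab m w \<Longrightarrow> g \<circ> h \<in> stab m w"
  by (auto simp: stab_def sym_grp_comp) (metis comp_assoc)

lemma stab_inv: assumes "g \<in> stab m w" shows "finv g \<in> stab m w"
proof -
  have g: "g \<in> sym_grp m" "w \<circ> g = w" using assms by (auto simp: stab_def)
  have "w \<circ> finv g = (w \<circ> g) \<circ> finv g" using g by simp
  also have "\<dots> = w" using g(1) by (simp add: comp_assoc)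
  finally show ?thesis using g by (simp add: stab_def sym_grp_inv)
qed

lemma stab_bij_left: assumes "h \<in> stab m w" shows "bij_betw ((\<circ>) h) (stab m w) (stab m w)"
proof (rule bij_betw_byWitness[where f' = "(\<circ>) (finv h)"])
  have "h \<in> sym_grp m" using assms by (simp add: stab_def)
  then show "\<forall>a\<in>stab m w. finv h \<circ> (h \<circ> a) = a" "\<forall>a\<in>stab m w. h \<circ> (finv h \<circ> a) = a"
    by (simp_all flip: comp_assoc)
qed (use assms in \<open>auto intro: stab_comp stab_inv\<close>)

lemma stab_bij_right: assumes "h \<in> stab m w" shows "bij_betw (\<lambda>g. g \<circ> h) (stab m w) (stab m w)"
proof (rule bij_betw_byWitness[where f' = "\<lambda>g. g \<circ> finv h"])
  have "h \<in> sym_grp m" using assms by (simp add: stab_def)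
  then show "\<forall>a\<in>stab m w. (a \<circ> h) \<circ> finv h = a" "\<forall>a\<in>stab m w. (a \<circ> finv h) \<circ> h = a"
    by (simp_all add: comp_assoc)
qed (use assms in \<open>auto intro: stab_comp stab_inv\<close>)

lemma tabloid_act_comp: "tabloid_act g (tabloid_act h X) = tabloid_act (g \<circ> h) X"
  by (simp add: tabloid_act_def image_comp)

lemma tabloid_act_id [simp]: "tabloid_act id X = X"
  by (simp add: tabloid_act_def)

lemma tabloid_act_inv_eq_iff:
  assumes "g \<in> sym_grp m"
  shows "tabloid_act (finv g) X = Y \<longleftrightarrow> X = tabloid_act g Y"
  using assms by (metis tabloid_act_comp tabloid_act_id sym_grp_inv_comp)

lemma module_act_comp:
  assumes "g \<in> sym_grp m" "h \<in> sym_grp m"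
  shows "module_act g (module_act h f) = module_act (g \<circ> h) f"
  using assms by (simp add: module_act_def tabloid_act_comp o_inv_distrib sym_grp_bij)

lemma linear_module_act: "Vector_Spaces.linear fun_scale fun_scale (module_act g)"
  by unfold_locales (auto simp: module_act_def fun_eq_iff algebra_simps)

lemma module_act_sum: "module_act g (\<Sum>i\<in>A. f i) = (\<Sum>i\<in>A. module_act g (f i))"
  by (auto simp: module_act_def fun_eq_iff sum_fun_apply)

lemma tableau_column_iff:
  "a \<in> tableau_column t j \<longleftrightarrow> (\<exists>i<length t. j < length (t ! i) \<and> a = t ! i ! j)"
  by (auto simp: tableau_column_def)

lemma tableau_column_map: "tableau_column (map (map g) t) j = g ` tableau_column t j"
proof (rule Set.set_eqI)
  fix x
  have "x \<in> tableau_column (map (map g) t) j \<longleftrightarrow> (\<exists>i<length t. j < length (t ! i) \<and> x = g (t ! i ! j))"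
    by (simp add: tableau_column_iff cong: conj_cong)
  also have "\<dots> \<longleftrightarrow> x \<in> g ` tableau_column t j"
    unfolding image_iff Bex_def tableau_column_iff by blast
  finally show "x \<in> tableau_column (map (map g) t) j \<longleftrightarrow> x \<in> g ` tableau_column t j" .
qed

lemma tabloid_map: "tabloid (map (map g) t) = tabloid_act g (tabloid t)"
  by (simp add: tabloid_def tabloid_act_def)

lemma column_group_sym: "k \<in> column_group l t \<Longrightarrow> k \<in> sym_grp (sum_list l)"
  by (simp add: column_group_def)

lemma finite_column_group [simp]: "finite (column_group l t)"
  by (simp add: column_group_def)

lemma column_group_id [simp]: "id \<in> column_group l t"
  by (simp add: column_group_def)

lemma column_group_comp:
  assumes "g \<in> column_group l t" "h \<in> column_group l t"
  shows "g \<circ> h \<in> column_group l t"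
proof -
  have "(g \<circ> h) ` tableau_column t j = tableau_column t j" for j
  proof -
    have "(g \<circ> h) ` tableau_column t j = g ` h ` tableau_column t j" by (simp only: image_comp)
    also have "\<dots> = tableau_column t j" using assms by (simp add: column_group_def)
    finally show ?thesis .
  qed
  then show ?thesis using assms by (simp add: column_group_def sym_grp_comp del: comp_apply)
qed

text \<open>Equal rows at different positions are excluded as well, unless they are empty, which the membership
  hypotheses rule out.\<close>

lemma distinct_concat_row_unique:
  assumes "distinct (concat t)" "i < length t" "i' < length t" "a \<in> set (t ! i)" "a \<in> set (t ! i')"
  shows "i = i'"
  using assms
proof (induction t arbitrary: i i')
  case (Cons r t)
  have *: "a \<in> set r \<Longrightarrow> n < length t \<Longrightarrow> a \<notin> set (t ! n)" for n
    using Cons.prems(1) nth_mem[of n t] by fastforce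
  show ?case
    using Cons.prems Cons.IH * by (cases i; cases i') auto
qed simp

lemma distinct_concat_nth_unique:
  assumes "distinct (concat t)" "i < length t" "i' < length t" "j < length (t ! i)" "j' < length (t ! i')"
    "t ! i ! j = t ! i' ! j'"
  shows "i = i' \<and> j = j'"
proof -
  have "i = i'"
    using assms nth_mem[of j "t ! i"] by (intro distinct_concat_row_unique[of t i i' "t ! i ! j"]) auto
  moreover have "distinct (t ! i)"
    using assms by (auto simp: distinct_concat_iff)
  ultimately show ?thesis using assms nth_eq_iff_index_eq by blast
qed

lemma tableau_column_unique:
  assumes "is_tableau l t" "a \<in> tableau_column t j" "a \<in> tableau_column t j'"
  shows "j = j'"
  using assms distinct_concat_nth_unique[of t] by (auto simp: tableau_column_iff is_tableau_def)

lemma tableau_column_subset: "tableau_column t j \<subseteq> set (concat t)"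
proof
  fix a assume "a \<in> tableau_column t j"
  then obtain i where "i < length t" "j < length (t ! i)" "a = t ! i ! j"
    by (auto simp: tableau_column_iff)
  then have "t ! i \<in> set t" "a \<in> set (t ! i)" by simp_all
  then show "a \<in> set (concat t)" by auto
qed

lemma tableau_entry_in_column:
  assumes "is_tableau l t" "a \<in> {1..sum_list l}"
  obtains j where "a \<in> tableau_column t j"
proof -
  have "a \<in> set (concat t)" using assms by (simp add: is_tableau_def)
  then obtain i j where "i < length t" "j < length (t ! i)" "a = t ! i ! j"
    by (auto simp: in_set_conv_nth)
  then show ?thesis using that by (auto simp: tableau_column_iff)
qed

text \<open>Columns of a tableau are disjoint, so a transposition inside one column moves no other column.\<close>

lemma column_group_transpose:
  assumes t: "is_tableau l t" and ab: "a \<in> tableau_column t j" "b \<in> tableau_column t j"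
  shows "Transposition.transpose a b \<in> column_group l t"
proof -
  have same: "a \<in> tableau_column t i \<longleftrightarrow> b \<in> tableau_column t i" for i
    using tableau_column_unique[OF t] ab by metis
  have "Transposition.transpose a b ` tableau_column t i = tableau_column t i" for i
    using same[of i] by (auto simp: Transposition.transpose_def image_iff)
  moreover have "Transposition.transpose a b permutes {1..sum_list l}"
    using t ab tableau_column_subset[of t j] by (intro permutes_swap_id) (auto simp: is_tableau_def)
  ultimately show ?thesis by (simp add: column_group_def sym_grp_iff)
qed

lemma polytabloid_apply:
  "polytabloid l t X = (\<Sum>k\<in>column_group l t. of_int (sign k) * of_bool (X = tabloid_act k (tabloid t)))"
  by (simp add: polytabloid_def of_bool_def)

lemma column_group_conj:
  assumes g: "g \<in> sym_grp (sum_list l)" and k: "k \<in> column_group l t"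
  shows "g \<circ> k \<circ> finv g \<in> column_group l (map (map g) t)"
proof -
  have "(g \<circ> k \<circ> finv g) ` g ` A = g ` k ` A" for A
    by (simp only: image_comp comp_assoc sym_grp_inv_comp(1)[OF g] comp_id)
  then show ?thesis
    using g k by (simp add: column_group_def sym_grp_comp sym_grp_inv tableau_column_map)
qed

text \<open>Renaming the entries by \<open>g\<close> conjugates the column group; the inverse of conjugation by \<open>g\<close> is again a
  renaming, by the inverse of \<open>g\<close>.\<close>

lemma column_group_map:
  assumes g: "g \<in> sym_grp (sum_list l)"
  shows "bij_betw (\<lambda>k. g \<circ> k \<circ> finv g) (column_group l t) (column_group l (map (map g) t))"
proof (rule bij_betw_byWitness[where f' = "\<lambda>k. finv g \<circ> k \<circ> g"])
  have cancel: "finv g (g x) = x" "g (finv g x) = x" for x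
    using sym_grp_inv_comp[OF g] by (metis comp_apply id_apply)+
  show "\<forall>k\<in>column_group l t. finv g \<circ> (g \<circ> k \<circ> finv g) \<circ> g = k"
    "\<forall>k\<in>column_group l (map (map g) t). g \<circ> (finv g \<circ> k \<circ> g) \<circ> finv g = k"
    by (simp_all add: fun_eq_iff cancel)
  show "(\<lambda>k. g \<circ> k \<circ> finv g) ` column_group l t \<subseteq> column_group l (map (map g) t)"
    using column_group_conj[OF g] by blast
  have "finv (finv g) = g" using g by (simp add: inv_inv_eq sym_grp_bij)
  moreover have "map (map (finv g)) (map (map g) t) = t"
    using sym_grp_inv_comp(1)[OF g] by (simp add: comp_def cancel)
  ultimately show "(\<lambda>k. finv g \<circ> k \<circ> g) ` column_group l (map (map g) t) \<subseteq> column_group l t"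
    using column_group_conj[OF sym_grp_inv[OF g], of _ "map (map g) t"] by auto
qed

text \<open>Conjugation by \<open>g\<close> matches the two signed sums term by term, because it preserves signs.\<close>

lemma module_act_polytabloid:
  assumes g: "g \<in> sym_grp (sum_list l)"
  shows "module_act g (polytabloid l t) = polytabloid l (map (map g) t)"
proof
  fix X
  have "polytabloid l (map (map g) t) X = (\<Sum>k\<in>column_group l t.
      of_int (sign (g \<circ> k \<circ> finv g)) *
      of_bool (X = tabloid_act (g \<circ> k \<circ> finv g) (tabloid_act g (tabloid t))))"
    unfolding polytabloid_apply tabloid_map
    by (rule sum.reindex_bij_betw[OF column_group_map[OF g], symmetric])
  also have "\<dots> = (\<Sum>k\<in>column_group l t.
      of_int (sign k) * of_bool (tabloid_act (finv g) X = tabloid_act k (tabloid t)))"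
  proof (intro sum.cong refl)
    fix k assume "k \<in> column_group l t"
    then have k: "permutation k" by (rule sym_grp_permutation[OF column_group_sym])
    have p: "permutation g" "permutation (finv g)"
      using g by (auto intro: sym_grp_permutation sym_grp_inv)
    have "sign (g \<circ> k \<circ> finv g) = sign k"
      using k p by (simp add: sign_compose permutation_compose sign_inverse sign_idempotent)
    moreover have "g \<circ> k \<circ> finv g \<circ> g = g \<circ> k" using g by (simp add: comp_assoc)
    ultimately show "of_int (sign (g \<circ> k \<circ> finv g)) *
        of_bool (X = tabloid_act (g \<circ> k \<circ> finv g) (tabloid_act g (tabloid t))) =
      of_int (sign k) * (of_bool (tabloid_act (finv g) X = tabloid_act k (tabloid t)) :: complex)"
      by (simp add: tabloid_act_comp tabloid_act_inv_eq_iff[OF g])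
  qed
  finally show "module_act g (polytabloid l t) X = polytabloid l (map (map g) t) X"
    by (simp add: module_act_def polytabloid_apply)
qed

text \<open>Multiplication by the transposition permutes the column group and reverses all signs in the sum that
  defines the polytabloid.\<close>

lemma module_act_transpose_polytabloid:
  assumes t: "is_tableau l t" and ab: "a \<in> tableau_column t j" "b \<in> tableau_column t j" "a \<noteq> b"
  shows "module_act (Transposition.transpose a b) (polytabloid l t) = fun_scale (-1) (polytabloid l t)"
proof
  fix X
  let ?\<tau> = "Transposition.transpose a b"
  have \<tau>: "?\<tau> \<in> column_group l t" by (rule column_group_transpose[OF t ab(1,2)])
  have bij: "bij_betw ((\<circ>) ?\<tau>) (column_group l t) (column_group l t)"
    by (rule bij_betw_byWitness[where f' = "(\<circ>) ?\<tau>"])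
      (use \<tau> in \<open>auto simp: column_group_comp simp flip: comp_assoc\<close>)
  have "module_act ?\<tau> (polytabloid l t) X =
      (\<Sum>k\<in>column_group l t. of_int (sign k) * of_bool (tabloid_act ?\<tau> X = tabloid_act k (tabloid t)))"
    by (simp add: module_act_def polytabloid_apply)
  also have "\<dots> = (\<Sum>k\<in>column_group l t. of_int (sign (?\<tau> \<circ> k)) *
      of_bool (tabloid_act ?\<tau> X = tabloid_act (?\<tau> \<circ> k) (tabloid t)))"
    by (rule sum.reindex_bij_betw[OF bij, symmetric])
  also have "\<dots> = (\<Sum>k\<in>column_group l t. - (of_int (sign k) * of_bool (X = tabloid_act k (tabloid t))))"
  proof (intro sum.cong refl)
    fix k assume "k \<in> column_group l t"
    then have k: "permutation k" by (rule sym_grp_permutation[OF column_group_sym])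
    have "sign (?\<tau> \<circ> k) = - sign k"
      using k ab(3) by (simp add: sign_compose permutation_swap_id sign_swap_id)
    moreover have "tabloid_act ?\<tau> X = tabloid_act (?\<tau> \<circ> k) (tabloid t) \<longleftrightarrow> X = tabloid_act k (tabloid t)"
      using tabloid_act_inv_eq_iff[OF column_group_sym[OF \<tau>], of X "tabloid_act (?\<tau> \<circ> k) (tabloid t)"]
      by (simp add: tabloid_act_comp flip: comp_assoc)
    ultimately show "of_int (sign (?\<tau> \<circ> k)) * of_bool (tabloid_act ?\<tau> X = tabloid_act (?\<tau> \<circ> k) (tabloid t))
        = - (of_int (sign k) * (of_bool (X = tabloid_act k (tabloid t)) :: complex))"
      by simp
  qed
  finally show "module_act ?\<tau> (polytabloid l t) X = fun_scale (-1) (polytabloid l t) X"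
    by (simp add: polytabloid_apply sum_negf)
qed

lemma is_tableau_map:
  assumes "g \<in> sym_grp (sum_list l)" "is_tableau l t"
  shows "is_tableau l (map (map g) t)"
proof -
  have g: "g permutes {1..sum_list l}" using assms by (simp add: sym_grp_iff)
  have "concat (map (map g) t) = map g (concat t)" by (simp add: map_concat)
  moreover have "inj_on g A" for A using g by (meson permutes_inj inj_on_subset subset_UNIV)
  moreover have "length \<circ> map g = length" by (simp add: fun_eq_iff)
  ultimately show ?thesis
    using assms(2) permutes_image[OF g] by (simp add: is_tableau_def distinct_map)
qed

lemma module_act_specht:
  assumes g: "g \<in> sym_grp (sum_list l)" and v: "v \<in> specht_module l"
  shows "module_act g v \<in> specht_module l"
proof -
  interpret g: Vector_Spaces.linear fun_scale fun_scale "module_act g" by (rule linear_module_act)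
  have "v \<in> cfun.span {polytabloid l t |t. is_tableau l t}"
    using v by (simp add: specht_module_def)
  then show ?thesis
  proof (induction rule: cfun.span_induct_alt)
    case base
    show ?case by (simp only: specht_module_def g.zero cfun.span_zero)
  next
    case (step c x y)
    then obtain t where t: "is_tableau l t" "x = polytabloid l t" by blast
    have "module_act g x \<in> specht_module l"
      unfolding t(2) module_act_polytabloid[OF g] specht_module_def
      using is_tableau_map[OF g t(1)] by (blast intro: cfun.span_base)
    moreover have "module_act g (fun_scale c x + y) = fun_scale c (module_act g x) + module_act g y"
      by (simp only: g.add g.scale)
    ultimately show ?case
      using step.IH unfolding specht_module_def by (simp only: cfun.span_add cfun.span_scale)
  qed
qed

lemma finite_tableaux: "finite {t. is_tableau l t}"
proof (rule finite_subset)
  have "length r \<le> sum_list l" if "is_tableau l t" "r \<in> set t" for t r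
    using that member_le_sum_list[of "length r" l] by (auto simp: is_tableau_def)
  then show "{t. is_tableau l t} \<subseteq> {t. set t \<subseteq> {r. set r \<subseteq> {1..sum_list l} \<and> length r \<le> sum_list l} \<and> length t = length l}"
    by (auto simp: is_tableau_def)
  show "finite \<dots>"
    by (intro finite_lists_length_eq finite_lists_length_le) auto
qed

text \<open>The projection to the fixed vectors, up to the order of the stabilizer as a factor.\<close>

definition symmetrize :: "nat \<Rightarrow> (nat \<Rightarrow> 'c) \<Rightarrow> (nat set list \<Rightarrow> complex) \<Rightarrow> nat set list \<Rightarrow> complex" where
  "symmetrize m w v = (\<Sum>g\<in>stab m w. module_act g v)"

lemma module_act_symmetrize:
  assumes h: "h \<in> stab m w"
  shows "module_act h (symmetrize m w v) = symmetrize m w v"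
proof -
  have "module_act h (symmetrize m w v) = (\<Sum>g\<in>stab m w. module_act (h \<circ> g) v)"
    unfolding symmetrize_def module_act_sum using h
    by (intro sum.cong refl module_act_comp[of _ m]) (auto simp: stab_def)
  also have "\<dots> = symmetrize m w v"
    unfolding symmetrize_def by (rule sum.reindex_bij_betw[OF stab_bij_left[OF h]])
  finally show ?thesis .
qed

lemma symmetrize_module_act:
  assumes h: "h \<in> stab m w"
  shows "symmetrize m w (module_act h v) = symmetrize m w v"
proof -
  have "symmetrize m w (module_act h v) = (\<Sum>g\<in>stab m w. module_act (g \<circ> h) v)"
    unfolding symmetrize_def using h
    by (intro sum.cong refl module_act_comp[of _ m]) (auto simp: stab_def)
  also have "\<dots> = symmetrize m w v"
    unfolding symmetrize_def by (rule sum.reindex_bij_betw[OF stab_bij_right[OF h]])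
  finally show ?thesis .
qed

text \<open>The dimension of this space is the multiplicity of the irreducible character in the permutation
  character on the orbit of \<open>w\<close>.\<close>

definition fixed_specht :: "nat list \<Rightarrow> (nat \<Rightarrow> 'c) \<Rightarrow> (nat set list \<Rightarrow> complex) set" where
  "fixed_specht l w = fixed_vectors (stab (sum_list l) w) module_act (specht_module l)"

lemma symmetrize_in_fixed_specht:
  assumes "v \<in> specht_module l"
  shows "symmetrize (sum_list l) w v \<in> fixed_specht l w"
  unfolding fixed_specht_def fixed_vectors_def
proof (intro CollectI conjI ballI module_act_symmetrize)
  show "symmetrize (sum_list l) w v \<in> specht_module l"
    unfolding symmetrize_def specht_module_def
    by (rule cfun.span_sum)
      (use assms module_act_specht in \<open>auto simp: stab_def specht_module_def\<close>)
qed

lemma sum_irr_char_stab: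
  "(\<Sum>g\<in>stab (sum_list l) w. irr_char l g) =
    of_nat (card (stab (sum_list l) w) * cfun.dim (fixed_specht l w))"
  unfolding irr_char_def fixed_specht_def
proof (rule sum_trace_on_eq_dim_fixed)
  show "finite {polytabloid l t |t. is_tableau l t}"
    using finite_tableaux[of l] by simp
  show "specht_module l = cfun.span {polytabloid l t |t. is_tableau l t}"
    by (rule specht_module_def)
  show "module_act g v \<in> specht_module l" if "g \<in> stab (sum_list l) w" "v \<in> specht_module l" for g v
    using that by (simp add: stab_def module_act_specht)
  show "module_act h (\<Sum>g\<in>stab (sum_list l) w. module_act g v) = (\<Sum>g\<in>stab (sum_list l) w. module_act g v)"
    if "h \<in> stab (sum_list l) w" for h v
    using module_act_symmetrize[OF that] by (simp only: symmetrize_def)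
qed (simp_all add: linear_module_act)

section \<open>Fixed vectors force dominance\<close>

lemma nonzero_dim_obtains:
  assumes "cfun.dim F > 0" obtains v where "v \<in> F" "v \<noteq> 0"
proof -
  obtain C where C: "C \<subseteq> F" "cfun.independent C" "F \<subseteq> cfun.span C" "card C = cfun.dim F"
    by (rule cfun.basis_exists)
  then have "C \<noteq> {}" using assms C(4) by (metis card.empty less_irrefl)
  then obtain c where c: "c \<in> C" by blast
  then have "c \<noteq> 0" using C(2) cfun.dependent_zero by metis
  then show ?thesis using that c C(1) by blast
qed

lemma symmetrize_add: "symmetrize m w (u + v) = symmetrize m w u + symmetrize m w v"
proof
  fix X show "symmetrize m w (u + v) X = (symmetrize m w u + symmetrize m w v) X"
    by (simp add: symmetrize_def module_act_def sum_fun_apply sum.distrib)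
qed

lemma symmetrize_scale: "symmetrize m w (fun_scale c v) = fun_scale c (symmetrize m w v)"
proof
  fix X show "symmetrize m w (fun_scale c v) X = fun_scale c (symmetrize m w v) X"
    by (simp add: symmetrize_def module_act_def sum_fun_apply sum_distrib_left)
qed

text \<open>A fixed vector is a nonzero multiple of its own symmetrization, and the polytabloids span.\<close>

lemma fixed_specht_nonzero_imp_symmetrize_nonzero:
  assumes "cfun.dim (fixed_specht l w) > 0"
  obtains t where "is_tableau l t" "symmetrize (sum_list l) w (polytabloid l t) \<noteq> 0"
proof (rule ccontr)
  let ?m = "sum_list l"
  note obtained = that
  assume no: "\<not> thesis"
  have zero: "symmetrize ?m w (polytabloid l t) = 0" if "is_tableau l t" for t
    using obtained[OF that] no by blast
  obtain v where v: "v \<in> fixed_specht l w" "v \<noteq> 0"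
    using nonzero_dim_obtains[OF assms] .
  have "v \<in> cfun.span {polytabloid l t |t. is_tableau l t}"
    using v(1) by (simp add: fixed_specht_def fixed_vectors_def specht_module_def)
  then have "symmetrize ?m w v = 0"
  proof (induction rule: cfun.span_induct_alt)
    case base
    show ?case by (auto simp: symmetrize_def module_act_def fun_eq_iff sum_fun_apply)
  next
    case (step c x y)
    then have "symmetrize ?m w x = 0" using zero by blast
    moreover have "symmetrize ?m w (fun_scale c x + y) = fun_scale c (symmetrize ?m w x) + symmetrize ?m w y"
      by (simp only: symmetrize_add symmetrize_scale)
    ultimately show ?case using step.IH by (simp only: fun_eq_iff) simp
  qed
  moreover have "symmetrize ?m w v = (\<Sum>g\<in>stab ?m w. v)"
    unfolding symmetrize_def using v(1)
    by (intro sum.cong) (auto simp: fixed_specht_def fixed_vectors_def)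
  then have "symmetrize ?m w v X = of_nat (card (stab ?m w)) * v X" for X
    by (simp add: sum_fun_apply)
  ultimately have "of_nat (card (stab ?m w)) * v X = 0" for X by (simp only: zero_fun_apply)
  then have "v X = 0" for X using card_stab_pos[of ?m w] by (metis mult_eq_0_iff of_nat_eq_0_iff less_irrefl)
  then show False using v(2) by (auto simp: fun_eq_iff)
qed

text \<open>If two entries of a column carried the same letter, their transposition \<open>\<tau>\<close> would lie both in the
  stabilizer, which the symmetrizer absorbs, and in the column group, where it acts on the polytabloid by \<open>-1\<close>. So the
  symmetrization would equal its own negative.\<close>

lemma symmetrize_polytabloid_column_inj:
  assumes t: "is_tableau l t" and nz: "symmetrize (sum_list l) w (polytabloid l t) \<noteq> 0"
  shows "inj_on w (tableau_column t j)"
proof (rule inj_onI, rule ccontr)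
  let ?m = "sum_list l"
  fix a b assume ab: "a \<in> tableau_column t j" "b \<in> tableau_column t j" "w a = w b" "a \<noteq> b"
  let ?\<tau> = "Transposition.transpose a b"
  have "?\<tau> \<in> sym_grp ?m" using column_group_transpose[OF t ab(1,2)] column_group_sym by blast
  moreover have "w \<circ> ?\<tau> = w" using ab(3) by (auto simp: fun_eq_iff Transposition.transpose_def)
  ultimately have "?\<tau> \<in> stab ?m w" by (simp add: stab_def)
  then have "symmetrize ?m w (polytabloid l t) = symmetrize ?m w (module_act ?\<tau> (polytabloid l t))"
    by (rule symmetrize_module_act[symmetric])
  also have "\<dots> = fun_scale (-1) (symmetrize ?m w (polytabloid l t))"
    by (simp only: module_act_transpose_polytabloid[OF t ab(1,2,4)] symmetrize_scale)
  finally have eq: "symmetrize ?m w (polytabloid l t) = \<dots>" .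
  have "symmetrize ?m w (polytabloid l t) X = 0" for X
    using arg_cong[OF eq, of "\<lambda>f. f X"] by (simp add: complex_eq_iff)
  then show False using nz by (auto simp: fun_eq_iff)
qed

lemma finite_tableau_column [simp]: "finite (tableau_column t j)"
  using tableau_column_subset finite_subset by blast

lemma card_tableau_column:
  assumes "is_tableau l t"
  shows "card (tableau_column t j) = card {i. i < length l \<and> j < l ! i}"
proof -
  have l: "length t = length l" "\<And>i. i < length l \<Longrightarrow> length (t ! i) = l ! i"
    using assms by (auto simp: is_tableau_def)
  have "tableau_column t j = (\<lambda>i. t ! i ! j) ` {i. i < length l \<and> j < l ! i}"
  proof -
    have "tableau_column t j = (\<lambda>i. t ! i ! j) ` {i. i < length t \<and> j < length (t ! i)}"
      by (auto simp: tableau_column_def)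
    also have "{i. i < length t \<and> j < length (t ! i)} = {i. i < length l \<and> j < l ! i}"
      using l by auto
    finally show ?thesis .
  qed
  moreover have "inj_on (\<lambda>i. t ! i ! j) {i. i < length l \<and> j < l ! i}"
    using assms l distinct_concat_nth_unique[of t] by (intro inj_onI) (auto simp: is_tableau_def)
  ultimately show ?thesis by (simp add: card_image)
qed

lemma card_filter_eq_sum: "finite A \<Longrightarrow> card {x \<in> A. P x} = (\<Sum>x\<in>A. if P x then 1 else 0)"
  by (simp add: sum.inter_filter[symmetric])

text \<open>The cells of the first \<open>s\<close> rows, counted column by column.\<close>

lemma sum_list_take_conv_cells:
  "sum_list (take s l) = (\<Sum>j<sum_list l. card {i. i < length l \<and> i < s \<and> j < l ! i})" for l :: "nat list"
proof -
  let ?n = "min s (length l)"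
  have row: "(\<Sum>j<sum_list l. if j < l ! i then 1 else 0) = l ! i" if "i < ?n" for i
  proof -
    have "l ! i \<le> sum_list l" using that by (intro member_le_sum_list) auto
    then have "{j \<in> {..<sum_list l}. j < l ! i} = {..<l ! i}" by auto
    then show ?thesis by (simp flip: card_filter_eq_sum)
  qed
  have col: "card {i. i < length l \<and> i < s \<and> j < l ! i} = (\<Sum>i<?n. if j < l ! i then 1 else 0)" for j
  proof -
    have "{i. i < length l \<and> i < s \<and> j < l ! i} = {i \<in> {..<?n}. j < l ! i}" by auto
    then show ?thesis by (simp only: card_filter_eq_sum finite_lessThan)
  qed
  have "(\<Sum>j<sum_list l. card {i. i < length l \<and> i < s \<and> j < l ! i})
      = (\<Sum>i<?n. \<Sum>j<sum_list l. if j < l ! i then 1 else 0)"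
    unfolding col by (rule sum.swap)
  also have "\<dots> = (\<Sum>i<?n. l ! i)"
    by (rule sum.cong[OF refl]) (use row in simp)
  also have "\<dots> = sum_list (take s l)"
    by (simp add: sum_list_sum_nth atLeast0LessThan min.commute)
  finally show ?thesis by simp
qed

text \<open>Some polytabloid \<open>e\<^sub>t\<close> survives symmetrization, so \<open>w\<close> is injective on the columns of \<open>t\<close>. The entries
  with a letter in \<open>I\<close> therefore number at most \<open>min (card I) h\<close> in a column of height \<open>h\<close>, which is the number of cells
  of that column in the first \<open>card I\<close> rows. Summing over the columns gives the bound.\<close>

lemma fixed_specht_nonzero_imp_dominated:
  assumes l: "sorted_wrt (\<ge>) l" and dim: "cfun.dim (fixed_specht l w) > 0" and I: "finite I"
  shows "card {a \<in> {1..sum_list l}. w a \<in> I} \<le> sum_list (take (card I) l)"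
proof -
  let ?m = "sum_list l"
  obtain t where t: "is_tableau l t" "symmetrize (sum_list l) w (polytabloid l t) \<noteq> 0"
    using fixed_specht_nonzero_imp_symmetrize_nonzero[OF dim] .
  let ?X = "\<lambda>j. {a \<in> tableau_column t j. w a \<in> I}"
  let ?R = "\<lambda>j. {i. i < length l \<and> i < card I \<and> j < l ! i}"
  have cols: "{a \<in> {1..?m}. w a \<in> I} \<subseteq> (\<Union>j<?m. ?X j)"
  proof safe
    fix a assume a: "a \<in> {1..?m}" "w a \<in> I"
    obtain j where j: "a \<in> tableau_column t j" using tableau_entry_in_column[OF t(1) a(1)] .
    then obtain i where "i < length t" "j < length (t ! i)" by (auto simp: tableau_column_iff)
    then have "i < length l" "j < l ! i" using t(1) by (auto simp: is_tableau_def)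
    then have "j < ?m" using member_le_sum_list[of "l ! i" l] by auto
    then show "a \<in> (\<Union>j<?m. ?X j)" using a j by auto
  qed
  have "card (?X j) \<le> card (?R j)" for j
  \<comment> \<open>does column \<open>j\<close> reach down to row \<open>card I\<close>, or does it lie entirely in the rows above?\<close>
  proof (cases "\<forall>i<card I. i < length l \<and> j < l ! i")
    case True
    have "inj_on w (?X j)"
      using symmetrize_polytabloid_column_inj[OF t] by (rule inj_on_subset) auto
    then have "card (?X j) \<le> card I" using I by (intro card_inj_on_le[of w]) auto
    also have "?R j = {..<card I}" using True by auto
    then have "card I = card (?R j)" by simp
    finally show ?thesis .
  next
    case False
    then obtain k where k: "k < card I" "k < length l \<Longrightarrow> l ! k \<le> j" by auto
    have mono: "l ! i \<le> l ! k" if "k \<le> i" "i < length l" for i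
      using l that by (cases "k = i") (auto simp: sorted_wrt_iff_nth_less)
    have "i < k" if i: "i < length l" "j < l ! i" for i
    proof (rule ccontr)
      assume "\<not> i < k"
      then have "k \<le> i" by simp
      then show False using mono[OF _ i(1)] k(2) i by fastforce
    qed
    then have "{i. i < length l \<and> j < l ! i} \<subseteq> ?R j" using k by force
    then have "card (tableau_column t j) \<le> card (?R j)"
      unfolding card_tableau_column[OF t(1)] by (intro card_mono) auto
    moreover have "card (?X j) \<le> card (tableau_column t j)" by (intro card_mono) auto
    ultimately show ?thesis by simp
  qed
  note col_bound = this
  have "card {a \<in> {1..?m}. w a \<in> I} \<le> card (\<Union>j<?m. ?X j)"
    by (rule card_mono[OF _ cols]) auto
  also have "\<dots> \<le> (\<Sum>j<?m. card (?X j))" by (rule card_UN_le) auto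
  also have "\<dots> \<le> (\<Sum>j<?m. card (?R j))" by (rule sum_mono) (rule col_bound)
  also have "\<dots> = sum_list (take (card I) l)" by (rule sum_list_take_conv_cells[symmetric])
  finally show ?thesis .
qed

section \<open>Semistandard tableaux give independent fixed vectors\<close>

text \<open>A sum in place of a choice: at most one summand is nonzero, and sums over the entries of a tableau
  become sums over its rows by interchanging summations.\<close>

definition row_index :: "nat list list \<Rightarrow> nat \<Rightarrow> nat" where
  "row_index t a = (\<Sum>i<length t. if a \<in> set (t ! i) then i else 0)"

lemma row_index_eq:
  assumes "distinct (concat t)" "i < length t" "a \<in> set (t ! i)"
  shows "row_index t a = i"
proof -
  have "row_index t a = (\<Sum>i'<length t. if i' = i then i else 0)"
    unfolding row_index_def using distinct_concat_row_unique[OF assms(1)] assms(2,3)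
    by (intro sum.cong) auto
  then show ?thesis using assms(2) by simp
qed

text \<open>This statistic is constant on the orbits of tabloids under the stabilizer of \<open>w\<close>, and every
  column permutation of a column-increasing tableau other than the identity lowers it.
  It thus plays the role of the dominance order on tabloids.\<close>

definition row_weight :: "(nat \<Rightarrow> nat) \<Rightarrow> nat set list \<Rightarrow> nat" where
  "row_weight w X = (\<Sum>i<length X. \<Sum>a\<in>X ! i. i * w a)"

lemma row_weight_act:
  assumes "inj h" shows "row_weight w (tabloid_act h X) = row_weight (w \<circ> h) X"
proof -
  have "(\<Sum>a\<in>h ` A. i * w a) = (\<Sum>a\<in>A. i * w (h a))" for A i
    by (subst sum.reindex) (use assms in \<open>auto intro: inj_on_subset simp: comp_def\<close>)
  then show ?thesis by (simp add: row_weight_def tabloid_act_def)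
qed

lemma row_weight_tabloid:
  assumes t: "is_tableau l t"
  shows "row_weight w (tabloid t) = (\<Sum>a\<in>{1..sum_list l}. row_index t a * w a)"
proof -
  have sub: "set (t ! i) \<subseteq> {1..sum_list l}" if "i < length t" for i
    using t that by (auto simp: is_tableau_def)
  have "(\<Sum>a\<in>{1..sum_list l}. row_index t a * w a)
     = (\<Sum>a\<in>{1..sum_list l}. \<Sum>i<length t. if a \<in> set (t ! i) then i * w a else 0)"
    unfolding row_index_def by (auto simp: sum_distrib_right intro!: sum.cong)
  also have "\<dots> = (\<Sum>i<length t. \<Sum>a\<in>{1..sum_list l}. if a \<in> set (t ! i) then i * w a else 0)"
    by (rule sum.swap)
  also have "\<dots> = (\<Sum>i<length t. \<Sum>a\<in>set (t ! i). i * w a)"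
  proof (rule sum.cong[OF refl])
    fix i assume "i \<in> {..<length t}"
    then show "(\<Sum>a\<in>{1..sum_list l}. if a \<in> set (t ! i) then i * w a else 0) = (\<Sum>a\<in>set (t ! i). i * w a)"
      using sub[of i] by (simp add: sum.inter_restrict[symmetric] Int_absorb1)
  qed
  finally show ?thesis by (simp add: row_weight_def tabloid_def)
qed

definition column_increasing :: "(nat \<Rightarrow> nat) \<Rightarrow> nat list list \<Rightarrow> bool" where
  "column_increasing w t \<longleftrightarrow> (\<forall>i i' j. i < i' \<and> i' < length t \<and> j < length (t ! i) \<and> j < length (t ! i')
     \<longrightarrow> w (t ! i ! j) < w (t ! i' ! j))"

lemma column_row_index:
  assumes "is_tableau l t" "a \<in> tableau_column t j"
  shows "row_index t a < length t \<and> j < length (t ! row_index t a) \<and> t ! row_index t a ! j = a"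
proof -
  obtain i where i: "i < length t" "j < length (t ! i)" "a = t ! i ! j"
    using assms(2) by (auto simp: tableau_column_iff)
  then have "row_index t a = i" using assms(1) by (intro row_index_eq) (auto simp: is_tableau_def)
  then show ?thesis using i by simp
qed

text \<open>A permutation of a column other than the identity has an inversion: let \<open>a\<close> be the topmost entry of the column that \<open>k\<close>
  moves and \<open>b\<close> the entry with \<open>k b = a\<close>. Then \<open>b\<close> lies below \<open>a\<close>, while \<open>k a\<close> lies below \<open>k b\<close>. Undoing this
  inversion increases the weighted sum, as in the rearrangement inequality.\<close>

lemma column_perm_improvable:
  assumes t: "is_tableau l t" and w: "column_increasing w t"
    and k: "k \<in> column_group l t" "k \<noteq> id"
  shows "\<exists>k'\<in>column_group l t.
    (\<Sum>a\<in>{1..sum_list l}. row_index t a * w (k a)) < (\<Sum>a\<in>{1..sum_list l}. row_index t a * w (k' a))"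
proof -
  let ?r = "row_index t" and ?m = "sum_list l"
  have kp: "k permutes {1..?m}" using column_group_sym[OF k(1)] by (simp add: sym_grp_iff)
  have kcol: "k ` tableau_column t j = tableau_column t j" for j
    using k(1) by (simp add: column_group_def)
  obtain x where x: "k x \<noteq> x" using k(2) by (auto simp: fun_eq_iff)
  then have "x \<in> {1..?m}" using permutes_not_in[OF kp, of x] by blast
  then obtain j where j: "x \<in> tableau_column t j" by (rule tableau_entry_in_column[OF t])
  let ?M = "{a \<in> tableau_column t j. k a \<noteq> a}"
  have injk: "k a = k b \<longleftrightarrow> a = b" for a b using permutes_inj[OF kp] by (simp add: inj_eq)
  have pos: "?r a < length t \<and> j < length (t ! ?r a) \<and> t ! ?r a ! j = a" if "a \<in> ?M" for a
    using column_row_index[OF t, of a j] that by simp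
  have injr: "?r a \<noteq> ?r b" if "a \<in> ?M" "b \<in> ?M" "a \<noteq> b" for a b
  proof
    assume "?r a = ?r b"
    then have "t ! ?r a ! j = t ! ?r b ! j" by (rule arg_cong)
    then show False using pos[OF that(1)] pos[OF that(2)] that(3) by linarith
  qed
  have mono: "w a < w b" if ab: "a \<in> ?M" "b \<in> ?M" "?r a < ?r b" for a b
  proof -
    have "w (t ! ?r a ! j) < w (t ! ?r b ! j)"
      by (rule w[unfolded column_increasing_def, rule_format])
        (intro conjI ab(3) pos[OF ab(1), THEN conjunct2, THEN conjunct1] pos[OF ab(2), THEN conjunct1]
          pos[OF ab(2), THEN conjunct2, THEN conjunct1])
    then show ?thesis
      by (simp only: pos[OF ab(1)] pos[OF ab(2)])
  qed
  have "Min (?r ` ?M) \<in> ?r ` ?M" using x j by (intro Min_in) auto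
  then obtain a where a: "a \<in> ?M" "?r a = Min (?r ` ?M)" by auto
  have a_min: "?r a \<le> ?r b" if "b \<in> ?M" for b
    unfolding a(2) using that by (intro Min_le) auto
  have "a \<in> k ` tableau_column t j" using a(1) kcol[of j] by simp
  then obtain b where b: "b \<in> tableau_column t j" "k b = a" by blast
  have bM: "b \<in> ?M" using b a(1) injk[of a b] by auto
  have "k a \<in> tableau_column t j" using a(1) kcol[of j] by blast
  then have kaM: "k a \<in> ?M" using a(1) injk[of "k a" a] by auto
  have "a \<noteq> b" using b(2) a(1) by auto
  then have r_ab: "?r a < ?r b" using a_min[OF bM] injr[OF a(1) bM] by simp
  have "a \<noteq> k a" using a(1) by auto
  then have "?r a < ?r (k a)" using a_min[OF kaM] injr[OF a(1) kaM] by simp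
  then have w_ab: "w (k b) < w (k a)" using mono[OF a(1) kaM] b(2) by simp
  let ?k = "k \<circ> Transposition.transpose a b"
  have mem: "a \<in> {1..?m}" "b \<in> {1..?m}"
    using t a(1) bM tableau_column_subset[of t j] by (auto simp: is_tableau_def)
  have split: "(\<Sum>x\<in>{1..?m}. f x) = f a + (f b + (\<Sum>x\<in>{1..?m}-{a}-{b}. f x))" for f :: "nat \<Rightarrow> nat"
  proof -
    have "(\<Sum>x\<in>{1..?m}. f x) = f a + (\<Sum>x\<in>{1..?m}-{a}. f x)"
      by (rule sum.remove) (use mem in auto)
    also have "(\<Sum>x\<in>{1..?m}-{a}. f x) = f b + (\<Sum>x\<in>{1..?m}-{a}-{b}. f x)"
      by (rule sum.remove) (use mem \<open>a \<noteq> b\<close> in auto)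
    finally show ?thesis .
  qed
  have rest: "(\<Sum>x\<in>{1..?m}-{a}-{b}. ?r x * w (?k x)) = (\<Sum>x\<in>{1..?m}-{a}-{b}. ?r x * w (k x))"
    by (intro sum.cong) (auto simp: Transposition.transpose_def)
  obtain d where d: "?r b = ?r a + d" "d > 0" using less_imp_add_positive[OF r_ab] by metis
  obtain e where e: "w (k a) = w (k b) + e" "e > 0" using less_imp_add_positive[OF w_ab] by metis
  have "?r a * w (k a) + ?r b * w (k b) < ?r a * w (k b) + ?r b * w (k a)"
    unfolding d e using d(2) e(2) by (simp add: algebra_simps)
  then have "(\<Sum>x\<in>{1..?m}. ?r x * w (k x)) < (\<Sum>x\<in>{1..?m}. ?r x * w (?k x))"
    unfolding split[of "\<lambda>x. ?r x * w (k x)"] split[of "\<lambda>x. ?r x * w (?k x)"] rest by simp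
  moreover have "?k \<in> column_group l t"
    using k(1) column_group_transpose[OF t] a(1) bM by (intro column_group_comp) auto
  ultimately show ?thesis by blast
qed

text \<open>Among the finitely many column permutations one attains the maximal weight, and every permutation
  other than the identity can be improved. Hence the identity is the unique maximum.\<close>

lemma row_weight_column_perm_less:
  assumes t: "is_tableau l t" and w: "column_increasing w t"
    and k: "k \<in> column_group l t" "k \<noteq> id"
  shows "row_weight w (tabloid_act k (tabloid t)) < row_weight w (tabloid t)"
proof -
  let ?G = "column_group l t"
  define F where "F k = (\<Sum>a\<in>{1..sum_list l}. row_index t a * w (k a))" for k :: "nat \<Rightarrow> nat"
  have improve: "\<exists>k'\<in>?G. F k < F k'" if "k \<in> ?G" "k \<noteq> id" for k
    using column_perm_improvable[OF t w that] by (simp add: F_def)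
  have fin: "finite (F ` ?G)" by simp
  have "Max (F ` ?G) \<in> F ` ?G" by (rule Max_in[OF fin]) (use column_group_id in blast)
  then obtain k0 where k0: "k0 \<in> ?G" "F k0 = Max (F ` ?G)" by auto
  have max: "F k' \<le> F k0" if "k' \<in> ?G" for k' using that k0 fin by auto
  have "k0 = id" using improve[OF k0(1)] max by (meson not_less)
  then have "F k < F id" using improve[OF k] max by (metis le_less_trans not_less less_le_trans)
  moreover have "row_weight w (tabloid_act k (tabloid t)) = F k"
    using k(1) by (simp add: row_weight_act row_weight_tabloid[OF t] F_def bij_is_inj sym_grp_bij[OF column_group_sym])
  moreover have "row_weight w (tabloid t) = F id"
    by (simp add: row_weight_tabloid[OF t] F_def)
  ultimately show ?thesis by simp
qed

text \<open>Evaluate a linear relation at the point \<open>x j\<close> of an index \<open>j\<close> of maximal rank among the indices with nonzero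
  coefficient: every other term vanishes there. Ties in rank are allowed, so \<open>rk\<close> is a mere number and not an
  injective labelling.\<close>

lemma triangular_family_independent:
  fixes v :: "'i \<Rightarrow> 'a \<Rightarrow> complex" and rk :: "'i \<Rightarrow> nat"
  assumes I: "finite I" and diag: "\<And>i. i \<in> I \<Longrightarrow> v i (x i) \<noteq> 0"
    and tri: "\<And>i j. i \<in> I \<Longrightarrow> j \<in> I \<Longrightarrow> v i (x j) \<noteq> 0 \<Longrightarrow> i \<noteq> j \<Longrightarrow> rk j < rk i"
  shows "inj_on v I \<and> cfun.independent (v ` I)"
proof
  show inj: "inj_on v I"
  proof (rule inj_onI, rule ccontr)
    fix i j assume ij: "i \<in> I" "j \<in> I" "v i = v j" "i \<noteq> j"
    then have "v i (x j) \<noteq> 0" "v j (x i) \<noteq> 0" using diag by metis+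
    then have "rk j < rk i" "rk i < rk j" using tri ij by metis+
    then show False by simp
  qed
  show "cfun.independent (v ` I)"
  proof
    assume "cfun.dependent (v ` I)"
    then obtain u y where u: "y \<in> v ` I" "u y \<noteq> 0" "(\<Sum>y\<in>v ` I. fun_scale (u y) y) = 0"
      using cfun.dependent_finite[of "v ` I"] I by auto
    define J where "J = {i \<in> I. u (v i) \<noteq> 0}"
    have J: "finite J" "J \<noteq> {}" using I u(1,2) by (auto simp: J_def)
    have "Max (rk ` J) \<in> rk ` J" using J by (intro Max_in) auto
    then obtain j where j: "j \<in> J" "rk j = Max (rk ` J)" by auto
    have max: "rk i \<le> rk j" if "i \<in> J" for i using that j J by auto
    have "0 = (\<Sum>y\<in>v ` I. fun_scale (u y) y) (x j)" using u(3) by simp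
    also have "\<dots> = (\<Sum>i\<in>I. u (v i) * v i (x j))"
      by (simp add: sum_fun_apply sum.reindex[OF inj])
    also have "\<dots> = (\<Sum>i\<in>I. if i = j then u (v j) * v j (x j) else 0)"
    proof (intro sum.cong refl)
      fix i assume i: "i \<in> I"
      show "u (v i) * v i (x j) = (if i = j then u (v j) * v j (x j) else 0)"
      proof (cases "u (v i) = 0")
        case False
        then have "\<not> rk j < rk i" using max[of i] i by (simp add: J_def)
        then show ?thesis using tri[OF i, of j] j(1) by (auto simp: J_def)
      qed (use j(1) in \<open>auto simp: J_def\<close>)
    qed
    also have "\<dots> = u (v j) * v j (x j)" using I j(1) by (simp add: J_def)
    finally show False using j(1) diag by (auto simp: J_def)
  qed
qed

lemma finite_ssyt: "finite {T. is_ssyt l \<nu> T}"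
proof (rule finite_subset)
  have "length r \<le> sum_list l" if "is_ssyt l \<nu> T" "r \<in> set T" for T r
    using that member_le_sum_list[of "length r" l] by (auto simp: is_ssyt_def)
  then show "{T. is_ssyt l \<nu> T} \<subseteq> {T. set T \<subseteq> {r. set r \<subseteq> {1..length \<nu>} \<and> length r \<le> sum_list l} \<and> length T = length l}"
    by (auto simp: is_ssyt_def)
  show "finite \<dots>"
    by (intro finite_lists_length_eq finite_lists_length_le) auto
qed

lemma ex_mset_preimage:
  assumes "mset (map f xs) = mset ys" shows "\<exists>zs. mset zs = mset xs \<and> map f zs = ys"
  using assms
proof (induction ys arbitrary: xs)
  case (Cons y ys)
  then have "y \<in> set (map f xs)" by (metis list.set_intros(1) mset_eq_setD)
  then obtain us x vs where xs: "xs = us @ x # vs" "f x = y" by (auto simp: in_set_conv_decomp)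
  then have "mset (map f (us @ vs)) = mset ys" using Cons.prems by simp
  then obtain zs where "mset zs = mset (us @ vs)" "map f zs = ys" using Cons.IH by blast
  then show ?case using xs by (intro exI[of _ "x # zs"]) simp
qed simp

lemma lift_filling:
  assumes "map w zs = concat T" shows "\<exists>t. concat t = zs \<and> map (map w) t = T"
  using assms
proof (induction T arbitrary: zs)
  case (Cons r T)
  then obtain us vs where "zs = us @ vs" "map w us = r" "map w vs = concat T"
    by (auto simp: map_eq_append_conv)
  moreover obtain t where "concat t = vs" "map (map w) t = T" using Cons.IH calculation(3) by blast
  ultimately show ?case by (intro exI[of _ "us # t"]) simp
qed (auto intro: exI[of _ "[]"])

lemma count_list_map_distinct:
  assumes "distinct xs" shows "count_list (map f xs) y = card {x \<in> set xs. f x = y}"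
proof -
  have "count_list (map f xs) y = length (filter (\<lambda>x. f x = y) xs)"
    by (induction xs) auto
  also have "\<dots> = card (set (filter (\<lambda>x. f x = y) xs))"
    using assms by (metis distinct_card distinct_filter)
  finally show ?thesis by simp
qed

lemma ssyt_column_less:
  assumes l: "sorted_wrt (\<ge>) l" and T: "is_ssyt l \<nu> T"
    and ij: "i < i'" "i' < length T" "j < length (T ! i')"
  shows "T ! i ! j < T ! i' ! j"
  using ij
proof (induction i')
  case (Suc i')
  have len: "length T = length l" "\<And>i. i < length l \<Longrightarrow> length (T ! i) = l ! i"
    using T by (auto simp: is_ssyt_def)
  have "l ! Suc i' \<le> l ! i'"
    using l Suc.prems(2) len(1) by (auto simp: sorted_wrt_iff_nth_less)
  then have j: "j < length (T ! i')" using Suc.prems len by simp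
  then have step: "T ! i' ! j < T ! Suc i' ! j"
    using T Suc.prems by (simp add: is_ssyt_def)
  show ?case
  proof (cases "i = i'")
    case False
    then have "T ! i ! j < T ! i' ! j" using Suc.IH Suc.prems j by simp
    then show ?thesis using step by simp
  qed (use step in simp)
qed simp

text \<open>The letters of a filling with content \<open>\<nu>\<close> and the letters of \<open>w\<close> form the same multiset, so the positions
  of the word \<open>w\<close> can be distributed over the cells of the filling.\<close>

lemma ssyt_tableau_exists:
  assumes range: "\<And>a. a \<in> {1..sum_list l} \<Longrightarrow> w a \<in> {1..length \<nu>}"
    and cnt: "\<And>k. k < length \<nu> \<Longrightarrow> card {a \<in> {1..sum_list l}. w a = Suc k} = \<nu> ! k"
    and T: "is_ssyt l \<nu> T"
  shows "\<exists>t. is_tableau l t \<and> map (map w) t = T"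
proof -
  let ?xs = "[1..<Suc (sum_list l)]"
  have set_xs: "set ?xs = {1..sum_list l}" by auto
  have "count_list (map w ?xs) y = count_list (concat T) y" for y
  proof (cases "y \<in> {1..length \<nu>}")
    case True
    then obtain k where k: "y = Suc k" "k < length \<nu>" by (cases y) auto
    have "count_list (map w ?xs) y = card {a \<in> set ?xs. w a = y}"
      by (rule count_list_map_distinct) simp
    also have "\<dots> = \<nu> ! k" unfolding set_xs using cnt[OF k(2)] k(1) by simp
    finally show ?thesis using T k by (simp add: is_ssyt_def)
  next
    case False
    then have "y \<notin> set (concat T)" using T by (auto simp: is_ssyt_def)
    moreover have "y \<notin> set (map w ?xs)" using False range unfolding set_map set_xs by blast
    ultimately show ?thesis by (metis count_notin)
  qed
  then have "mset (map w ?xs) = mset (concat T)"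
    by (intro multiset_eqI) (simp only: count_mset)
  then obtain zs where zs: "mset zs = mset ?xs" "map w zs = concat T"
    using ex_mset_preimage by blast
  obtain t where t: "concat t = zs" "map (map w) t = T"
    using lift_filling[OF zs(2)] by blast
  have "map length t = map length T" unfolding t(2)[symmetric] by simp
  then have "map length t = l" using T by (simp add: is_ssyt_def)
  moreover have "distinct zs" using zs(1) by (metis distinct_upt mset_eq_imp_distinct_iff)
  moreover have "set zs = {1..sum_list l}" using zs(1) set_xs by (metis mset_eq_setD)
  ultimately have "is_tableau l t" by (simp add: is_tableau_def t(1))
  then show ?thesis using t(2) by blast
qed

text \<open>The action of \<open>h\<close> preserves the letters, so the corresponding rows carry the same multiset of letters,
  and sorted rows with the same multiset are equal.\<close>

lemma tabloid_orbit_imp_same_filling: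
  assumes t: "is_tableau l t" "is_tableau l t'" and h: "h \<in> stab (sum_list l) w"
    and eq: "tabloid_act h (tabloid t') = tabloid t"
    and sorted: "\<And>i. i < length t \<Longrightarrow> sorted (map w (t ! i))" "\<And>i. i < length t' \<Longrightarrow> sorted (map w (t' ! i))"
  shows "map (map w) t' = map (map w) t"
proof (rule nth_equalityI)
  have len: "length t' = length t" using t unfolding is_tableau_def by (metis length_map)
  then show "length (map (map w) t') = length (map (map w) t)" by simp
  fix i assume "i < length (map (map w) t')"
  then have i: "i < length t" "i < length t'" using len by auto
  have "h ` set (t' ! i) = set (t ! i)"
    using arg_cong[OF eq, of "\<lambda>X. X ! i"] i by (simp add: tabloid_act_def tabloid_def)
  moreover have dist: "distinct (t ! i)" "distinct (t' ! i)"
    using t i by (auto simp: is_tableau_def distinct_concat_iff)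
  moreover have "inj h" using h by (auto simp: stab_def bij_is_inj sym_grp_bij)
  ultimately have "mset (t ! i) = image_mset h (mset (t' ! i))"
    by (metis image_mset_mset_set inj_on_subset mset_set_set subset_UNIV)
  then have "mset (map w (t ! i)) = image_mset (w \<circ> h) (mset (t' ! i))"
    by (simp add: multiset.map_comp)
  also have "\<dots> = mset (map w (t' ! i))" using h by (simp add: stab_def)
  finally have "map w (t ! i) = map w (t' ! i)"
    using sorted(1)[OF i(1)] sorted(2)[OF i(2)] by (metis properties_for_sort)
  then show "map (map w) t' ! i = map (map w) t ! i" using i by simp
qed

lemma symmetrize_polytabloid_apply:
  "symmetrize m w (polytabloid l t) X = (\<Sum>h\<in>stab m w. \<Sum>k\<in>column_group l t.
     of_int (sign k) * of_bool (tabloid_act (finv h) X = tabloid_act k (tabloid t)))"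
  by (simp only: symmetrize_def sum_fun_apply module_act_def polytabloid_apply)

lemma row_weight_stab:
  assumes "h \<in> stab m w" shows "row_weight w (tabloid_act h X) = row_weight w X"
proof -
  have "inj h" using assms by (auto simp: stab_def intro: bij_is_inj sym_grp_bij)
  then show ?thesis using assms by (simp add: stab_def row_weight_act)
qed

text \<open>This is the lower bound in Young's rule. Every semistandard \<open>T\<close> is the image under \<open>w\<close> of some tableau
  \<open>t\<close>, and \<open>v T\<close> is the symmetrization of the polytabloid of \<open>t\<close>. It is a combination of tabloids \<open>h k {t}\<close> with \<open>h\<close>
  in the stabilizer and \<open>k\<close> in the column group, whose weight is that of \<open>{t}\<close> if \<open>k\<close> is the identity and smaller
  otherwise. So the matrix of values of the vectors \<open>v T\<close> at the tabloids of the chosen tableaux is triangular with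
  nonzero diagonal.\<close>

theorem kostka_le_dim_fixed_specht:
  assumes l: "sorted_wrt (\<ge>) l"
    and range: "\<And>a. a \<in> {1..sum_list l} \<Longrightarrow> w a \<in> {1..length \<nu>}"
    and cnt: "\<And>k. k < length \<nu> \<Longrightarrow> card {a \<in> {1..sum_list l}. w a = Suc k} = \<nu> ! k"
  shows "kostka l \<nu> \<le> cfun.dim (fixed_specht l w)"
proof -
  let ?m = "sum_list l" and ?SSYT = "{T. is_ssyt l \<nu> T}"
  define tab where "tab T = (SOME t. is_tableau l t \<and> map (map w) t = T)" for T
  have tab: "is_tableau l (tab T)" "map (map w) (tab T) = T" if "is_ssyt l \<nu> T" for T
    using someI_ex[OF ssyt_tableau_exists[OF range cnt that]] by (simp_all add: tab_def)
  define v where "v T = symmetrize ?m w (polytabloid l (tab T))" for T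
  define x where "x T = tabloid (tab T)" for T
  define rk where "rk T = row_weight w (x T)" for T
  have sorted: "sorted (map w (tab T ! i))" if "is_ssyt l \<nu> T" "i < length (tab T)" for T i
  proof -
    have "map w (tab T ! i) = T ! i" using tab(2)[OF that(1)] that(2) by (metis nth_map)
    moreover have "T ! i \<in> set T" using tab(2)[OF that(1)] that(2) by (metis length_map nth_mem)
    ultimately show ?thesis using that(1) by (simp add: is_ssyt_def)
  qed
  have incr: "column_increasing w (tab T)" if T: "is_ssyt l \<nu> T" for T
    unfolding column_increasing_def
  proof (intro allI impI)
    fix i i' j assume A: "i < i' \<and> i' < length (tab T) \<and> j < length (tab T ! i) \<and> j < length (tab T ! i')"
    have nth: "T ! k = map w (tab T ! k)" if "k < length (tab T)" for k
      using tab(2)[OF T] that by (metis nth_map)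
    have len: "length T = length (tab T)" using tab(2)[OF T] by (metis length_map)
    have "T ! i ! j < T ! i' ! j"
      by (rule ssyt_column_less[OF l T]) (use A nth len in auto)
    then show "w (tab T ! i ! j) < w (tab T ! i' ! j)" using A nth by simp
  qed
  have weight: "k = id \<or> row_weight w X < rk T"
    if "is_ssyt l \<nu> T" "h \<in> stab ?m w" "k \<in> column_group l (tab T)"
      "tabloid_act (finv h) X = tabloid_act k (x T)" for T h k X
  proof (cases "k = id")
    case False
    have "row_weight w X = row_weight w (tabloid_act k (x T))"
      using row_weight_stab[OF stab_inv[OF that(2)], of X] that(4) by simp
    also have "\<dots> < rk T"
      unfolding rk_def x_def using that(1,3) False tab(1) incr by (intro row_weight_column_perm_less) auto
    finally show ?thesis by simp
  qed simp
  have diag: "v T (x T) \<noteq> 0" if T: "is_ssyt l \<nu> T" for T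
  proof -
    let ?S = "\<lambda>h. \<Sum>k\<in>column_group l (tab T). of_int (sign k) * of_bool (tabloid_act (finv h) (x T) = tabloid_act k (x T)) :: complex"
    have "?S h
        = of_bool (tabloid_act (finv h) (x T) = x T)" if h: "h \<in> stab ?m w" for h
    proof -
      have "?S h
        = (\<Sum>k\<in>column_group l (tab T). if k = id then of_bool (tabloid_act (finv h) (x T) = x T) else 0 :: complex)"
      proof (rule sum.cong[OF refl])
        fix k assume k: "k \<in> column_group l (tab T)"
        show "of_int (sign k) * of_bool (tabloid_act (finv h) (x T) = tabloid_act k (x T)) =
          (if k = id then of_bool (tabloid_act (finv h) (x T) = x T) else 0 :: complex)"
          using weight[OF T h k, of "x T"] by (auto simp: rk_def)
      qed
      then show ?thesis by simp
    qed
    then have "v T (x T) = (\<Sum>h\<in>stab ?m w. of_bool (tabloid_act (finv h) (x T) = x T))"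
      unfolding v_def symmetrize_polytabloid_apply x_def by (rule sum.cong[OF refl])
    also have "\<dots> = of_nat (card {h \<in> stab ?m w. tabloid_act (finv h) (x T) = x T})"
      by (simp add: sum_of_bool_eq Int_def)
    also have "\<dots> \<noteq> 0"
    proof -
      have "{id} \<subseteq> {h \<in> stab ?m w. tabloid_act (finv h) (x T) = x T}" by simp
      then have "card {id :: nat \<Rightarrow> nat} \<le> card {h \<in> stab ?m w. tabloid_act (finv h) (x T) = x T}"
        by (intro card_mono) auto
      moreover have "card {id :: nat \<Rightarrow> nat} = 1" by simp
      ultimately have "card {h \<in> stab ?m w. tabloid_act (finv h) (x T) = x T} \<noteq> 0"
        by linarith
      then show ?thesis unfolding of_nat_eq_0_iff .
    qed
    finally show ?thesis .
  qed
  have tri: "rk T' < rk T" if T: "is_ssyt l \<nu> T" "is_ssyt l \<nu> T'" "v T (x T') \<noteq> 0" "T \<noteq> T'" for T T'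
  proof -
    obtain h where h: "h \<in> stab ?m w" "(\<Sum>k\<in>column_group l (tab T).
       of_int (sign k) * of_bool (tabloid_act (finv h) (x T') = tabloid_act k (tabloid (tab T)))) \<noteq> (0::complex)"
      using T(3) unfolding v_def symmetrize_polytabloid_apply by (meson sum.neutral)
    obtain k where k: "k \<in> column_group l (tab T)"
       "of_int (sign k) * of_bool (tabloid_act (finv h) (x T') = tabloid_act k (tabloid (tab T))) \<noteq> (0::complex)"
      using h(2) by (meson sum.neutral)
    then have eq: "tabloid_act (finv h) (x T') = tabloid_act k (x T)" by (auto simp: x_def of_bool_def split: if_splits)
    have "k \<noteq> id"
    proof
      assume "k = id"
      then have "tabloid_act (finv h) (tabloid (tab T')) = tabloid (tab T)" using eq by (simp add: x_def)
      then have "map (map w) (tab T') = map (map w) (tab T)"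
        using T(1,2) tab(1) stab_inv[OF h(1)] sorted by (intro tabloid_orbit_imp_same_filling[of l _ _ "finv h"]) auto
      then show False using T tab(2) by simp
    qed
    then show ?thesis using weight[OF T(1) h(1) k(1) eq] by (simp add: rk_def)
  qed
  have indep: "inj_on v ?SSYT \<and> cfun.independent (v ` ?SSYT)"
    by (rule triangular_family_independent[OF finite_ssyt, where x = x and rk = rk])
      (use diag tri in auto)
  obtain C where C: "C \<subseteq> fixed_specht l w" "cfun.independent C" "fixed_specht l w \<subseteq> cfun.span C"
      "card C = cfun.dim (fixed_specht l w)"
    by (rule cfun.basis_exists)
  have "finite {polytabloid l t |t. is_tableau l t}" using finite_tableaux[of l] by simp
  moreover have "C \<subseteq> cfun.span {polytabloid l t |t. is_tableau l t}"
    using C(1) by (auto simp: fixed_specht_def fixed_vectors_def specht_module_def)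
  ultimately have finC: "finite C" using cfun.independent_span_bound C(2) by blast
  have "v T \<in> fixed_specht l w" if "is_ssyt l \<nu> T" for T
    unfolding v_def using tab(1)[OF that]
    by (intro symmetrize_in_fixed_specht) (auto simp: specht_module_def intro: cfun.span_base)
  then have "v ` ?SSYT \<subseteq> cfun.span C" using C(3) by blast
  then have "card (v ` ?SSYT) \<le> card C"
    using cfun.independent_span_bound[OF finC] indep by blast
  then show ?thesis
    using indep C(4) by (simp add: kostka_def card_image)
qed

section \<open>Permutation characters and words\<close>

lemma card_eq_sum_fibres:
  assumes "finite A" "finite B" "f ` A \<subseteq> B"
  shows "card A = (\<Sum>b\<in>B. card {a \<in> A. f a = b})"
  using sum.group[OF assms, of "\<lambda>_. 1 :: nat"] by simp

lemma comp_finv_eq_iff: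
  assumes x: "x \<in> sym_grp m" shows "w \<circ> finv x = u \<longleftrightarrow> u \<circ> x = w"
proof
  assume "w \<circ> finv x = u"
  then have "u \<circ> x = w \<circ> (finv x \<circ> x)" by (simp only: comp_assoc[symmetric])
  then show "u \<circ> x = w" using x by simp
next
  assume "u \<circ> x = w"
  then have "w \<circ> finv x = u \<circ> (x \<circ> finv x)" by (simp only: comp_assoc[symmetric])
  then show "w \<circ> finv x = u" using x by simp
qed

text \<open>A transporter from \<open>u\<close> to \<open>w\<close> is a coset of the stabilizer of \<open>w\<close>.\<close>

lemma card_transporter:
  assumes x0: "x0 \<in> sym_grp m" "u \<circ> x0 = w"
  shows "card {x \<in> sym_grp m. u \<circ> x = w} = card (stab m w)"
proof (rule bij_betw_same_card[symmetric])
  show "bij_betw ((\<circ>) x0) (stab m w) {x \<in> sym_grp m. u \<circ> x = w}"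
  proof (rule bij_betw_byWitness[where f' = "(\<circ>) (finv x0)"])
    show "\<forall>a\<in>stab m w. finv x0 \<circ> (x0 \<circ> a) = a"
      "\<forall>a\<in>{x \<in> sym_grp m. u \<circ> x = w}. x0 \<circ> (finv x0 \<circ> a) = a"
      using x0(1) by (simp_all flip: comp_assoc)
    show "(\<circ>) x0 ` stab m w \<subseteq> {x \<in> sym_grp m. u \<circ> x = w}"
      using x0 by (auto simp: stab_def sym_grp_comp simp flip: comp_assoc)
    show "(\<circ>) (finv x0) ` {x \<in> sym_grp m. u \<circ> x = w} \<subseteq> stab m w"
    proof safe
      fix x assume x: "x \<in> sym_grp m" "w = u \<circ> x"
      have "(u \<circ> x0) \<circ> (finv x0 \<circ> x) = u \<circ> (x0 \<circ> finv x0) \<circ> x" by (simp only: comp_assoc)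
      also have "\<dots> = u \<circ> x" using x0(1) by simp
      finally show "finv x0 \<circ> x \<in> stab m (u \<circ> x)"
        using x x0 by (simp add: stab_def sym_grp_comp sym_grp_inv)
    qed
  qed
qed

text \<open>The orbit-stabilizer theorem, stated with the stabilizer of every point: the fibre of \<open>x \<mapsto> w \<circ> x\<close>
  over \<open>w'\<close> is a coset of the stabilizer of \<open>w'\<close>.\<close>

lemma sum_card_stab_orbit:
  "(\<Sum>w'\<in>(\<circ>) w ` sym_grp m. card (stab m w')) = fact m"
proof -
  have "card {x \<in> sym_grp m. w \<circ> x = w'} = card (stab m w')" if "w' \<in> (\<circ>) w ` sym_grp m" for w'
    using that card_transporter[of _ m w] by blast
  then show ?thesis
    using card_eq_sum_fibres[of "sym_grp m" "(\<circ>) w ` sym_grp m" "(\<circ>) w"]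
    by (simp add: card_sym_grp)
qed

text \<open>The words with \<open>l ! i\<close> occurrences of the letter \<open>i\<close>, on which the symmetric group acts by permuting positions.
  The value \<open>0\<close> outside of \<open>{1..sum_list l}\<close> makes a word a single function.\<close>

definition words :: "nat list \<Rightarrow> (nat \<Rightarrow> nat) set" where
  "words l = {u. (\<forall>a. (a \<in> {1..sum_list l} \<longrightarrow> u a \<in> {..<length l}) \<and> (a \<notin> {1..sum_list l} \<longrightarrow> u a = 0)) \<and>
     (\<forall>i<length l. card {a \<in> {1..sum_list l}. u a = i} = l ! i)}"

lemma finite_words: "finite (words l)"
proof (rule finite_subset)
  show "words l \<subseteq> {u. \<forall>a. (a \<in> {1..sum_list l} \<longrightarrow> u a \<in> {..<length l}) \<and> (a \<notin> {1..sum_list l} \<longrightarrow> u a = 0)}"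
    by (auto simp: words_def)
qed (rule finite_set_of_finite_funs; simp)

lemma card_letter_perm:
  assumes "g \<in> sym_grp m"
  shows "card {a \<in> {1..m}. (u \<circ> g) a = i} = card {a \<in> {1..m}. u a = i}"
proof (rule bij_betw_same_card)
  have g: "g permutes {1..m}" using assms by (simp add: sym_grp_iff)
  show "bij_betw g {a \<in> {1..m}. (u \<circ> g) a = i} {a \<in> {1..m}. u a = i}"
  proof (rule bij_betw_imageI)
    show "inj_on g {a \<in> {1..m}. (u \<circ> g) a = i}"
      using permutes_inj[OF g] by (rule inj_on_subset) simp
    show "g ` {a \<in> {1..m}. (u \<circ> g) a = i} = {a \<in> {1..m}. u a = i}"
    proof (intro equalityI subsetI)
      fix b assume b: "b \<in> {a \<in> {1..m}. u a = i}"
      then have "b \<in> g ` {1..m}" using permutes_image[OF g] by simp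
      then obtain a where "a \<in> {1..m}" "g a = b" by blast
      then show "b \<in> g ` {a \<in> {1..m}. (u \<circ> g) a = i}" using b by auto
    next
      fix b assume "b \<in> g ` {a \<in> {1..m}. (u \<circ> g) a = i}"
      then obtain a where a: "a \<in> {1..m}" "u (g a) = i" "b = g a" by auto
      then have "g a \<in> {1..m}" using permutes_in_image[OF g, of a] by simp
      then show "b \<in> {a \<in> {1..m}. u a = i}" using a by simp
    qed
  qed
qed

lemma words_comp:
  assumes "u \<in> words l" "g \<in> sym_grp (sum_list l)" shows "u \<circ> g \<in> words l"
proof -
  have g: "g permutes {1..sum_list l}" using assms(2) by (simp add: sym_grp_iff)
  have "u (g a) < length l" if "a \<in> {1..sum_list l}" for a
    using assms(1) permutes_in_image[OF g, of a] that by (simp add: words_def)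
  moreover have "u (g a) = 0" if "a \<notin> {1..sum_list l}" for a
    using assms(1) permutes_not_in[OF g that] that by (simp add: words_def)
  moreover have "card {a \<in> {1..sum_list l}. (u \<circ> g) a = i} = l ! i" if "i < length l" for i
    unfolding card_letter_perm[OF assms(2)] using assms(1) that by (simp add: words_def)
  ultimately show ?thesis by (simp add: words_def)
qed

lemma words_transitive:
  assumes u: "u \<in> words l" and u': "u' \<in> words l"
  obtains x where "x \<in> sym_grp (sum_list l)" "u \<circ> x = u'"
proof -
  let ?A = "{1..sum_list l}"
  have "count (image_mset u' (mset_set ?A)) i = count (image_mset u (mset_set ?A)) i" for i
  proof -
    have "card {a \<in> ?A. u' a = i} = card {a \<in> ?A. u a = i}"
    proof (cases "i < length l")
      case False
      then have "{a \<in> ?A. u' a = i} = {}" "{a \<in> ?A. u a = i} = {}" using u u' by (auto simp: words_def)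
      then show ?thesis by (simp only:)
    qed (use u u' in \<open>simp add: words_def\<close>)
    then show ?thesis by (simp only: count_image_mset_eq_card_vimage finite_atLeastAtMost)
  qed
  then have "image_mset u' (mset_set ?A) = image_mset u (mset_set ?A)" by (rule multiset_eqI)
  then obtain p where p: "p permutes ?A" "\<forall>a\<in>?A. u' a = u (p a)"
    by (rule image_mset_eq_implies_permutes[OF finite_atLeastAtMost])
  have "(u \<circ> p) a = u' a" for a
  proof (cases "a \<in> ?A")
    case False
    then have "p a = a" using permutes_not_in[OF p(1)] by blast
    then show ?thesis using False u u' by (simp add: words_def)
  qed (use p(2) in simp)
  then have "u \<circ> p = u'" by (rule ext)
  moreover have "p \<in> sym_grp (sum_list l)" using p(1) by (simp only: sym_grp_iff)
  ultimately show ?thesis using that by blast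
qed

text \<open>The word \<open>0\<dots>01\<dots>12\<dots>\<close>, whose stabilizer is the standard Young subgroup.\<close>

definition block_word :: "nat list \<Rightarrow> nat \<Rightarrow> nat" where
  "block_word l a = (if a \<in> {1..sum_list l} then LEAST i. a \<le> sum_list (take (Suc i) l) else 0)"

lemma sum_list_take_mono: "i \<le> j \<Longrightarrow> sum_list (take i l) \<le> sum_list (take j l)" for l :: "nat list"
  by (metis le_add1 le_add_diff_inverse sum_list_append take_add)

lemma block_word_less:
  assumes "a \<in> {1..sum_list l}" shows "block_word l a < length l"
proof -
  have "l \<noteq> []" using assms by auto
  then have "a \<le> sum_list (take (Suc (length l - 1)) l)" using assms by simp
  then have "(LEAST i. a \<le> sum_list (take (Suc i) l)) \<le> length l - 1" by (rule Least_le)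
  moreover have "block_word l a = (LEAST i. a \<le> sum_list (take (Suc i) l))"
    using assms unfolding block_word_def by (rule if_P)
  moreover have "length l > 0" using \<open>l \<noteq> []\<close> by simp
  ultimately show ?thesis by linarith
qed

lemma block_word_iff:
  assumes i: "i < length l"
  shows "a \<in> {1..sum_list l} \<and> block_word l a = i \<longleftrightarrow> a \<in> {sum_list (take i l)<..sum_list (take (Suc i) l)}"
proof
  assume a: "a \<in> {sum_list (take i l)<..sum_list (take (Suc i) l)}"
  have "sum_list (take (Suc i) l) \<le> sum_list l"
    using sum_list_take_mono[of "Suc i" "length l" l] i by simp
  then have rng: "a \<in> {1..sum_list l}" using a by auto
  have "(LEAST k. a \<le> sum_list (take (Suc k) l)) = i"
  proof (rule Least_equality)
    fix k assume k: "a \<le> sum_list (take (Suc k) l)"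
    show "i \<le> k"
    proof (rule ccontr)
      assume "\<not> i \<le> k"
      then have "sum_list (take (Suc k) l) \<le> sum_list (take i l)" by (intro sum_list_take_mono) simp
      then show False using a k by simp
    qed
  qed (use a in simp)
  then show "a \<in> {1..sum_list l} \<and> block_word l a = i" using rng by (simp add: block_word_def)
next
  assume a: "a \<in> {1..sum_list l} \<and> block_word l a = i"
  then have L: "(LEAST k. a \<le> sum_list (take (Suc k) l)) = i" by (auto simp: block_word_def)
  have "l \<noteq> []" using i by auto
  then have "a \<le> sum_list (take (Suc (length l - 1)) l)" using a by simp
  then have up: "a \<le> sum_list (take (Suc i) l)" using LeastI[of "\<lambda>k. a \<le> sum_list (take (Suc k) l)"] L by blast
  have "sum_list (take i l) < a"
  proof (cases i)
    case (Suc k)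
    then have "\<not> a \<le> sum_list (take (Suc k) l)" using not_less_Least[of k "\<lambda>k. a \<le> sum_list (take (Suc k) l)"] L by simp
    then show ?thesis using Suc by simp
  qed (use a in simp)
  then show "a \<in> {sum_list (take i l)<..sum_list (take (Suc i) l)}" using up by simp
qed

lemma block_word_in_words: "block_word l \<in> words l"
proof -
  have "card {a \<in> {1..sum_list l}. block_word l a = i} = l ! i" if i: "i < length l" for i
  proof -
    have "{a \<in> {1..sum_list l}. block_word l a = i} = {sum_list (take i l)<..sum_list (take (Suc i) l)}"
      using block_word_iff[OF i] by blast
    then show ?thesis using i by (simp add: take_Suc_conv_app_nth)
  qed
  moreover have "block_word l a = 0" if "a \<notin> {1..sum_list l}" for a
    using that unfolding block_word_def by (rule if_not_P)
  ultimately show ?thesis using block_word_less by (simp add: words_def)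
qed

text \<open>A block that is mapped into itself is mapped onto itself because it is finite.\<close>

lemma young_subgroup_eq_stab: "young_subgroup l = stab (sum_list l) (block_word l)"
proof (intro equalityI subsetI)
  let ?B = "\<lambda>i. {sum_list (take i l)<..sum_list (take (Suc i) l)}" and ?m = "sum_list l"
  fix g assume g: "g \<in> young_subgroup l"
  then have gm: "g permutes {1..?m}" by (simp add: young_subgroup_def sym_grp_iff)
  have "block_word l (g a) = block_word l a" for a
  proof (cases "a \<in> {1..?m}")
    case True
    have lt: "block_word l a < length l" by (rule block_word_less[OF True])
    then have "a \<in> ?B (block_word l a)" using block_word_iff[OF lt, of a] True by blast
    then have "g a \<in> ?B (block_word l a)" using g lt unfolding young_subgroup_def by blast
    then show ?thesis using block_word_iff[OF lt, of "g a"] by blast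
  next
    case False
    then show ?thesis using permutes_not_in[OF gm] by simp
  qed
  then show "g \<in> stab ?m (block_word l)" using g by (auto simp: stab_def young_subgroup_def)
next
  let ?B = "\<lambda>i. {sum_list (take i l)<..sum_list (take (Suc i) l)}" and ?m = "sum_list l"
  fix g assume "g \<in> stab ?m (block_word l)"
  then have g: "g \<in> sym_grp ?m" "block_word l \<circ> g = block_word l" by (auto simp: stab_def)
  then have gm: "g permutes {1..?m}" by (simp add: sym_grp_iff)
  have "g ` ?B i = ?B i" if i: "i < length l" for i
  proof (rule card_subset_eq)
    show "g ` ?B i \<subseteq> ?B i"
    proof
      fix b assume "b \<in> g ` ?B i"
      then obtain a where a: "a \<in> ?B i" "b = g a" by blast
      then have "a \<in> {1..?m} \<and> block_word l a = i" using block_word_iff[OF i] by blast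
      then have "g a \<in> {1..?m} \<and> block_word l (g a) = i"
        using permutes_in_image[OF gm, of a] fun_cong[OF g(2), of a] by simp
      then show "b \<in> ?B i" using block_word_iff[OF i] a(2) by blast
    qed
    show "card (g ` ?B i) = card (?B i)"
      by (rule card_image) (rule inj_on_subset[OF permutes_inj[OF gm]], simp)
  qed simp
  then show "g \<in> young_subgroup l" using g(1) by (simp add: young_subgroup_def)
qed

text \<open>The conjugate of \<open>g\<close> by \<open>x\<close> lies in the Young subgroup exactly if \<open>g\<close> fixes the translate of the block word by
  the inverse of \<open>x\<close>. As \<open>x\<close> varies this translate meets each word equally often, namely as often as the
  Young subgroup has elements, which cancels the denominator of the induced character.\<close>

lemma perm_char_eq_card_fixed_words:
  assumes g: "g \<in> sym_grp (sum_list l)"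
  shows "perm_char l g = of_nat (card {u \<in> words l. u \<circ> g = u})"
proof -
  let ?G = "sym_grp (sum_list l)" and ?w = "block_word l"
  let ?Y = "stab (sum_list l) ?w" and ?X = "{x \<in> sym_grp (sum_list l). finv x \<circ> g \<circ> x \<in> stab (sum_list l) (block_word l)}"
  let ?F = "{u \<in> words l. u \<circ> g = u}"
  have mem: "finv x \<circ> g \<circ> x \<in> ?Y \<longleftrightarrow> (?w \<circ> finv x) \<circ> g = ?w \<circ> finv x" if x: "x \<in> ?G" for x
  proof -
    have "finv x \<circ> g \<circ> x \<in> ?Y \<longleftrightarrow> ?w \<circ> (finv x \<circ> g \<circ> x) = ?w"
      using x g by (simp add: stab_def sym_grp_comp sym_grp_inv)
    also have "\<dots> \<longleftrightarrow> (?w \<circ> finv x) \<circ> g = ?w \<circ> finv x"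
    proof
      assume A: "?w \<circ> (finv x \<circ> g \<circ> x) = ?w"
      have "(?w \<circ> finv x) \<circ> g = (?w \<circ> (finv x \<circ> g \<circ> x)) \<circ> finv x"
        using sym_grp_inv_comp(2)[OF x] by (simp add: comp_assoc)
      then show "(?w \<circ> finv x) \<circ> g = ?w \<circ> finv x" unfolding A .
    next
      assume A: "(?w \<circ> finv x) \<circ> g = ?w \<circ> finv x"
      have "?w \<circ> (finv x \<circ> g \<circ> x) = ((?w \<circ> finv x) \<circ> g) \<circ> x" by (simp only: comp_assoc)
      also have "\<dots> = ?w" unfolding A using sym_grp_inv_comp(1)[OF x] by (simp add: comp_assoc)
      finally show "?w \<circ> (finv x \<circ> g \<circ> x) = ?w" .
    qed
    finally show ?thesis .
  qed
  have fibre: "card {x \<in> ?X. ?w \<circ> finv x = u} = card ?Y" if u: "u \<in> ?F" for u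
  proof -
    have "x \<in> {x \<in> ?X. ?w \<circ> finv x = u} \<longleftrightarrow> x \<in> {x \<in> ?G. u \<circ> x = ?w}" for x
    proof (cases "x \<in> ?G")
      case True
      have "?w \<circ> finv x = u \<Longrightarrow> finv x \<circ> g \<circ> x \<in> ?Y" using mem[OF True] u by simp
      then show ?thesis using True comp_finv_eq_iff[OF True, of ?w u]
        unfolding mem_Collect_eq by argo
    qed blast
    then have "{x \<in> ?X. ?w \<circ> finv x = u} = {x \<in> ?G. u \<circ> x = ?w}" by (rule Set.set_eqI)
    moreover have "u \<in> words l" using u by blast
    then obtain x0 where "x0 \<in> ?G" "u \<circ> x0 = ?w"
      by (rule words_transitive[OF _ block_word_in_words])
    then have "card {x \<in> ?G. u \<circ> x = ?w} = card ?Y" by (rule card_transporter)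
    ultimately show ?thesis by simp
  qed
  have "card ?X = (\<Sum>u\<in>?F. card {x \<in> ?X. ?w \<circ> finv x = u})"
  proof (rule card_eq_sum_fibres)
    show "(\<lambda>x. ?w \<circ> finv x) ` ?X \<subseteq> ?F"
    proof
      fix u assume "u \<in> (\<lambda>x. ?w \<circ> finv x) ` ?X"
      then obtain x where x: "x \<in> ?G" "finv x \<circ> g \<circ> x \<in> ?Y" "u = ?w \<circ> finv x" by blast
      then have "u \<circ> g = u" using mem[OF x(1)] by simp
      moreover have "u \<in> words l"
        unfolding x(3) by (rule words_comp[OF block_word_in_words sym_grp_inv[OF x(1)]])
      ultimately show "u \<in> ?F" by blast
    qed
  qed (use finite_words in auto)
  also have "\<dots> = card ?F * card ?Y" using fibre by simp
  finally have "card ?X = card ?F * card ?Y" .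
  moreover have "perm_char l g = of_nat (card ?X) / of_nat (card ?Y)"
    by (simp add: perm_char_def induced_char_def young_subgroup_eq_stab)
  moreover have "?Y \<noteq> {}" using id_in_stab by blast
  ultimately show ?thesis by simp
qed

text \<open>A pair of words is a word in the cells of a matrix, and the product of the two permutation
  characters is the permutation character on these words.\<close>

definition pair_words :: "nat list \<Rightarrow> nat list \<Rightarrow> (nat \<Rightarrow> nat \<times> nat) set" where
  "pair_words \<alpha> \<beta> = (\<lambda>(u, v) a. (u a, v a)) ` (words \<alpha> \<times> words \<beta>)"

lemma finite_pair_words: "finite (pair_words \<alpha> \<beta>)"
  by (simp add: pair_words_def finite_words)

lemma pair_words_comp:
  assumes "sum_list \<beta> = sum_list \<alpha>" "w \<in> pair_words \<alpha> \<beta>" "g \<in> sym_grp (sum_list \<alpha>)"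
  shows "w \<circ> g \<in> pair_words \<alpha> \<beta>"
proof -
  obtain u v where uv: "u \<in> words \<alpha>" "v \<in> words \<beta>" "w = (\<lambda>a. (u a, v a))"
    using assms(2) by (auto simp: pair_words_def)
  then have "w \<circ> g = (\<lambda>(u, v) a. (u a, v a)) (u \<circ> g, v \<circ> g)" by auto
  moreover have "u \<circ> g \<in> words \<alpha>" "v \<circ> g \<in> words \<beta>" using words_comp assms uv by auto
  ultimately show ?thesis unfolding pair_words_def by blast
qed

lemma perm_char_product:
  assumes "sum_list \<beta> = sum_list \<alpha>" "g \<in> sym_grp (sum_list \<alpha>)"
  shows "perm_char \<alpha> g * perm_char \<beta> g = of_nat (card {w \<in> pair_words \<alpha> \<beta>. w \<circ> g = w})"
proof -
  let ?f = "\<lambda>(u, v) a. (u a, v a) :: nat \<times> nat"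
  let ?U = "{u \<in> words \<alpha>. u \<circ> g = u}" and ?V = "{v \<in> words \<beta>. v \<circ> g = v}"
  have inj: "inj_on ?f (?U \<times> ?V)" by (rule inj_onI) (auto simp: fun_eq_iff)
  have "{w \<in> pair_words \<alpha> \<beta>. w \<circ> g = w} = ?f ` (?U \<times> ?V)"
    by (force simp: pair_words_def fun_eq_iff)
  then show ?thesis
    using assms by (simp add: perm_char_eq_card_fixed_words card_image[OF inj] card_cartesian_product)
qed

text \<open>Both permutation characters are replaced by counts of fixed words. Interchanging the sums leaves, for each
  word, the sum of the irreducible character over its stabilizer.\<close>

lemma char_inner_eq_sum_pair_words:
  assumes sz: "sum_list \<beta> = sum_list \<alpha>" "sum_list \<gamma> = sum_list \<alpha>"
  shows "char_inner (sum_list \<alpha>) (char_tensor (perm_char \<alpha>) (perm_char \<beta>)) (irr_char \<gamma>) =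
    of_nat (\<Sum>w\<in>pair_words \<alpha> \<beta>. card (stab (sum_list \<alpha>) w) * cfun.dim (fixed_specht \<gamma> w)) / fact (sum_list \<alpha>)"
proof -
  let ?m = "sum_list \<alpha>" and ?W = "pair_words \<alpha> \<beta>"
  have "(\<Sum>g\<in>sym_grp ?m. perm_char \<alpha> g * perm_char \<beta> g * cnj (irr_char \<gamma> g))
      = (\<Sum>g\<in>sym_grp ?m. \<Sum>w\<in>?W. if w \<circ> g = w then cnj (irr_char \<gamma> g) else 0)"
  proof (rule sum.cong[OF refl])
    fix g assume g: "g \<in> sym_grp ?m"
    have "of_nat (card {w \<in> ?W. w \<circ> g = w}) * cnj (irr_char \<gamma> g)
        = (\<Sum>w\<in>{w \<in> ?W. w \<circ> g = w}. cnj (irr_char \<gamma> g))" by simp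
    also have "\<dots> = (\<Sum>w\<in>?W. if w \<circ> g = w then cnj (irr_char \<gamma> g) else 0)"
      by (rule sum.inter_filter[OF finite_pair_words])
    finally show "perm_char \<alpha> g * perm_char \<beta> g * cnj (irr_char \<gamma> g) = \<dots>"
      using perm_char_product[OF sz(1) g] by simp
  qed
  also have "\<dots> = (\<Sum>w\<in>?W. \<Sum>g\<in>sym_grp ?m. if w \<circ> g = w then cnj (irr_char \<gamma> g) else 0)"
    by (rule sum.swap)
  also have "\<dots> = (\<Sum>w\<in>?W. of_nat (card (stab ?m w) * cfun.dim (fixed_specht \<gamma> w)))"
  proof (rule sum.cong[OF refl])
    fix w
    have "(\<Sum>g\<in>sym_grp ?m. if w \<circ> g = w then cnj (irr_char \<gamma> g) else 0)
        = (\<Sum>g\<in>stab ?m w. cnj (irr_char \<gamma> g))"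
      unfolding stab_def by (rule sum.inter_filter[symmetric]) simp
    also have "\<dots> = cnj (of_nat (card (stab ?m w) * cfun.dim (fixed_specht \<gamma> w)))"
      using sum_irr_char_stab[of \<gamma> w] unfolding sz(2) cnj_sum[symmetric] by (rule arg_cong)
    finally show "(\<Sum>g\<in>sym_grp ?m. if w \<circ> g = w then cnj (irr_char \<gamma> g) else 0)
        = of_nat (card (stab ?m w) * cfun.dim (fixed_specht \<gamma> w))" by simp
  qed
  finally show ?thesis
    by (simp add: char_inner_def char_tensor_def card_sym_grp)
qed

section \<open>Orbits of words\<close>

lemma orbit_sum_ge:
  assumes "\<And>x. x \<in> sym_grp m \<Longrightarrow> K \<le> d (w \<circ> x)"
  shows "fact m * K \<le> (\<Sum>w'\<in>(\<circ>) w ` sym_grp m. card (stab m w') * d w')"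
proof -
  have "fact m * K = (\<Sum>w'\<in>(\<circ>) w ` sym_grp m. card (stab m w') * K)"
    by (simp only: sum_card_stab_orbit[symmetric, of m w] sum_distrib_right)
  also have "\<dots> \<le> (\<Sum>w'\<in>(\<circ>) w ` sym_grp m. card (stab m w') * d w')"
    using assms by (intro sum_mono mult_left_mono) auto
  finally show ?thesis .
qed

text \<open>By orbit-stabilizer an orbit on which \<open>d\<close> is at least \<open>K\<close> contributes at least \<open>m! K\<close> to the total.\<close>

lemma weight_one_imp_bounded:
  assumes W: "finite W" "\<And>w x. w \<in> W \<Longrightarrow> x \<in> sym_grp m \<Longrightarrow> w \<circ> x \<in> W"
    and total: "(\<Sum>w\<in>W. card (stab m w) * d w) = fact m"
    and w: "w \<in> W" "\<And>x. x \<in> sym_grp m \<Longrightarrow> K \<le> d (w \<circ> x)"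
  shows "K \<le> 1"
proof -
  have "fact m * K \<le> (\<Sum>w'\<in>(\<circ>) w ` sym_grp m. card (stab m w') * d w')"
    by (rule orbit_sum_ge) (rule w(2))
  also have "\<dots> \<le> (\<Sum>w\<in>W. card (stab m w) * d w)"
    using W w(1) by (intro sum_mono2) auto
  finally have "fact m * K \<le> (fact m :: nat) * 1" using total by simp
  then show ?thesis by (simp only: nat_mult_le_cancel_disj) auto
qed

text \<open>Two different orbits on which \<open>d\<close> does not vanish would contribute at least \<open>2 m!\<close>.\<close>

lemma weight_one_imp_same_orbit:
  assumes W: "finite W" "\<And>w x. w \<in> W \<Longrightarrow> x \<in> sym_grp m \<Longrightarrow> w \<circ> x \<in> W"
    and total: "(\<Sum>w\<in>W. card (stab m w) * d w) = fact m"
    and w: "w \<in> W" "\<And>x. x \<in> sym_grp m \<Longrightarrow> 1 \<le> d (w \<circ> x)"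
    and w': "w' \<in> W" "\<And>x. x \<in> sym_grp m \<Longrightarrow> 1 \<le> d (w' \<circ> x)"
  shows "\<exists>x\<in>sym_grp m. w' = w \<circ> x"
proof (rule ccontr)
  assume no: "\<not> ?thesis"
  let ?O = "(\<circ>) w ` sym_grp m" and ?O' = "(\<circ>) w' ` sym_grp m"
  have "?O \<inter> ?O' = {}"
  proof (rule ccontr)
    assume "?O \<inter> ?O' \<noteq> {}"
    then obtain x y where xy: "x \<in> sym_grp m" "y \<in> sym_grp m" "w \<circ> x = w' \<circ> y" by auto
    then have "(w \<circ> x) \<circ> finv y = w'"
      using comp_finv_eq_iff[OF xy(2), of "w \<circ> x" w'] by simp
    then have "w' = w \<circ> (x \<circ> finv y)" by (simp only: comp_assoc)
    then show False using no xy sym_grp_comp sym_grp_inv by blast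
  qed
  then have "(\<Sum>w\<in>?O. card (stab m w) * d w) + (\<Sum>w\<in>?O'. card (stab m w) * d w)
      = (\<Sum>w\<in>?O \<union> ?O'. card (stab m w) * d w)"
    by (intro sum.union_disjoint[symmetric]) auto
  also have "\<dots> \<le> (\<Sum>w\<in>W. card (stab m w) * d w)"
    using W w(1) w'(1) by (intro sum_mono2) auto
  also note total
  finally have "fact m + fact m \<le> (fact m :: nat)"
    using orbit_sum_ge[of m 1 d w, OF w(2)] orbit_sum_ge[of m 1 d w', OF w'(2)]
    unfolding mult_1_right by linarith
  then show False using fact_gt_zero[of m, where 'a = nat] by linarith
qed

section \<open>Dominance, semistandard tableaux and permutohedra\<close>

definition dominates :: "nat list \<Rightarrow> nat list \<Rightarrow> bool" where
  "dominates l \<nu> \<longleftrightarrow> sorted_wrt (\<ge>) l \<and> sorted_wrt (\<ge>) \<nu> \<and> length l = length \<nu> \<and>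
     sum_list l = sum_list \<nu> \<and> (\<forall>j. sum_list (take j \<nu>) \<le> sum_list (take j l))"

text \<open>Since \<open>l\<close> dominates, the last and smallest entry \<open>x\<close> of the second sequence lies between the first and the
  last entry of \<open>l\<close>, hence between two consecutive entries \<open>a \<ge> x \<ge> b\<close>. Replacing these two by the single entry
  \<open>a + b - x\<close> leaves a sequence that dominates the rest: the partial sums up to this position do not change,
  and each later one is the next partial sum of \<open>l\<close> less \<open>x\<close>, while the next partial sum on the other side grows by at least \<open>x\<close>.\<close>

lemma dominates_peel:
  assumes dom: "dominates l (\<nu> @ [x])" and ne: "\<nu> \<noteq> []"
  obtains L a b R where "l = L @ a # b # R" "b \<le> x" "x \<le> a" "dominates (L @ (a + b - x) # R) \<nu>"
proof -
  define k where "k = length \<nu>"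
  have k: "k > 0" using ne by (simp add: k_def)
  have l: "sorted_wrt (\<ge>) l" "length l = Suc k" "sum_list l = sum_list \<nu> + x"
    and le: "\<And>j. sum_list (take j (\<nu> @ [x])) \<le> sum_list (take j l)"
    and \<nu>: "sorted_wrt (\<ge>) \<nu>" "\<And>y. y \<in> set \<nu> \<Longrightarrow> x \<le> y"
    using dom by (auto simp: dominates_def k_def sorted_wrt_append)
  have "sum_list l = sum_list (take k l) + l ! k"
    using l(2) by (metis lessI order_refl sum_list_append take_Suc_conv_app_nth take_all sum_list_simps(2) sum_list.Nil add_0_right sum_list.Cons)
  then have last: "l ! k \<le> x" using le[of k] l(3) by (simp add: k_def)
  have first: "x \<le> l ! 0"
  proof -
    have "\<nu> ! 0 \<in> set \<nu>" using ne by simp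
    then have "x \<le> \<nu> ! 0" by (rule \<nu>(2))
    also have "\<dots> \<le> l ! 0" using le[of 1] ne l(2) by (cases \<nu>; cases l) auto
    finally show ?thesis .
  qed
  \<comment> \<open>the position at which \<open>x\<close> fits between two neighbours in \<open>l\<close>\<close>
  define r where "r = (LEAST i. l ! Suc i \<le> x)"
  have ex: "l ! Suc (k - 1) \<le> x" using last k by simp
  have rb: "l ! Suc r \<le> x" unfolding r_def by (rule LeastI[of "\<lambda>i. l ! Suc i \<le> x", OF ex])
  have "r \<le> k - 1" unfolding r_def by (rule Least_le) (rule ex)
  then have r: "r < k" using k by simp
  have ra: "x \<le> l ! r"
  proof (cases r)
    case (Suc i)
    then show ?thesis using not_less_Least[of i "\<lambda>i. l ! Suc i \<le> x"] r_def by simp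
  qed (use first in simp)
  define L a b R where "L = take r l" and "a = l ! r" and "b = l ! Suc r" and "R = drop (Suc (Suc r)) l"
  have split: "l = L @ a # b # R"
    unfolding L_def a_def b_def R_def using r l(2) by (simp add: Cons_nth_drop_Suc)
  have lenL: "length L = r" using r l(2) by (simp add: L_def)
  define c where "c = a + b - x"
  have c: "c + x = a + b" "b \<le> c" "c \<le> a" using ra rb by (auto simp: c_def a_def b_def)
  have sorted: "sorted_wrt (\<ge>) (L @ c # R)"
    using l(1) c unfolding split by (fastforce simp: sorted_wrt_append)
  have sum: "sum_list (L @ c # R) = sum_list \<nu>"
    using l(3) c(1) unfolding split by simp
  have "sum_list (take j \<nu>) \<le> sum_list (take j (L @ c # R))" for j
  proof (cases "j \<le> r")
    case True
    have "take j (L @ c # R) = take j l" using True lenL unfolding split by simp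
    moreover have "take j (\<nu> @ [x]) = take j \<nu>" using True r by (simp add: k_def)
    ultimately show ?thesis using le[of j] by simp
  next
    case False
    then obtain d where d: "j = Suc r + d" by (metis Suc_leI add.commute le_add_diff_inverse2 not_le)
    have "sum_list (take j (L @ c # R)) + x = sum_list (take (Suc j) l)"
      using c(1) lenL d unfolding split by (simp add: take_Cons')
    moreover have "sum_list (take j \<nu>) + x \<le> sum_list (take (Suc j) (\<nu> @ [x]))"
    proof (cases "j < k")
      case True
      then have "x \<le> \<nu> ! j" using \<nu>(2) by (simp add: k_def)
      then show ?thesis using True by (simp add: k_def take_Suc_conv_app_nth)
    qed (simp add: k_def)
    ultimately show ?thesis using le[of "Suc j"] by linarith
  qed
  then have "dominates (L @ c # R) \<nu>"
    using sorted \<nu>(1) sum lenL l(2) split by (simp add: dominates_def k_def)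
  then show ?thesis using that[OF split] ra rb by (simp add: a_def b_def c_def)
qed

text \<open>One peeling step has two readings. For tableaux, the smaller shape is obtained by
  removing a horizontal strip with \<open>x\<close> cells. For permutohedra, \<open>(a, b)\<close> is averaged with \<open>(b, a)\<close> to \<open>(a + b - x, x)\<close>.
  Hence this induction proves the existence of semistandard tableaux and the theorem of Rado at the same time.\<close>

lemma dominates_induct [consumes 1, case_names Nil single step]:
  assumes "dominates l \<nu>"
    and nil: "P [] []" and single: "\<And>a. P [a] [a]"
    and step: "\<And>L a b R \<nu> x. dominates (L @ a # b # R) (\<nu> @ [x]) \<Longrightarrow> b \<le> x \<Longrightarrow> x \<le> a \<Longrightarrow>
      dominates (L @ (a + b - x) # R) \<nu> \<Longrightarrow> P (L @ (a + b - x) # R) \<nu> \<Longrightarrow> P (L @ a # b # R) (\<nu> @ [x])"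
  shows "P l \<nu>"
  using assms(1)
proof (induction \<nu> arbitrary: l rule: rev_induct)
  case Nil
  then show ?case using nil by (simp add: dominates_def)
next
  case (snoc x \<nu>)
  show ?case
  proof (cases "\<nu> = []")
    case True
    then have "l = [x]" using snoc.prems by (cases l) (auto simp: dominates_def)
    then show ?thesis using single True by simp
  next
    case False
    then obtain L a b R where *: "l = L @ a # b # R" "b \<le> x" "x \<le> a" "dominates (L @ (a + b - x) # R) \<nu>"
      using dominates_peel[OF snoc.prems] by blast
    show ?thesis unfolding *(1)
      by (rule step[OF _ *(2-4) snoc.IH[OF *(4)]]) (use snoc.prems *(1) in simp)
  qed
qed

lemma count_list_concat_extend:
  assumes "list_all2 (\<lambda>r n. length r \<le> n) rs ns"
  shows "count_list (concat (map2 (\<lambda>r n. r @ replicate (n - length r) z) rs ns)) y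
      + (if y = z then sum_list (map length rs) else 0)
    = count_list (concat rs) y + (if y = z then sum_list ns else 0)"
  using assms
proof (induction rule: list_all2_induct)
  case (Cons r rs n ns)
  have rep: "count_list (replicate i z) y = (if y = z then i else 0)" for i
    by (induction i) auto
  show ?case using Cons by (auto simp: rep)
qed simp

text \<open>By induction there is a tableau of the smaller shape; its rows are prolonged by a new largest letter. The
  two shapes interlace, so no two new cells lie in the same column.\<close>

lemma dominates_imp_ssyt_exists:
  assumes "dominates l \<nu>" shows "\<exists>T. is_ssyt l \<nu> T"
  using assms
proof (induction rule: dominates_induct)
  case Nil
  show ?case by (intro exI[of _ "[]"]) (simp add: is_ssyt_def)
next
  case (single a)
  have "count_list (replicate a (Suc 0)) (Suc 0) = a" by (induction a) auto
  then show ?case by (intro exI[of _ "[replicate a 1]"]) (auto simp: is_ssyt_def)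
next
  case (step L a b R \<nu> x)
  let ?l = "L @ a # b # R" and ?\<mu> = "L @ (a + b - x) # R"
  obtain T' where T': "is_ssyt ?\<mu> \<nu> T'" using step.IH by blast
  define k where "k = length \<nu>"
  define U where "U = T' @ [[]]"
  define T where "T = map2 (\<lambda>r n. r @ replicate (n - length r) (Suc k)) U ?l"
  have len\<mu>: "length ?\<mu> = k" using step.hyps(4) by (simp add: dominates_def k_def)
  have lenT': "length T' = k" "\<And>i. i < k \<Longrightarrow> length (T' ! i) = ?\<mu> ! i"
  proof -
    have "map length T' = ?\<mu>" using T' by (simp only: is_ssyt_def)
    then show "length T' = k" using len\<mu> by (metis length_map)
    then show "length (T' ! i) = ?\<mu> ! i" if "i < k" for i
      using \<open>map length T' = ?\<mu>\<close> that by (metis nth_map)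
  qed
  have lenl: "length ?l = Suc k" using len\<mu> by simp
  have sortedl: "?l ! Suc i \<le> ?l ! i" if "i < k" for i
  proof -
    have "\<forall>i j. i < j \<longrightarrow> j < length ?l \<longrightarrow> ?l ! j \<le> ?l ! i"
      using step.hyps(1) unfolding dominates_def sorted_wrt_iff_nth_less by blast
    then show ?thesis unfolding lenl using that lessI Suc_less_eq by metis
  qed
  have inter: "?\<mu> ! i \<le> ?l ! i \<and> ?l ! Suc i \<le> ?\<mu> ! i" if "i < k" for i
  proof -
    consider "i < length L" | "i = length L" | j where "i = Suc (length L + j)"
      by (metis add_Suc less_iff_Suc_add linorder_neqE_nat)
    then show ?thesis
    proof cases
      case 1
      then have "?\<mu> ! i = ?l ! i" by (simp add: nth_append)
      then show ?thesis using sortedl[OF that] by simp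
    next
      case 2
      then show ?thesis using step.hyps(2,3) by (auto simp: nth_append)
    next
      case 3
      then have "?\<mu> ! i = ?l ! Suc i" by (simp add: nth_append)
      then show ?thesis using sortedl[OF that] by simp
    qed
  qed
  have lenU: "length U = Suc k" "\<And>i. i < k \<Longrightarrow> U ! i = T' ! i" "U ! k = []"
    using lenT' by (auto simp: U_def nth_append)
  have U_le: "length (U ! i) \<le> ?l ! i" if "i < Suc k" for i
    using inter[of i] lenU lenT' that by (cases "i = k") auto
  have nthT: "T ! i = U ! i @ replicate (?l ! i - length (U ! i)) (Suc k)" if "i < Suc k" for i
    unfolding T_def using that lenU(1) lenl by simp
  have lenT: "length T = Suc k" unfolding T_def using lenU(1) lenl by simp
  have valU: "y \<in> {1..k}" if "i < Suc k" "y \<in> set (U ! i)" for i y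
  proof -
    have "i \<noteq> k" using that(2) lenU(3) by auto
    then have "i < k" using that(1) by simp
    then have "T' ! i \<in> set T'" "y \<in> set (T' ! i)" using lenT'(1) lenU(2) that(2) by simp_all
    then have "y \<in> set (concat T')" by (simp only: set_concat) blast
    then show ?thesis using T' by (auto simp: is_ssyt_def k_def)
  qed
  have sortedU: "sorted (U ! i)" if "i < Suc k" for i
    using that T' lenU lenT'(1) by (cases "i = k") (auto simp: is_ssyt_def)
  have rowlen: "length (T ! i) = ?l ! i" if "i < Suc k" for i
    using nthT[OF that] U_le[OF that] by simp
  have "is_ssyt ?l (\<nu> @ [x]) T"
    unfolding is_ssyt_def
  proof (intro conjI ballI allI impI)
    show "map length T = ?l"
      by (rule nth_equalityI) (use lenT lenl rowlen in auto)
    show "sorted r" if "r \<in> set T" for r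
    proof -
      obtain i where i: "i < Suc k" "r = T ! i" using \<open>r \<in> set T\<close> lenT by (auto simp: in_set_conv_nth)
      have "y \<le> Suc k" if "y \<in> set (U ! i)" for y using valU[OF i(1) that] by simp
      then show ?thesis unfolding i(2) nthT[OF i(1)] using sortedU[OF i(1)]
        by (auto simp: sorted_append)
    qed
    show "T ! i ! j < T ! Suc i ! j" if ij: "Suc i < length T \<and> j < length (T ! i) \<and> j < length (T ! Suc i)" for i j
    proof -
      have i: "i < k" "i < Suc k" "Suc i < Suc k" using ij lenT by auto
      have j: "j < ?l ! Suc i" using ij rowlen[OF i(3)] by simp
      then have jU: "j < length (U ! i)" using inter[OF i(1)] lenU(2)[OF i(1)] lenT'(2)[OF i(1)] by simp
      then have Tij: "T ! i ! j = U ! i ! j" by (simp only: nthT[OF i(2)] nth_append if_True)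
      show ?thesis
      proof (cases "j < length (U ! Suc i)")
        case True
        then have "Suc i < k" using lenU(3) i by (cases "Suc i = k") auto
        then have "T' ! i ! j < T' ! Suc i ! j"
          using T' True jU lenT'(1) lenU(2) i(1) by (simp add: is_ssyt_def)
        moreover have "T ! Suc i ! j = U ! Suc i ! j"
          using True by (simp only: nthT[OF i(3)] nth_append if_True)
        ultimately show ?thesis using Tij lenU(2)[OF i(1)] lenU(2)[OF \<open>Suc i < k\<close>] by simp
      next
        case False
        then have "T ! Suc i ! j = Suc k"
          using j by (simp add: nthT[OF i(3)] nth_append del: append.simps)
        moreover have "U ! i ! j \<le> k" using valU[OF i(2), of "U ! i ! j"] jU by simp
        ultimately show ?thesis using Tij by simp
      qed
    qed
    show "set (concat T) \<subseteq> {1..length (\<nu> @ [x])}"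
    proof
      fix y assume "y \<in> set (concat T)"
      then obtain r where r: "r \<in> set T" "y \<in> set r" by auto
      obtain i where "i < length T" "T ! i = r" using r(1) by (metis in_set_conv_nth)
      then have i: "i < Suc k" "y \<in> set (T ! i)" using r(2) lenT by simp_all
      then have "y \<in> set (U ! i) \<or> y = Suc k" using nthT[OF i(1)] by (auto split: if_splits)
      then show "y \<in> {1..length (\<nu> @ [x])}" using valU[OF i(1), of y] by (auto simp: k_def)
    qed
    have "list_all2 (\<lambda>r n. length r \<le> n) U ?l"
      using lenU(1) lenl U_le by (simp only: list_all2_conv_all_nth) simp
    note count = count_list_concat_extend[OF this, of "Suc k", folded T_def]
    have concatU: "concat U = concat T'" by (simp add: U_def)
    show "count_list (concat T) (Suc v) = (\<nu> @ [x]) ! v" if v: "v < length (\<nu> @ [x])" for v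
    proof (cases "v = k")
      case True
      have "Suc k \<notin> set (concat T')" using T' by (auto simp: is_ssyt_def k_def)
      then have "count_list (concat T') (Suc k) = 0" by simp
      moreover have "map length U = ?\<mu> @ [0]" using T' by (simp add: U_def is_ssyt_def)
      ultimately have "count_list (concat T) (Suc k) + sum_list ?\<mu> = sum_list ?l"
        using count[of "Suc k"] concatU by simp
      moreover have "sum_list ?l = sum_list ?\<mu> + x" using step.hyps(2,3) by simp
      ultimately show ?thesis using True by (simp add: k_def)
    next
      case False
      then have "v < k" using v by (simp add: k_def)
      then show ?thesis using count[of "Suc v"] concatU T' by (simp add: is_ssyt_def k_def nth_append)
    qed
  qed
  then show ?case by blast
qed

text \<open>The largest index in \<open>I\<close> is at least \<open>card I - 1\<close>, so its entry is at most the last entry of the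
  initial segment of the same size; remove both.\<close>

lemma sum_nth_le_sum_list_take:
  fixes l :: "nat list"
  assumes l: "sorted_wrt (\<ge>) l" and I: "I \<subseteq> {..<length l}"
  shows "(\<Sum>i\<in>I. l ! i) \<le> sum_list (take (card I) l)"
proof -
  have "finite I" using I finite_subset by blast
  then show ?thesis using I
  proof (induction "card I" arbitrary: I)
    case (Suc n)
    then have ne: "I \<noteq> {}" by auto
    define M where "M = Max I"
    have M: "M \<in> I" using Suc.prems(1) ne by (simp add: M_def)
    have card: "card (I - {M}) = n" using Suc.hyps(2) M by simp
    have "I \<subseteq> {..M}" using Suc.prems(1) by (auto simp: M_def)
    then have "card I \<le> card {..M}" by (intro card_mono) auto
    then have nM: "n \<le> M" using Suc.hyps(2) by simp
    have Ml: "M < length l" using M Suc.prems(2) by auto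
    have "l ! M \<le> l ! n" using nM Ml l by (cases "n = M") (auto simp: sorted_wrt_iff_nth_less)
    moreover have "(\<Sum>i\<in>I - {M}. l ! i) \<le> sum_list (take n l)"
    proof -
      have "finite (I - {M})" "I - {M} \<subseteq> {..<length l}" using Suc.prems by auto
      then show ?thesis using Suc.hyps(1)[OF card[symmetric]] by (simp only: card)
    qed
    moreover have "(\<Sum>i\<in>I. l ! i) = l ! M + (\<Sum>i\<in>I - {M}. l ! i)"
      using M Suc.prems(1) by (rule sum.remove[rotated])
    moreover have "sum_list (take (Suc n) l) = sum_list (take n l) + l ! n"
      using nM Ml by (simp add: take_Suc_conv_app_nth)
    ultimately show ?case unfolding Suc.hyps(2)[symmetric] by linarith
  qed simp
qed

lemma permuted_list_obtain:
  assumes "mset ys = mset xs"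
  obtains \<sigma> where "\<sigma> permutes {..<length xs}" "length ys = length xs" "\<And>i. i < length xs \<Longrightarrow> ys ! i = xs ! \<sigma> i"
proof -
  obtain \<sigma> where \<sigma>: "\<sigma> permutes {..<length xs}" "permute_list \<sigma> xs = ys"
    using assms by (rule mset_eq_permutation)
  moreover have "ys ! i = xs ! \<sigma> i" if "i < length xs" for i
    using permute_list_nth[OF \<sigma>(1) that] \<sigma>(2) by simp
  moreover have "length ys = length xs" using assms by (rule mset_eq_length)
  ultimately show ?thesis using that by blast
qed

lemma sum_subset_permuted_le:
  fixes l :: "nat list"
  assumes l: "sorted_wrt (\<ge>) l" and b: "mset b = mset l" and I: "I \<subseteq> {..<length l}"
  shows "(\<Sum>i\<in>I. b ! i) \<le> sum_list (take (card I) l)"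
proof -
  obtain \<sigma> where \<sigma>: "\<sigma> permutes {..<length l}" "\<And>i. i < length l \<Longrightarrow> b ! i = l ! \<sigma> i"
    using permuted_list_obtain[OF b] by metis
  have inj: "inj_on \<sigma> I" using permutes_inj[OF \<sigma>(1)] by (rule inj_on_subset) simp
  have "(\<Sum>i\<in>I. b ! i) = (\<Sum>i\<in>I. l ! \<sigma> i)" using I \<sigma>(2) by (intro sum.cong) auto
  also have "\<dots> = (\<Sum>i\<in>\<sigma> ` I. l ! i)" by (simp add: sum.reindex[OF inj])
  also have "\<dots> \<le> sum_list (take (card (\<sigma> ` I)) l)"
    using I permutes_image[OF \<sigma>(1)] by (intro sum_nth_le_sum_list_take[OF l]) auto
  finally show ?thesis by (simp add: card_image[OF inj])
qed

lemma lookup_scaleR_real: "Poly_Mapping.lookup (r *\<^sub>R f) i = r * Poly_Mapping.lookup f i"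
  for f :: "nat \<Rightarrow>\<^sub>0 real"
  by (simp add: scaleR_poly_mapping_def Poly_Mapping.map.rep_eq when_def)

abbreviation perm_hull :: "real list \<Rightarrow> (nat \<Rightarrow>\<^sub>0 real) set" where
  "perm_hull a \<equiv> convex hull (Poly_Mapping.nth ` {b. mset b = mset a})"

text \<open>If \<open>x = (1 - u) p + u q\<close>, then \<open>(p + q - x, x)\<close> is the same convex combination of \<open>(q, p)\<close> and
  \<open>(p, q)\<close>.\<close>

lemma transfer_in_hull:
  fixes p q x :: real
  assumes C: "convex C" and xs: "q \<le> x" "x \<le> p"
    and in1: "Poly_Mapping.nth (c1 @ p # c2 @ [q]) \<in> C" and in2: "Poly_Mapping.nth (c1 @ q # c2 @ [p]) \<in> C"
  shows "Poly_Mapping.nth (c1 @ (p + q - x) # c2 @ [x]) \<in> C"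
proof (cases "p = q")
  case True
  then show ?thesis using in1 xs by simp
next
  case False
  then have pq: "q < p" using xs by simp
  define u v where "u = (p - x) / (p - q)" and "v = (x - q) / (p - q)"
  have uv: "0 \<le> u" "0 \<le> v" "u + v = 1" using xs pq by (auto simp: u_def v_def divide_simps)
  have v: "v = 1 - u" using uv(3) by simp
  have "u * (p - q) = p - x" using pq by (simp add: u_def)
  then have x: "x = p - u * (p - q)" by simp
  have "Poly_Mapping.nth (c1 @ (p + q - x) # c2 @ [x])
     = v *\<^sub>R Poly_Mapping.nth (c1 @ q # c2 @ [p]) + u *\<^sub>R Poly_Mapping.nth (c1 @ p # c2 @ [q])"
  proof (rule poly_mapping_eqI)
    fix i
    consider "i < length c1" | "i = length c1" | "length c1 < i" "i \<le> length c1 + length c2"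
      | "i = Suc (length c1 + length c2)" | "Suc (length c1 + length c2) < i" by linarith
    then show "Poly_Mapping.lookup (Poly_Mapping.nth (c1 @ (p + q - x) # c2 @ [x])) i
        = Poly_Mapping.lookup (v *\<^sub>R Poly_Mapping.nth (c1 @ q # c2 @ [p]) + u *\<^sub>R Poly_Mapping.nth (c1 @ p # c2 @ [q])) i"
      unfolding lookup_add lookup_scaleR_real lookup_nth
      by cases (auto simp: nth_default_def nth_append nth_Cons' v x algebra_simps)
  qed
  then show ?thesis using convexD[OF C in2 in1 uv(2,1)] uv(3) by (simp add: add.commute)
qed

text \<open>The vertices of the smaller permutohedron, with \<open>x\<close> appended, lie in the larger one by a single
  transfer, and appending \<open>x\<close> is a translation in the space of finitely supported sequences, so it commutes with
  the convex hull.\<close>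

lemma dominates_imp_in_hull:
  assumes "dominates l \<nu>"
  shows "Poly_Mapping.nth (map real \<nu>) \<in> perm_hull (map real l)"
  using assms
proof (induction rule: dominates_induct)
  case (step L a b R \<nu> x)
  let ?l = "L @ a # b # R" and ?\<mu> = "L @ (a + b - x) # R"
  let ?H = "\<lambda>l. perm_hull (map real l)"
  let ?k = "length \<nu>" and ?t = "Poly_Mapping.single (length \<nu>) (real x)"
  have lenk: "length ?\<mu> = ?k" using step.hyps(4) by (simp add: dominates_def)
  have app: "Poly_Mapping.nth (c @ [real x]) = ?t + Poly_Mapping.nth c" if "length c = ?k" for c
    by (rule poly_mapping_eqI) (auto simp: that nth_default_def lookup_add lookup_scaleR_real lookup_single nth_append when_def)
  have vertex: "Poly_Mapping.nth (c @ [real x]) \<in> ?H ?l" if c: "mset c = mset (map real ?\<mu>)" for c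
  proof -
    have "real (a + b - x) \<in> set (map real ?\<mu>)" by simp
    then have "real (a + b - x) \<in> set c" using c by (metis mset_eq_setD)
    then obtain c1 c2 where c12: "c = c1 @ real (a + b - x) # c2" by (meson split_list)
    then have ms: "mset c1 + mset c2 = mset (map real L) + mset (map real R)" using c by simp
    have real: "real (a + b - x) = real a + real b - real x" using step.hyps(3) by simp
    have eq: "mset (c1 @ s # c2 @ [t]) = mset (map real ?l)" if "{#s, t#} = {#real a, real b#}" for s t
    proof -
      have "mset (c1 @ s # c2 @ [t]) = mset c1 + mset c2 + {#s, t#}" by simp
      also have "\<dots> = mset (map real ?l)" unfolding ms that by simp
      finally show ?thesis .
    qed
    have "Poly_Mapping.nth (c1 @ s # c2 @ [t]) \<in> ?H ?l" if "{#s, t#} = {#real a, real b#}" for s t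
      using eq[OF that] by (intro hull_inc) blast
    then have "Poly_Mapping.nth (c1 @ real a # c2 @ [real b]) \<in> ?H ?l"
      "Poly_Mapping.nth (c1 @ real b # c2 @ [real a]) \<in> ?H ?l" by (auto simp: add_mset_commute)
    then have "Poly_Mapping.nth (c1 @ (real a + real b - real x) # c2 @ [real x]) \<in> ?H ?l"
      using step.hyps(2,3) by (intro transfer_in_hull) (auto simp: convex_convex_hull)
    then show ?thesis unfolding c12 real by simp
  qed
  have "?t + Poly_Mapping.nth (map real \<nu>) \<in> (+) ?t ` ?H ?\<mu>" using step.IH by blast
  also have "\<dots> = convex hull ((+) ?t ` Poly_Mapping.nth ` {b. mset b = mset (map real ?\<mu>)})"
    by (rule convex_hull_translation[symmetric])
  also have "\<dots> \<subseteq> ?H ?l"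
  proof (rule hull_minimal)
    show "(+) ?t ` Poly_Mapping.nth ` {b. mset b = mset (map real ?\<mu>)} \<subseteq> ?H ?l"
    proof safe
      fix c assume c: "mset c = mset (map real ?\<mu>)"
      then have "length c = ?k" using lenk by (metis length_map mset_eq_length)
      then show "?t + Poly_Mapping.nth c \<in> ?H ?l" using vertex[OF c] app by simp
    qed
  qed (rule convex_convex_hull)
  finally show ?case using app[of "map real \<nu>"] by simp
qed (auto intro!: hull_inc)

lemma in_hull_permuted:
  fixes xs ys a :: "real list"
  assumes "Poly_Mapping.nth xs \<in> perm_hull a"
    and "length xs = length a" "mset ys = mset xs"
  shows "Poly_Mapping.nth ys \<in> perm_hull a"
proof -
  let ?S = "Poly_Mapping.nth ` {b. mset b = mset a}"
  obtain \<sigma> where \<sigma>: "\<sigma> permutes {..<length xs}" "length ys = length xs" "\<And>i. i < length xs \<Longrightarrow> ys ! i = xs ! \<sigma> i"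
    using permuted_list_obtain[OF assms(3)] by metis
  have inj: "inj \<sigma>" using \<sigma>(1) by (rule permutes_inj)
  have lookup: "Poly_Mapping.lookup (Poly_Mapping.map_key \<sigma> f) i = Poly_Mapping.lookup f (\<sigma> i)" for f :: "nat \<Rightarrow>\<^sub>0 real" and i
    using inj by (simp add: map_key.rep_eq)
  have lin: "linear (Poly_Mapping.map_key \<sigma> :: (nat \<Rightarrow>\<^sub>0 real) \<Rightarrow> nat \<Rightarrow>\<^sub>0 real)"
    by (rule linearI; rule poly_mapping_eqI) (simp_all add: lookup lookup_add lookup_scaleR_real)
  have map_key: "Poly_Mapping.map_key \<sigma> (Poly_Mapping.nth b) = Poly_Mapping.nth (permute_list \<sigma> b)"
    if "length b = length xs" for b :: "real list"
  proof (rule poly_mapping_eqI)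
    fix i
    show "Poly_Mapping.lookup (Poly_Mapping.map_key \<sigma> (Poly_Mapping.nth b)) i
      = Poly_Mapping.lookup (Poly_Mapping.nth (permute_list \<sigma> b)) i"
    proof (cases "i < length b")
      case True
      then have "\<sigma> i < length b" using permutes_in_image[OF \<sigma>(1), of i] that by simp
      then show ?thesis using True \<sigma>(1) that by (simp add: lookup nth_default_def permute_list_nth)
    next
      case False
      then have "\<sigma> i = i" using permutes_not_in[OF \<sigma>(1)] that by simp
      then show ?thesis using False by (simp add: lookup nth_default_def)
    qed
  qed
  have "ys = permute_list \<sigma> xs"
    by (rule nth_equalityI) (use \<sigma> in \<open>auto simp: permute_list_nth\<close>)
  then have "Poly_Mapping.nth ys = Poly_Mapping.map_key \<sigma> (Poly_Mapping.nth xs)"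
    using map_key[of xs] by simp
  also have "\<dots> \<in> Poly_Mapping.map_key \<sigma> ` (convex hull ?S)"
    using assms(1) by (rule imageI)
  also have "\<dots> = convex hull (Poly_Mapping.map_key \<sigma> ` ?S)" using lin by (rule convex_hull_linear_image)
  also have "\<dots> \<subseteq> convex hull ?S"
  proof (rule hull_mono)
    show "Poly_Mapping.map_key \<sigma> ` ?S \<subseteq> ?S"
    proof safe
      fix b :: "real list" assume b: "mset b = mset a"
      have "length b = length xs" using mset_eq_length[OF b] assms(2) by simp
      moreover have "mset (permute_list \<sigma> b) = mset a" using b \<sigma>(1) calculation by simp
      ultimately show "Poly_Mapping.map_key \<sigma> (Poly_Mapping.nth b) \<in> ?S" using map_key by blast
    qed
  qed
  finally show ?thesis .
qed

text \<open>The inequality defines a half space, so it suffices to check the vertices.\<close>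

lemma in_hull_imp_subset_sums_le:
  fixes l :: "nat list"
  assumes l: "sorted_wrt (\<ge>) l" and xs: "length xs = length l"
    and hull: "Poly_Mapping.nth (map real xs) \<in> perm_hull (map real l)"
    and I: "I \<subseteq> {..<length l}"
  shows "(\<Sum>i\<in>I. xs ! i) \<le> sum_list (take (card I) l)"
proof -
  let ?H = "{f. (\<Sum>i\<in>I. Poly_Mapping.lookup f i) \<le> real (sum_list (take (card I) l))} :: (nat \<Rightarrow>\<^sub>0 real) set"
  have conv: "convex ?H"
  proof (rule convexI)
    fix f g :: "nat \<Rightarrow>\<^sub>0 real" and u v :: real
    assume *: "f \<in> ?H" "g \<in> ?H" "0 \<le> u" "0 \<le> v" "u + v = 1"
    let ?c = "real (sum_list (take (card I) l))"
    have "(\<Sum>i\<in>I. Poly_Mapping.lookup (u *\<^sub>R f + v *\<^sub>R g) i)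
        = u * (\<Sum>i\<in>I. Poly_Mapping.lookup f i) + v * (\<Sum>i\<in>I. Poly_Mapping.lookup g i)"
      by (simp add: lookup_add lookup_scaleR_real sum.distrib sum_distrib_left)
    also have "\<dots> \<le> u * ?c + v * ?c" using * by (intro add_mono mult_left_mono) auto
    also have "\<dots> = ?c" using *(5) by (simp flip: distrib_right)
    finally show "u *\<^sub>R f + v *\<^sub>R g \<in> ?H" by simp
  qed
  have "Poly_Mapping.nth ` {b. mset b = mset (map real l)} \<subseteq> ?H"
  proof safe
    fix b assume b: "mset b = mset (map real l)"
    obtain b' where b': "mset b' = mset l" "map real b' = b"
      using ex_mset_preimage[OF b[symmetric]] by blast
    have "(\<Sum>i\<in>I. Poly_Mapping.lookup (Poly_Mapping.nth b) i) = (\<Sum>i\<in>I. real (b' ! i))"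
      using I mset_eq_length[OF b'(1)] unfolding b'(2)[symmetric]
      by (intro sum.cong) (auto simp: nth_default_def)
    then show "(\<Sum>i\<in>I. Poly_Mapping.lookup (Poly_Mapping.nth b) i) \<le> real (sum_list (take (card I) l))"
      using sum_subset_permuted_le[OF l b'(1) I] by (simp flip: of_nat_sum)
  qed
  then have "perm_hull (map real l) \<subseteq> ?H"
    using conv by (rule hull_minimal)
  then have "(\<Sum>i\<in>I. Poly_Mapping.lookup (Poly_Mapping.nth (map real xs)) i) \<le> real (sum_list (take (card I) l))"
    using hull by blast
  moreover have "(\<Sum>i\<in>I. Poly_Mapping.lookup (Poly_Mapping.nth (map real xs)) i) = (\<Sum>i\<in>I. real (xs ! i))"
    using I xs by (intro sum.cong) (auto simp: nth_default_def)
  ultimately show ?thesis by (simp flip: of_nat_sum)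
qed

text \<open>The row-by-row list of entries is indexed by the lexicographic list of cells. This translates
  between sets of positions in the list and sets of cells.\<close>

lemma mat_entries_eq: "mat_entries A = map (($$) A) (List.product [0..<dim_row A] [0..<dim_col A])"
proof -
  have "concat (map (\<lambda>i. map (\<lambda>j. A $$ (i, j)) [0..<dim_col A]) is) = map (($$) A) (List.product is [0..<dim_col A])" for "is"
    by (induction "is") (auto simp: comp_def)
  then show ?thesis by (simp add: mat_entries_def mat_to_list_def)
qed

lemma length_mat_entries [simp]: "length (mat_entries A) = dim_row A * dim_col A"
  by (simp add: mat_entries_eq)

lemma distinct_cells: "distinct (List.product [0..<p] [0..<q])"
  by (simp add: distinct_product)

lemma sum_nth_mat_entries:
  assumes I: "I \<subseteq> {..<dim_row A * dim_col A}"
  defines "J \<equiv> (!) (List.product [0..<dim_row A] [0..<dim_col A]) ` I"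
  shows "(\<Sum>i\<in>I. mat_entries A ! i) = (\<Sum>c\<in>J. A $$ c)" "card J = card I"
    "J \<subseteq> {..<dim_row A} \<times> {..<dim_col A}"
proof -
  let ?cs = "List.product [0..<dim_row A] [0..<dim_col A]"
  have len: "length ?cs = dim_row A * dim_col A" by simp
  have inj: "inj_on ((!) ?cs) I"
    using inj_on_nth[OF distinct_cells, of I "dim_row A" "dim_col A"] I by auto
  then show "card J = card I" by (simp add: J_def card_image)
  have "mat_entries A ! i = A $$ (?cs ! i)" if "i \<in> I" for i
    using that I by (auto simp: mat_entries_eq)
  then show "(\<Sum>i\<in>I. mat_entries A ! i) = (\<Sum>c\<in>J. A $$ c)"
    by (simp add: J_def sum.reindex[OF inj])
  have "?cs ! i \<in> set ?cs" if "i \<in> I" for i using that I len by (intro nth_mem) auto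
  then show "J \<subseteq> {..<dim_row A} \<times> {..<dim_col A}" by (fastforce simp: J_def)
qed

lemma cells_conv_indices:
  assumes "J \<subseteq> {..<p} \<times> {..<q}"
  obtains I where "I \<subseteq> {..<p * q}" "(!) (List.product [0..<p] [0..<q]) ` I = J"
proof
  let ?cs = "List.product [0..<p] [0..<q]"
  let ?I = "{i. i < p * q \<and> ?cs ! i \<in> J}"
  show "?I \<subseteq> {..<p * q}" by auto
  show "(!) ?cs ` ?I = J"
  proof (intro equalityI subsetI)
    fix c assume c: "c \<in> J"
    then have "c \<in> set ?cs" using assms by auto
    then obtain i where "i < length ?cs" "?cs ! i = c" by (metis in_set_conv_nth)
    then show "c \<in> (!) ?cs ` ?I" using c by auto
  qed auto
qed

text \<open>Dominance in a form that does not refer to a sorted sequence: the entries in any set of cells sum up to at most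
  the sum of the same number of largest parts, which for a partition come first.\<close>

definition majorized :: "nat list \<Rightarrow> nat mat \<Rightarrow> bool" where
  "majorized l A \<longleftrightarrow> (\<forall>J\<subseteq>{..<dim_row A} \<times> {..<dim_col A}. (\<Sum>c\<in>J. A $$ c) \<le> sum_list (take (card J) l))"

lemma majorized_iff_indices:
  "majorized l A \<longleftrightarrow>
    (\<forall>I\<subseteq>{..<length (mat_entries A)}. (\<Sum>i\<in>I. mat_entries A ! i) \<le> sum_list (take (card I) l))"
proof
  assume "majorized l A"
  then show "\<forall>I\<subseteq>{..<length (mat_entries A)}. (\<Sum>i\<in>I. mat_entries A ! i) \<le> sum_list (take (card I) l)"
    using sum_nth_mat_entries[of _ A] unfolding majorized_def length_mat_entries by metis
next
  assume R: "\<forall>I\<subseteq>{..<length (mat_entries A)}. (\<Sum>i\<in>I. mat_entries A ! i) \<le> sum_list (take (card I) l)"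
  show "majorized l A"
    unfolding majorized_def
  proof (intro allI impI)
    fix J assume "J \<subseteq> {..<dim_row A} \<times> {..<dim_col A}"
    then obtain I where I: "I \<subseteq> {..<dim_row A * dim_col A}" "(!) (List.product [0..<dim_row A] [0..<dim_col A]) ` I = J"
      by (rule cells_conv_indices)
    have "(\<Sum>i\<in>I. mat_entries A ! i) \<le> sum_list (take (card I) l)" using R I(1) by simp
    then show "(\<Sum>c\<in>J. A $$ c) \<le> sum_list (take (card J) l)"
      using sum_nth_mat_entries(1,2)[OF I(1)] unfolding I(2) by simp
  qed
qed

lemma take_pad: "sum_list (take j (l @ replicate n 0)) = sum_list (take j l)" for l :: "nat list"
  by (simp add: sum_list_replicate)

lemma sorted_pad: "sorted_wrt (\<ge>) l \<Longrightarrow> sorted_wrt (\<ge>) (l @ replicate n 0)" for l :: "nat list"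
  by (auto simp: sorted_wrt_append sorted_wrt_iff_nth_less[of _ "replicate n 0"])

text \<open>The first \<open>j\<close> terms of the sorted sequence are the entries at some set of \<open>j\<close> positions.\<close>

lemma subset_sums_le_imp_dominates:
  fixes l es :: "nat list"
  assumes l: "sorted_wrt (\<ge>) l" "length l \<le> length es" and sum: "sum_list es = sum_list l"
    and le: "\<And>I. I \<subseteq> {..<length es} \<Longrightarrow> (\<Sum>i\<in>I. es ! i) \<le> sum_list (take (card I) l)"
  shows "dominates (l @ replicate (length es - length l) 0) (rev (sort es))"
proof -
  let ?\<nu> = "rev (sort es)"
  have mset: "mset ?\<nu> = mset es" by simp
  obtain \<sigma> where \<sigma>: "\<sigma> permutes {..<length es}" "length ?\<nu> = length es" "\<And>i. i < length es \<Longrightarrow> ?\<nu> ! i = es ! \<sigma> i"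
    by (rule permuted_list_obtain[OF mset]) blast
  have total: "sum_list ?\<nu> = sum_list l"
    using sum mset by (metis sum_mset_sum_list)
  have "sum_list (take j ?\<nu>) \<le> sum_list (take j l)" for j
  proof (cases "j \<le> length es")
    case True
    have inj: "inj_on \<sigma> {..<j}" using permutes_inj[OF \<sigma>(1)] by (rule inj_on_subset) simp
    have "sum_list (take j ?\<nu>) = (\<Sum>i<j. ?\<nu> ! i)"
      using True by (simp add: sum_list_sum_nth atLeast0LessThan min_def)
    also have "\<dots> = (\<Sum>i<j. es ! \<sigma> i)" using True \<sigma>(3) by (intro sum.cong) auto
    also have "\<dots> = (\<Sum>i\<in>\<sigma> ` {..<j}. es ! i)" by (simp add: sum.reindex[OF inj])
    also have "\<dots> \<le> sum_list (take (card (\<sigma> ` {..<j})) l)"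
      using permutes_image[OF \<sigma>(1)] True by (intro le) auto
    finally show ?thesis by (simp add: card_image[OF inj])
  next
    case False
    then have "take j ?\<nu> = ?\<nu>" "take j l = l" using l(2) by simp_all
    then show ?thesis using total by simp
  qed
  moreover have "sorted_wrt (\<ge>) ?\<nu>" by (simp add: sorted_wrt_rev)
  ultimately show ?thesis
    using sorted_pad[OF l(1)] total l(2) by (simp only: dominates_def take_pad) (simp add: sum_list_replicate)
qed

lemma margin_mats_sum_entries:
  assumes "A \<in> margin_mats \<alpha> \<beta>"
  shows "sum_list (mat_entries A) = sum_list \<alpha>"
proof -
  have dim: "dim_row A = length \<alpha>" "dim_col A = length \<beta>" using assms by (auto simp: margin_mats_def)
  have "sum_list (mat_entries A) = (\<Sum>c\<in>{..<length \<alpha>} \<times> {..<length \<beta>}. A $$ c)"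
    unfolding mat_entries_eq dim
    by (subst sum_list_distinct_conv_sum_set[OF distinct_cells]) (simp add: atLeast0LessThan)
  also have "\<dots> = (\<Sum>i<length \<alpha>. \<Sum>j<length \<beta>. A $$ (i, j))"
    by (simp add: sum.cartesian_product case_prod_beta)
  also have "\<dots> = (\<Sum>i<length \<alpha>. \<alpha> ! i)" using assms by (simp add: margin_mats_def)
  finally show ?thesis by (simp add: sum_list_sum_nth atLeast0LessThan)
qed

text \<open>If the partition had more parts than the matrix has cells, the sum of all entries would be bounded by a
  proper initial sum of the partition, whose parts are positive.\<close>

lemma majorized_imp_length_le:
  assumes \<gamma>: "is_partition \<gamma>" and A: "A \<in> margin_mats \<alpha> \<beta>" and sum: "sum_list \<gamma> = sum_list \<alpha>"
    and maj: "majorized \<gamma> A"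
  shows "length \<gamma> \<le> length (mat_entries A)"
proof (rule ccontr)
  let ?n = "length (mat_entries A)"
  assume "\<not> ?thesis"
  then have n: "?n < length \<gamma>" by simp
  have "sum_list (mat_entries A) = (\<Sum>i\<in>{..<?n}. mat_entries A ! i)"
    by (simp only: sum_list_sum_nth atLeast0LessThan)
  also have "\<dots> \<le> sum_list (take (card {..<?n}) \<gamma>)"
    using maj unfolding majorized_iff_indices by blast
  finally have le: "sum_list \<gamma> \<le> sum_list (take ?n \<gamma>)"
    using margin_mats_sum_entries[OF A] sum by simp
  have "\<gamma> = take ?n \<gamma> @ \<gamma> ! ?n # drop (Suc ?n) \<gamma>" using n by (rule id_take_nth_drop)
  then have "sum_list \<gamma> = sum_list (take ?n \<gamma>) + (\<gamma> ! ?n + sum_list (drop (Suc ?n) \<gamma>))"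
    by (metis sum_list.Cons sum_list_append)
  moreover have "0 < \<gamma> ! ?n" using \<gamma> n by (simp add: is_partition_def)
  ultimately show False using le by linarith
qed

text \<open>The theorem of Rado for the entries of the matrix. Dominance also yields the restriction on the number of parts.\<close>

lemma permutohedron_mats_iff:
  assumes \<gamma>: "is_partition \<gamma>" and sum: "sum_list \<gamma> = sum_list \<alpha>"
  shows "A \<in> permutohedron_mats \<gamma> \<alpha> \<beta> \<longleftrightarrow> A \<in> margin_mats \<alpha> \<beta> \<and> majorized \<gamma> A"
proof (cases "A \<in> margin_mats \<alpha> \<beta>")
  case A: True
  let ?es = "mat_entries A"
  let ?pad = "\<gamma> @ replicate (length ?es - length \<gamma>) 0"
  have dim: "length ?es = length \<alpha> * length \<beta>" using A by (auto simp: margin_mats_def)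
  have sorted: "sorted_wrt (\<ge>) \<gamma>" using \<gamma> by (simp add: is_partition_def)
  have mem: "A \<in> permutohedron_mats \<gamma> \<alpha> \<beta> \<longleftrightarrow> length \<gamma> \<le> length ?es \<and>
      Poly_Mapping.nth (map real ?es) \<in> perm_hull (map real ?pad)"
    using A dim by (auto simp: permutohedron_mats_def permutohedron_def)
  show ?thesis
  proof
    assume L: "A \<in> permutohedron_mats \<gamma> \<alpha> \<beta>"
    then have len: "length ?es = length ?pad" unfolding mem by simp
    have "(\<Sum>i\<in>I. ?es ! i) \<le> sum_list (take (card I) \<gamma>)" if "I \<subseteq> {..<length ?es}" for I
      using in_hull_imp_subset_sums_le[OF sorted_pad[OF sorted] len, of I] L that len
      unfolding mem take_pad by metis
    then show "A \<in> margin_mats \<alpha> \<beta> \<and> majorized \<gamma> A" using A unfolding majorized_iff_indices by blast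
  next
    assume R: "A \<in> margin_mats \<alpha> \<beta> \<and> majorized \<gamma> A"
    then have len: "length \<gamma> \<le> length ?es" using majorized_imp_length_le[OF \<gamma> A sum] by blast
    have "dominates ?pad (rev (sort ?es))"
    proof (rule subset_sums_le_imp_dominates[OF sorted len])
      show "sum_list ?es = sum_list \<gamma>" using margin_mats_sum_entries[OF A] sum by simp
      show "(\<Sum>i\<in>I. ?es ! i) \<le> sum_list (take (card I) \<gamma>)" if "I \<subseteq> {..<length ?es}" for I
        using R that unfolding majorized_iff_indices by blast
    qed
    then have "Poly_Mapping.nth (map real (rev (sort ?es))) \<in>
        perm_hull (map real ?pad)"
      by (rule dominates_imp_in_hull)
    then have "Poly_Mapping.nth (map real ?es) \<in>
        perm_hull (map real ?pad)"
      by (rule in_hull_permuted) (use len in simp_all)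
    then show "A \<in> permutohedron_mats \<gamma> \<alpha> \<beta>" unfolding mem using len by blast
  qed
qed (simp add: permutohedron_mats_def)

lemma rev_sort_split_zeros:
  fixes es :: "nat list"
  shows "rev (sort es) = rev (sort (filter (\<lambda>x. 0 < x) es)) @ replicate (length (filter (\<lambda>x. x = 0) es)) 0"
proof -
  have "filter (\<lambda>x. x = 0) es = replicate (length (filter (\<lambda>x. x = 0) es)) 0"
    by (induction es) auto
  then have "mset es = mset (replicate (length (filter (\<lambda>x. x = 0) es)) 0 @ sort (filter (\<lambda>x. 0 < x) es))"
    using multiset_partition[of "mset es" "\<lambda>x. x = 0"] by (simp flip: mset_filter)
  moreover have "sorted (replicate (length (filter (\<lambda>x. x = 0) es)) 0 @ sort (filter (\<lambda>x. 0 < x) es))"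
    by (auto simp: sorted_append sorted_replicate)
  ultimately have "sort es = replicate (length (filter (\<lambda>x. x = 0) es)) 0 @ sort (filter (\<lambda>x. 0 < x) es)"
    by (metis properties_for_sort)
  then show ?thesis by simp
qed

text \<open>Zero parts of the shape are empty rows at the bottom, and zero parts of the content are the letters
  that do not occur.\<close>

lemma is_ssyt_strip_zeros:
  assumes T: "is_ssyt (l @ replicate n 0) (\<nu> @ replicate k 0) T"
  shows "is_ssyt l \<nu> (take (length l) T)"
proof -
  let ?T = "take (length l) T"
  have lens: "map length T = l @ replicate n 0" using T by (simp only: is_ssyt_def)
  have "map length ?T = l" using arg_cong[OF lens, of "take (length l)"] by (simp add: take_map)
  have "map length (drop (length l) T) = replicate n 0"
    using arg_cong[OF lens, of "drop (length l)"] by (simp add: drop_map)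
  then have "\<forall>r\<in>set (drop (length l) T). r = []"
    by (metis in_set_replicate length_0_conv list.set_map image_eqI)
  then have "concat (drop (length l) T) = []" by simp
  then have conc: "concat T = concat ?T"
    by (metis append_Nil2 append_take_drop_id concat_append)
  have "Suc v \<notin> set (concat T)" if "length \<nu> \<le> v" for v
  proof
    assume mem: "Suc v \<in> set (concat T)"
    then have v: "v < length (\<nu> @ replicate k 0)" using T unfolding is_ssyt_def by auto
    then have "count_list (concat T) (Suc v) = 0" using T that by (simp add: is_ssyt_def nth_append)
    then show False using mem by (simp add: count_list_0_iff)
  qed
  note big = this
  have "y \<in> {1..length \<nu>}" if y: "y \<in> set (concat T)" for y
  proof -
    have "1 \<le> y" using T y unfolding is_ssyt_def by (meson atLeastAtMost_iff subsetD)
    then obtain v where "y = Suc v" by (cases y) auto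
    then show ?thesis using big[of v] y by (cases "length \<nu> \<le> v") auto
  qed
  then have "set (concat ?T) \<subseteq> {1..length \<nu>}" unfolding conc[symmetric] by blast
  moreover have "count_list (concat ?T) (Suc v) = \<nu> ! v" if "v < length \<nu>" for v
    unfolding conc[symmetric] using T that by (simp add: is_ssyt_def nth_append)
  moreover have "\<forall>r\<in>set ?T. sorted r" using T by (auto simp: is_ssyt_def dest: in_set_takeD)
  moreover have "?T ! i ! j < ?T ! Suc i ! j"
    if "Suc i < length ?T" "j < length (?T ! i)" "j < length (?T ! Suc i)" for i j
    using T that by (simp add: is_ssyt_def)
  ultimately show ?thesis using \<open>map length ?T = l\<close> unfolding is_ssyt_def by blast
qed

lemma majorized_imp_ssyt_exists:
  assumes \<gamma>: "is_partition \<gamma>" and A: "A \<in> margin_mats \<alpha> \<beta>" and sum: "sum_list \<gamma> = sum_list \<alpha>"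
    and maj: "majorized \<gamma> A"
  shows "\<exists>T. is_ssyt \<gamma> (mat_partition A) T"
proof -
  let ?es = "mat_entries A"
  have sorted: "sorted_wrt (\<ge>) \<gamma>" using \<gamma> by (simp add: is_partition_def)
  have "dominates (\<gamma> @ replicate (length ?es - length \<gamma>) 0) (rev (sort ?es))"
  proof (rule subset_sums_le_imp_dominates[OF sorted majorized_imp_length_le[OF assms]])
    show "sum_list ?es = sum_list \<gamma>" using margin_mats_sum_entries[OF A] sum by simp
    show "(\<Sum>i\<in>I. ?es ! i) \<le> sum_list (take (card I) \<gamma>)" if "I \<subseteq> {..<length ?es}" for I
      using maj that unfolding majorized_iff_indices by blast
  qed
  then obtain T where "is_ssyt (\<gamma> @ replicate (length ?es - length \<gamma>) 0) (rev (sort ?es)) T"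
    using dominates_imp_ssyt_exists by blast
  then have "is_ssyt (\<gamma> @ replicate (length ?es - length \<gamma>) 0)
      (mat_partition A @ replicate (length (filter (\<lambda>x. x = 0) ?es)) 0) T"
    unfolding rev_sort_split_zeros[of ?es] by (simp only: mat_partition_def)
  then show ?thesis using is_ssyt_strip_zeros by blast
qed

section \<open>Matrices that are not additive\<close>

text \<open>Sums of elements with repetition, that is, combinations with natural coefficients that are not all zero.
  Induction over this set replaces the manipulation of coefficients.\<close>

inductive_set semigroup_span :: "(nat \<Rightarrow> int) set \<Rightarrow> (nat \<Rightarrow> int) set" for S where
  base: "v \<in> S \<Longrightarrow> v \<in> semigroup_span S"
| add: "u \<in> semigroup_span S \<Longrightarrow> v \<in> semigroup_span S \<Longrightarrow> (\<lambda>i. u i + v i) \<in> semigroup_span S"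

lemma semigroup_span_scale:
  assumes "v \<in> semigroup_span S" "0 < c"
  shows "(\<lambda>i. c * v i) \<in> semigroup_span S"
proof -
  have "(\<lambda>i. int (Suc n) * v i) \<in> semigroup_span S" for n
  proof (induction n)
    case (Suc n)
    have "(\<lambda>i. int (Suc (Suc n)) * v i) = (\<lambda>i. int (Suc n) * v i + v i)"
      by (auto simp: algebra_simps)
    then show ?case using semigroup_span.add[OF Suc assms(1)] by simp
  qed (use assms in simp)
  then have "(\<lambda>i. int (Suc (nat c - 1)) * v i) \<in> semigroup_span S" .
  moreover have "int (Suc (nat c - 1)) = c" using assms(2) by simp
  ultimately show ?thesis by simp
qed

lemma semigroup_span_mono:
  assumes "S' \<subseteq> semigroup_span S" "v \<in> semigroup_span S'"
  shows "v \<in> semigroup_span S"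
  using assms(2) by induction (use assms(1) in \<open>auto intro: semigroup_span.add\<close>)

lemma finite_strictly_between:
  fixes L U :: "real set"
  assumes "finite L" "finite U" "\<And>l u. l \<in> L \<Longrightarrow> u \<in> U \<Longrightarrow> l < u"
  shows "\<exists>t. (\<forall>l\<in>L. l < t) \<and> (\<forall>u\<in>U. t < u)"
proof (cases "L = {}")
  case True
  show ?thesis
  proof (cases "U = {}")
    case False
    have "Min U - 1 < u" if "u \<in> U" for u using Min_le[OF assms(2) that] by simp
    then show ?thesis using True by blast
  qed (use True in simp)
next
  case L: False
  show ?thesis
  proof (cases "U = {}")
    case True
    have "l < Max L + 1" if "l \<in> L" for l using Max_ge[OF assms(1) that] by simp
    then show ?thesis using True by blast
  next
    case False
    have "Max L < Min U" using assms L False by simp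
    then obtain t where t: "Max L < t" "t < Min U" using dense by blast
    then show ?thesis using assms(1,2) L False by (intro exI[of _ t]) auto
  qed
qed

text \<open>Gordan's theorem of the alternative for integer vectors, by Fourier-Motzkin elimination. To eliminate the
  last coordinate, keep the vectors in which it is zero and add, for each pair with a positive and a negative last
  coordinate, the integral combination that cancels it. A functional that is positive on these extends:
  the pairs say precisely that every lower bound for the new coefficient is below every upper bound.
  Integrality matters, since the coefficients of a relation will become multiples of matrices.\<close>

lemma positive_functional_or_zero_in_semigroup:
  assumes "finite S"
  shows "(\<exists>x :: nat \<Rightarrow> real. \<forall>v\<in>S. 0 < (\<Sum>i<d. x i * v i)) \<or> (\<exists>v\<in>semigroup_span S. \<forall>i<d. v i = 0)"
  using assms
proof (induction d arbitrary: S)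
  case 0
  show ?case
  proof (cases "S = {}")
    case False
    then show ?thesis by (auto intro: semigroup_span.base)
  qed simp
next
  case (Suc d)
  define P where "P = {v \<in> S. 0 < v d}"
  define N where "N = {v \<in> S. v d < 0}"
  define Z where "Z = {v \<in> S. v d = 0}"
  define comb where "comb = (\<lambda>(u, v) i. (- v d) * u i + u d * v i :: int)"
  define S' where "S' = Z \<union> comb ` (P \<times> N)"
  have fin: "finite P" "finite N" "finite S'" using Suc.prems by (auto simp: P_def N_def Z_def S'_def)
  have "comb (u, v) \<in> semigroup_span S" if "u \<in> P" "v \<in> N" for u v
  proof -
    have "(\<lambda>i. (- v d) * u i) \<in> semigroup_span S" "(\<lambda>i. u d * v i) \<in> semigroup_span S"
      using that by (intro semigroup_span_scale semigroup_span.base; simp add: P_def N_def)+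
    from semigroup_span.add[OF this] show ?thesis by (simp add: comb_def)
  qed
  then have S'_sub: "S' \<subseteq> semigroup_span S" by (auto simp: S'_def Z_def intro: semigroup_span.base)
  have zero: "v d = 0" if "v \<in> semigroup_span S'" for v
    using that by induction (auto simp: S'_def Z_def comb_def)
  from Suc.IH[OF fin(3)] show ?case
  proof
    assume "\<exists>v\<in>semigroup_span S'. \<forall>i<d. v i = 0"
    then obtain v where "v \<in> semigroup_span S'" "\<forall>i<d. v i = 0" by blast
    then show ?thesis using semigroup_span_mono[OF S'_sub] zero less_Suc_eq by metis
  next
    assume "\<exists>x :: nat \<Rightarrow> real. \<forall>v\<in>S'. 0 < (\<Sum>i<d. x i * v i)"
    then obtain x :: "nat \<Rightarrow> real" where x: "\<And>v. v \<in> S' \<Longrightarrow> 0 < (\<Sum>i<d. x i * v i)" by blast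
    define f where "f v = (\<Sum>i<d. x i * v i)" for v :: "nat \<Rightarrow> int"
    \<comment> \<open>the bounds that the vectors of \<open>P\<close> and \<open>N\<close> impose on the coefficient \<open>t\<close> of the last coordinate\<close>
    have "\<exists>t. (\<forall>l\<in>(\<lambda>v. - f v / v d) ` P. l < t) \<and> (\<forall>u\<in>(\<lambda>v. - f v / v d) ` N. t < u)"
    proof (rule finite_strictly_between)
      fix l u' assume "l \<in> (\<lambda>v. - f v / v d) ` P" "u' \<in> (\<lambda>v. - f v / v d) ` N"
      then obtain u v where uv: "u \<in> P" "v \<in> N" "l = - f u / u d" "u' = - f v / v d" by blast
      have "0 < f (comb (u, v))" using x uv by (auto simp: f_def S'_def)
      also have "f (comb (u, v)) = (- real_of_int (v d)) * f u + u d * f v"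
        by (simp add: f_def comb_def sum_distrib_left sum.distrib[symmetric] algebra_simps)
      finally have "real_of_int (v d) * f u < u d * f v" by simp
      moreover have "0 < real_of_int (u d)" "real_of_int (v d) < 0" using uv by (auto simp: P_def N_def)
      ultimately show "l < u'" unfolding uv by (simp add: divide_simps mult.commute)
    qed (use fin in auto)
    then obtain t where t: "\<And>v. v \<in> P \<Longrightarrow> - f v / v d < t" "\<And>v. v \<in> N \<Longrightarrow> t < - f v / v d" by blast
    have "0 < (\<Sum>i<Suc d. (x(d := t)) i * v i)" if v: "v \<in> S" for v
    proof -
      have eq: "(\<Sum>i<Suc d. (x(d := t)) i * v i) = f v + t * v d" by (simp add: f_def)
      consider "v \<in> P" | "v \<in> N" | "v \<in> Z" using v by (force simp: P_def N_def Z_def)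
      then show ?thesis
      proof cases
        case 1
        then have "0 < real_of_int (v d)" by (simp add: P_def)
        then show ?thesis using t(1)[OF 1] unfolding eq by (simp add: divide_simps split: if_splits)
      next
        case 2
        then have "real_of_int (v d) < 0" by (simp add: N_def)
        then show ?thesis using t(2)[OF 2] unfolding eq by (simp add: divide_simps split: if_splits)
      next
        case 3
        then have "v \<in> S'" by (simp add: S'_def)
        then show ?thesis using x[of v] 3 unfolding eq by (simp add: f_def Z_def)
      qed
    qed
    then show ?thesis by blast
  qed
qed

text \<open>The coefficients of \<open>x\<^sub>i + y\<^sub>j - x\<^sub>k - y\<^sub>l\<close> in the variables \<open>x\<^sub>0, \<dots>, x\<^bsub>p-1\<^esub>, y\<^sub>0, y\<^sub>1, \<dots>\<close> listed in this
  order.\<close>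

definition comparison_vec :: "nat \<Rightarrow> nat \<Rightarrow> nat \<Rightarrow> nat \<Rightarrow> nat \<Rightarrow> nat \<Rightarrow> int" where
  "comparison_vec p i j k l n = of_bool (n = i) - of_bool (n = k) + of_bool (n = p + j) - of_bool (n = p + l)"

lemma sum_list_take_scale: "sum_list (take k (scale_partition n l)) = n * sum_list (take k l)"
  by (simp add: scale_partition_def take_map sum_list_const_mult)

text \<open>\<open>B\<close> competes with \<open>C\<close> times \<open>A\<close>: it is majorized by \<open>C\<close> times \<open>\<gamma>\<close>, its margins fall short by \<open>v\<close>, and its
  inner product with \<open>A\<close> is too small for the two to be equal. Each clause is additive in \<open>(v, C, B)\<close>.\<close>

definition perturbation ::
    "nat list \<Rightarrow> nat list \<Rightarrow> nat list \<Rightarrow> nat mat \<Rightarrow> (nat \<Rightarrow> int) \<Rightarrow> nat \<Rightarrow> (nat \<times> nat \<Rightarrow> nat) \<Rightarrow> bool" where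
  "perturbation \<alpha> \<beta> \<gamma> A v C B \<longleftrightarrow> 1 \<le> C \<and>
    (\<forall>i<length \<alpha>. (\<Sum>j<length \<beta>. int (B (i, j))) = int C * int (\<alpha> ! i) - v i) \<and>
    (\<forall>j<length \<beta>. (\<Sum>i<length \<alpha>. int (B (i, j))) = int C * int (\<beta> ! j) - v (length \<alpha> + j)) \<and>
    (\<forall>J\<subseteq>{..<length \<alpha>} \<times> {..<length \<beta>}. (\<Sum>c\<in>J. B c) \<le> C * sum_list (take (card J) \<gamma>)) \<and>
    (\<Sum>c\<in>{..<length \<alpha>} \<times> {..<length \<beta>}. A $$ c * B c) < C * (\<Sum>c\<in>{..<length \<alpha>} \<times> {..<length \<beta>}. A $$ c * A $$ c)"

text \<open>Move one unit from the larger entry \<open>(i, j)\<close> to the smaller entry \<open>(k, l)\<close>. Only a set \<open>J\<close> that contains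
  \<open>(k, l)\<close> but not \<open>(i, j)\<close> gains by this. Exchanging \<open>(k, l)\<close> for \<open>(i, j)\<close> in \<open>J\<close> gains at least as much in \<open>A\<close>, so the
  sum stays within the bound that holds for \<open>A\<close>.\<close>

lemma perturbation_base:
  assumes A: "A \<in> margin_mats \<alpha> \<beta>" and maj: "majorized \<gamma> A"
    and ij: "i < length \<alpha>" "j < length \<beta>" and kl: "k < length \<alpha>" "l < length \<beta>"
    and gt: "A $$ (k, l) < A $$ (i, j)"
  shows "\<exists>B. perturbation \<alpha> \<beta> \<gamma> A (comparison_vec (length \<alpha>) i j k l) 1 B"
proof -
  let ?p = "length \<alpha>" and ?q = "length \<beta>"
  let ?C = "{..<?p} \<times> {..<?q}"
  have dim: "dim_row A = ?p" "dim_col A = ?q" using A by (auto simp: margin_mats_def)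
  define B where "B c = A $$ c + of_bool (c = (k, l)) - of_bool (c = (i, j))" for c
  have B: "int (B c) = int (A $$ c) + of_bool (c = (k, l)) - of_bool (c = (i, j))" for c
    using gt by (auto simp: B_def of_bool_def)
  have sumB: "(\<Sum>c\<in>J. int (B c)) = (\<Sum>c\<in>J. int (A $$ c)) + of_bool ((k, l) \<in> J) - of_bool ((i, j) \<in> J)"
    if "finite J" for J
    unfolding B sum.distrib sum_subtractf using that by (simp add: of_bool_def)
  have rows: "(\<Sum>j'<?q. int (B (r, j'))) = int 1 * int (\<alpha> ! r) - comparison_vec ?p i j k l r" if r: "r < ?p" for r
  proof -
    have "(\<Sum>j'<?q. int (A $$ (r, j'))) = int (\<alpha> ! r)"
      using A r by (simp add: margin_mats_def flip: of_nat_sum)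
    moreover have "(\<Sum>j'<?q. of_bool ((r, j') = (s, t))) = (of_bool (r = s) :: int)" if "t < ?q" for s t
      using that by (auto simp: of_bool_def)
    ultimately show ?thesis using ij kl r
      unfolding B sum.distrib sum_subtractf by (simp add: comparison_vec_def)
  qed
  have cols: "(\<Sum>i'<?p. int (B (i', r))) = int 1 * int (\<beta> ! r) - comparison_vec ?p i j k l (?p + r)" if r: "r < ?q" for r
  proof -
    have "(\<Sum>i'<?p. int (A $$ (i', r))) = int (\<beta> ! r)"
      using A r by (simp add: margin_mats_def flip: of_nat_sum)
    moreover have "(\<Sum>i'<?p. of_bool ((i', r) = (s, t))) = (of_bool (r = t) :: int)" if "s < ?p" for s t
      using that by (auto simp: of_bool_def)
    ultimately show ?thesis using ij kl r
      unfolding B sum.distrib sum_subtractf by (simp add: comparison_vec_def)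
  qed
  have major: "(\<Sum>c\<in>J. B c) \<le> 1 * sum_list (take (card J) \<gamma>)" if J: "J \<subseteq> ?C" for J
  proof -
    have fin: "finite J" using J finite_subset by blast
    have le: "(\<Sum>c\<in>J'. A $$ c) \<le> sum_list (take (card J') \<gamma>)" if "J' \<subseteq> ?C" for J'
      using maj that dim by (simp add: majorized_def)
    show ?thesis
    proof (cases "(k, l) \<in> J \<and> (i, j) \<notin> J")
      case True
      \<comment> \<open>the set with the larger of the two cells, to which the bound for \<open>A\<close> applies\<close>
      let ?J = "insert (i, j) (J - {(k, l)})"
      have "card ?J = Suc (card (J - {(k, l)}))"
        by (rule card_insert_disjoint) (use True fin in auto)
      also have "\<dots> = card J" by (rule card_Suc_Diff1) (use True fin in auto)
      finally have "card ?J = card J" .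
      then have "(\<Sum>c\<in>?J. A $$ c) \<le> sum_list (take (card J) \<gamma>)" using le[of ?J] J ij by auto
      moreover have "(\<Sum>c\<in>?J. A $$ c) = A $$ (i, j) + (\<Sum>c\<in>J - {(k, l)}. A $$ c)" using True fin by simp
      moreover have "(\<Sum>c\<in>J. A $$ c) = A $$ (k, l) + (\<Sum>c\<in>J - {(k, l)}. A $$ c)"
        using True fin by (simp add: sum.remove)
      moreover have "int (\<Sum>c\<in>J. B c) = int (\<Sum>c\<in>J. A $$ c) + 1" using sumB[OF fin] True by simp
      ultimately show ?thesis using gt by linarith
    next
      case False
      have "int (\<Sum>c\<in>J. B c) \<le> int (\<Sum>c\<in>J. A $$ c)" using sumB[OF fin] False by (auto simp: of_bool_def)
      then show ?thesis using le[OF J] by linarith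
    qed
  qed
  have inner: "(\<Sum>c\<in>?C. A $$ c * B c) < 1 * (\<Sum>c\<in>?C. A $$ c * A $$ c)"
  proof -
    have "int (\<Sum>c\<in>?C. A $$ c * B c) = (\<Sum>c\<in>?C. int (A $$ c) * int (A $$ c)
        + (if c = (k, l) then int (A $$ c) else 0) - (if c = (i, j) then int (A $$ c) else 0))"
      unfolding of_nat_sum of_nat_mult B by (intro sum.cong) (auto simp: algebra_simps)
    also have "\<dots> = int (\<Sum>c\<in>?C. A $$ c * A $$ c) + int (A $$ (k, l)) - int (A $$ (i, j))"
      using ij kl by (simp only: sum.distrib sum_subtractf sum.delta finite_SigmaI finite_lessThan) simp
    finally show ?thesis using gt by linarith
  qed
  show ?thesis unfolding perturbation_def using rows cols major inner by blast
qed

lemma perturbation_add: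
  assumes "perturbation \<alpha> \<beta> \<gamma> A u C B" "perturbation \<alpha> \<beta> \<gamma> A v C' B'"
  shows "perturbation \<alpha> \<beta> \<gamma> A (\<lambda>n. u n + v n) (C + C') (\<lambda>c. B c + B' c)"
  unfolding perturbation_def
proof (intro conjI allI impI)
  fix J assume "J \<subseteq> {..<length \<alpha>} \<times> {..<length \<beta>}"
  then have "(\<Sum>c\<in>J. B c) \<le> C * sum_list (take (card J) \<gamma>)" "(\<Sum>c\<in>J. B' c) \<le> C' * sum_list (take (card J) \<gamma>)"
    using assms by (simp_all add: perturbation_def)
  then show "(\<Sum>c\<in>J. B c + B' c) \<le> (C + C') * sum_list (take (card J) \<gamma>)"
    by (simp add: sum.distrib add_mult_distrib)
next
  fix i assume "i < length \<alpha>"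
  then have "(\<Sum>j<length \<beta>. int (B (i, j))) = int C * int (\<alpha> ! i) - u i"
    "(\<Sum>j<length \<beta>. int (B' (i, j))) = int C' * int (\<alpha> ! i) - v i"
    using assms by (simp_all add: perturbation_def)
  then show "(\<Sum>j<length \<beta>. int (B (i, j) + B' (i, j))) = int (C + C') * int (\<alpha> ! i) - (u i + v i)"
    by (simp add: sum.distrib distrib_right)
next
  fix j assume "j < length \<beta>"
  then have "(\<Sum>i<length \<alpha>. int (B (i, j))) = int C * int (\<beta> ! j) - u (length \<alpha> + j)"
    "(\<Sum>i<length \<alpha>. int (B' (i, j))) = int C' * int (\<beta> ! j) - v (length \<alpha> + j)"
    using assms by (simp_all add: perturbation_def)
  then show "(\<Sum>i<length \<alpha>. int (B (i, j) + B' (i, j))) =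
      int (C + C') * int (\<beta> ! j) - (u (length \<alpha> + j) + v (length \<alpha> + j))"
    by (simp add: sum.distrib distrib_right)
next
  let ?C = "{..<length \<alpha>} \<times> {..<length \<beta>}"
  have "(\<Sum>c\<in>?C. A $$ c * B c) < C * (\<Sum>c\<in>?C. A $$ c * A $$ c)"
    "(\<Sum>c\<in>?C. A $$ c * B' c) < C' * (\<Sum>c\<in>?C. A $$ c * A $$ c)"
    using assms by (simp_all add: perturbation_def)
  then show "(\<Sum>c\<in>?C. A $$ c * (B c + B' c)) < (C + C') * (\<Sum>c\<in>?C. A $$ c * A $$ c)"
    by (simp add: sum.distrib distrib_right distrib_left)
  show "1 \<le> C + C'" using assms by (simp add: perturbation_def)
qed

text \<open>If \<open>A\<close> is not additive, the strict inequalities between the potentials are unsolvable, so by Gordan's theorem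
  the comparison vectors have a nontrivial relation with natural coefficients. Applied to a multiple of \<open>A\<close>, the
  corresponding one-unit transfers keep all margins, and their sum produces a matrix other than that multiple of \<open>A\<close>.\<close>

lemma non_additive_imp_other_majorized_mat:
  assumes A: "A \<in> margin_mats \<alpha> \<beta>" and maj: "majorized \<gamma> A" and na: "\<not> additive_mat A"
  shows "\<exists>C B. 1 \<le> C \<and> B \<in> margin_mats (scale_partition C \<alpha>) (scale_partition C \<beta>) \<and>
    majorized (scale_partition C \<gamma>) B \<and> B \<noteq> C \<cdot>\<^sub>m A"
proof -
  let ?p = "length \<alpha>" and ?q = "length \<beta>"
  let ?C = "{..<?p} \<times> {..<?q}"
  have dim: "dim_row A = ?p" "dim_col A = ?q" "A \<in> carrier_mat ?p ?q" using A by (auto simp: margin_mats_def)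
  define S where "S = {comparison_vec ?p i j k l |i j k l.
    i < ?p \<and> j < ?q \<and> k < ?p \<and> l < ?q \<and> A $$ (k, l) < A $$ (i, j)}"
  have "finite S"
  proof (rule finite_subset)
    show "S \<subseteq> (\<lambda>(c, d). comparison_vec ?p (fst c) (snd c) (fst d) (snd d)) ` (?C \<times> ?C)"
    proof
      fix v assume "v \<in> S"
      then obtain i j k l where "i < ?p" "j < ?q" "k < ?p" "l < ?q" "v = comparison_vec ?p i j k l"
        unfolding S_def by blast
      then show "v \<in> (\<lambda>(c, d). comparison_vec ?p (fst c) (snd c) (fst d) (snd d)) ` (?C \<times> ?C)"
        by (intro image_eqI[of _ _ "((i, j), (k, l))"]) simp_all
    qed
  qed simp
  then consider x :: "nat \<Rightarrow> real" where "\<And>v. v \<in> S \<Longrightarrow> 0 < (\<Sum>n<?p + ?q. x n * v n)"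
    | v where "v \<in> semigroup_span S" "\<And>n. n < ?p + ?q \<Longrightarrow> v n = 0"
    using positive_functional_or_zero_in_semigroup[of S "?p + ?q"] by blast
  then show ?thesis
  proof cases
    case 1
    have key: "x i + x (?p + j) > x k + x (?p + l)"
      if "i < ?p" "k < ?p" "j < ?q" "l < ?q" "A $$ (i, j) > A $$ (k, l)" for i j k l
    proof -
      have "0 < (\<Sum>n<?p + ?q. x n * comparison_vec ?p i j k l n)"
        using that by (intro 1) (auto simp: S_def)
      also have "\<dots> = (\<Sum>n<?p + ?q. (if n = i then x n else 0) - (if n = k then x n else 0)
          + (if n = ?p + j then x n else 0) - (if n = ?p + l then x n else 0))"
        by (intro sum.cong) (auto simp: comparison_vec_def)
      also have "\<dots> = x i - x k + x (?p + j) - x (?p + l)"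
        using that by (simp add: sum.distrib sum_subtractf)
      finally show ?thesis by simp
    qed
    have "additive_mat A"
      unfolding additive_mat_def dim(1,2)
      by (rule exI[of _ x], rule exI[of _ "\<lambda>j. x (?p + j)"], intro allI impI, rule key)
    then show ?thesis using na by simp
  next
    case 2
    \<comment> \<open>at the relation \<open>v = 0\<close> the margins are exactly those of the multiple\<close>
    have "\<exists>C B. perturbation \<alpha> \<beta> \<gamma> A v C B"
      using 2(1)
    proof induction
      case (base v)
      then obtain i j k l where "i < ?p" "j < ?q" "k < ?p" "l < ?q" "A $$ (k, l) < A $$ (i, j)"
          "v = comparison_vec ?p i j k l"
        unfolding S_def by blast
      then show ?case using perturbation_base[OF A maj, of i j k l] by blast
    next
      case (add u v)
      then obtain C B C' B' where "perturbation \<alpha> \<beta> \<gamma> A u C B" "perturbation \<alpha> \<beta> \<gamma> A v C' B'"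
        by blast
      from perturbation_add[OF this] show ?case by blast
    qed
    then obtain C B where pert: "perturbation \<alpha> \<beta> \<gamma> A v C B" by blast
    let ?B = "mat ?p ?q B"
    have C: "1 \<le> C" using pert by (simp add: perturbation_def)
    have "(\<Sum>j<?q. B (i, j)) = C * \<alpha> ! i" if "i < ?p" for i
    proof -
      have "int (\<Sum>j<?q. B (i, j)) = int (C * \<alpha> ! i)"
        using pert that 2(2)[of i] by (simp add: perturbation_def)
      then show ?thesis by (simp only: of_nat_eq_iff)
    qed
    moreover have "(\<Sum>i<?p. B (i, j)) = C * \<beta> ! j" if "j < ?q" for j
    proof -
      have "int (\<Sum>i<?p. B (i, j)) = int (C * \<beta> ! j)"
        using pert that 2(2)[of "?p + j"] by (simp add: perturbation_def)
      then show ?thesis by (simp only: of_nat_eq_iff)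
    qed
    ultimately have "?B \<in> margin_mats (scale_partition C \<alpha>) (scale_partition C \<beta>)"
      by (simp add: margin_mats_def scale_partition_def)
    moreover have "majorized (scale_partition C \<gamma>) ?B"
      unfolding majorized_def
    proof (intro allI impI)
      fix J assume "J \<subseteq> {..<dim_row ?B} \<times> {..<dim_col ?B}"
      then have J: "J \<subseteq> ?C" by simp
      then have "(\<Sum>c\<in>J. ?B $$ c) = (\<Sum>c\<in>J. B c)" by (intro sum.cong) auto
      then show "(\<Sum>c\<in>J. ?B $$ c) \<le> sum_list (take (card J) (scale_partition C \<gamma>))"
        using pert J by (simp add: perturbation_def sum_list_take_scale)
    qed
    moreover have "?B \<noteq> C \<cdot>\<^sub>m A"
    proof
      assume eq: "?B = C \<cdot>\<^sub>m A"
      have "B c = C * A $$ c" if "c \<in> ?C" for c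
      proof -
        obtain i j where c: "c = (i, j)" "i < ?p" "j < ?q" using \<open>c \<in> ?C\<close> by blast
        have "?B $$ (i, j) = (C \<cdot>\<^sub>m A) $$ (i, j)" by (simp only: eq)
        then show ?thesis using c dim by simp
      qed
      then have "(\<Sum>c\<in>?C. A $$ c * B c) = C * (\<Sum>c\<in>?C. A $$ c * A $$ c)"
        unfolding sum_distrib_left by (intro sum.cong) auto
      then show False using pert by (simp add: perturbation_def)
    qed
    ultimately show ?thesis using C by blast
  qed
qed

section \<open>Words with given margins\<close>

definition content_mat :: "nat list \<Rightarrow> nat list \<Rightarrow> (nat \<Rightarrow> nat \<times> nat) \<Rightarrow> nat mat" where
  "content_mat \<alpha> \<beta> w = mat (length \<alpha>) (length \<beta>) (\<lambda>c. card {a \<in> {1..sum_list \<alpha>}. w a = c})"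

lemma content_mat_dim [simp]:
  "dim_row (content_mat \<alpha> \<beta> w) = length \<alpha>" "dim_col (content_mat \<alpha> \<beta> w) = length \<beta>"
  by (simp_all add: content_mat_def)

lemma content_mat_index:
  "c \<in> {..<length \<alpha>} \<times> {..<length \<beta>} \<Longrightarrow> content_mat \<alpha> \<beta> w $$ c = card {a \<in> {1..sum_list \<alpha>}. w a = c}"
  by (auto simp: content_mat_def)

lemma pair_words_range:
  assumes "sum_list \<beta> = sum_list \<alpha>" "w \<in> pair_words \<alpha> \<beta>" "a \<in> {1..sum_list \<alpha>}"
  shows "w a \<in> {..<length \<alpha>} \<times> {..<length \<beta>}"
  using assms by (auto simp: pair_words_def words_def)

lemma sum_card_cells_row:
  fixes v :: "'a \<Rightarrow> nat"
  assumes "finite M" "\<And>a. a \<in> M \<Longrightarrow> v a < q"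
  shows "(\<Sum>j<q. card {a \<in> M. (u a, v a) = (i, j)}) = card {a \<in> M. u a = i}"
proof -
  have "card {a \<in> M. u a = i} = (\<Sum>j<q. card {a \<in> {a \<in> M. u a = i}. v a = j})"
    by (rule card_eq_sum_fibres) (use assms in auto)
  then show ?thesis by (simp add: conj_assoc)
qed

lemma sum_card_cells_column:
  fixes u :: "'a \<Rightarrow> nat"
  assumes "finite M" "\<And>a. a \<in> M \<Longrightarrow> u a < p"
  shows "(\<Sum>i<p. card {a \<in> M. (u a, v a) = (i, j)}) = card {a \<in> M. v a = j}"
  using sum_card_cells_row[where u = v and v = u, OF assms] by (simp add: conj_commute)

lemma content_mat_in_margin_mats:
  assumes sz: "sum_list \<beta> = sum_list \<alpha>" and w: "w \<in> pair_words \<alpha> \<beta>"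
  shows "content_mat \<alpha> \<beta> w \<in> margin_mats \<alpha> \<beta>"
proof -
  obtain u v where uv: "u \<in> words \<alpha>" "v \<in> words \<beta>" "w = (\<lambda>a. (u a, v a))"
    using w by (auto simp: pair_words_def)
  let ?M = "{1..sum_list \<alpha>}"
  have "(\<Sum>j<length \<beta>. content_mat \<alpha> \<beta> w $$ (i, j)) = \<alpha> ! i" if i: "i < length \<alpha>" for i
  proof -
    have "(\<Sum>j<length \<beta>. content_mat \<alpha> \<beta> w $$ (i, j)) = card {a \<in> ?M. u a = i}"
      by (subst sum_card_cells_row[symmetric, where v = v and q = "length \<beta>"])
        (use uv sz i in \<open>auto simp: words_def content_mat_index\<close>)
    then show ?thesis using uv(1) i by (simp add: words_def)
  qed
  moreover have "(\<Sum>i<length \<alpha>. content_mat \<alpha> \<beta> w $$ (i, j)) = \<beta> ! j" if j: "j < length \<beta>" for j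
  proof -
    have "(\<Sum>i<length \<alpha>. content_mat \<alpha> \<beta> w $$ (i, j)) = card {a \<in> ?M. v a = j}"
      by (subst sum_card_cells_column[symmetric, where u = u and p = "length \<alpha>"])
        (use uv j in \<open>auto simp: words_def content_mat_index\<close>)
    then show ?thesis using uv(2) j sz by (simp add: words_def)
  qed
  ultimately show ?thesis by (simp add: margin_mats_def content_mat_def)
qed

lemma content_mat_comp:
  assumes "g \<in> sym_grp (sum_list \<alpha>)"
  shows "content_mat \<alpha> \<beta> (w \<circ> g) = content_mat \<alpha> \<beta> w"
  unfolding content_mat_def card_letter_perm[OF assms] ..

lemma count_list_concat_replicate:
  "distinct cs \<Longrightarrow> count_list (concat (map (\<lambda>c. replicate (f c) c) cs)) d = (if d \<in> set cs then f d else 0)"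
proof (induction cs)
  case (Cons c cs)
  have "count_list (replicate n c) d = (if d = c then n else 0)" for n by (induction n) auto
  then show ?case using Cons by auto
qed simp

text \<open>List every cell as often as its entry says and read the list as a word.\<close>

lemma pair_word_with_content_exists:
  assumes A: "A \<in> margin_mats \<alpha> \<beta>" and sz: "sum_list \<beta> = sum_list \<alpha>"
  obtains w where "w \<in> pair_words \<alpha> \<beta>" "content_mat \<alpha> \<beta> w = A"
proof -
  let ?p = "length \<alpha>" and ?q = "length \<beta>" and ?M = "{1..sum_list \<alpha>}"
  let ?cs = "List.product [0..<?p] [0..<?q]"
  have dim: "dim_row A = ?p" "dim_col A = ?q" using A by (auto simp: margin_mats_def)
  define xs where "xs = concat (map (\<lambda>c. replicate (A $$ c) c) ?cs)"
  have "length xs = sum_list (mat_entries A)"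
    unfolding xs_def mat_entries_eq dim by (simp add: length_concat comp_def)
  then have len: "length xs = sum_list \<alpha>" using margin_mats_sum_entries[OF A] by simp
  have set_xs: "set xs \<subseteq> {..<?p} \<times> {..<?q}" by (auto simp: xs_def)
  have mem: "xs ! (a - 1) \<in> {..<?p} \<times> {..<?q}" if "a \<in> ?M" for a
    using set_xs nth_mem[of "a - 1" xs] len that by fastforce
  define u v where "u a = (if a \<in> ?M then fst (xs ! (a - 1)) else 0)"
    and "v a = (if a \<in> ?M then snd (xs ! (a - 1)) else 0)" for a
  have uv_less: "u a < ?p" "v a < ?q" if "a \<in> ?M" for a
    using mem[OF that] that by (auto simp: u_def v_def)
  define w where "w a = (u a, v a)" for a
  have w: "w a = xs ! (a - 1)" if "a \<in> ?M" for a using that by (simp add: w_def u_def v_def)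
  have cnt: "card {a \<in> ?M. w a = c} = A $$ c" if c: "c \<in> {..<?p} \<times> {..<?q}" for c
  proof -
    let ?us = "[1..<Suc (sum_list \<alpha>)]"
    have us: "set ?us = ?M" by auto
    have "map w ?us = xs"
      by (rule nth_equalityI) (use len w in \<open>auto simp del: upt_Suc\<close>)
    then have "card {a \<in> ?M. w a = c} = count_list xs c"
      using count_list_map_distinct[OF distinct_upt, of w 1 "Suc (sum_list \<alpha>)" c] by (simp only: us)
    also have "\<dots> = A $$ c"
      unfolding xs_def count_list_concat_replicate[OF distinct_cells] using c by auto
    finally show ?thesis .
  qed
  have u: "u \<in> words \<alpha>"
    unfolding words_def
  proof (intro CollectI conjI allI impI)
    show "u a \<in> {..<?p}" if "a \<in> ?M" for a using uv_less(1)[OF that] by simp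
    show "u a = 0" if "a \<notin> ?M" for a using that by (auto simp: u_def)
    fix i assume i: "i < ?p"
    have "card {a \<in> ?M. u a = i} = (\<Sum>j<?q. card {a \<in> ?M. w a = (i, j)})"
      unfolding w_def by (rule sum_card_cells_row[symmetric]) (use uv_less in auto)
    also have "\<dots> = (\<Sum>j<?q. A $$ (i, j))" using cnt i by simp
    finally show "card {a \<in> ?M. u a = i} = \<alpha> ! i" using A i by (simp add: margin_mats_def)
  qed
  have v: "v \<in> words \<beta>"
    unfolding words_def sz
  proof (intro CollectI conjI allI impI)
    show "v a \<in> {..<?q}" if "a \<in> ?M" for a using uv_less(2)[OF that] by simp
    show "v a = 0" if "a \<notin> ?M" for a using that by (auto simp: v_def)
    fix j assume j: "j < ?q"
    have "card {a \<in> ?M. v a = j} = (\<Sum>i<?p. card {a \<in> ?M. w a = (i, j)})"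
      unfolding w_def by (rule sum_card_cells_column[symmetric]) (use uv_less in auto)
    also have "\<dots> = (\<Sum>i<?p. A $$ (i, j))" using cnt j by simp
    finally show "card {a \<in> ?M. v a = j} = \<beta> ! j" using A j by (simp add: margin_mats_def)
  qed
  have "w = (\<lambda>(u, v) a. (u a, v a)) (u, v)" by (simp add: w_def fun_eq_iff)
  then have "w \<in> pair_words \<alpha> \<beta>" unfolding pair_words_def using u v by blast
  moreover have "content_mat \<alpha> \<beta> w = A"
    by (rule eq_matI) (use dim cnt content_mat_index[of _ \<alpha> \<beta> w] in auto)
  ultimately show ?thesis by (rule that)
qed

text \<open>Only the level sets of a word matter for its stabilizer.\<close>

lemma stab_relabel:
  assumes inj: "inj_on f (w ` {1..m})"
  shows "stab m (f \<circ> w) = stab m w"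
proof -
  have "w \<circ> g = w" if g: "g \<in> sym_grp m" "(f \<circ> w) \<circ> g = f \<circ> w" for g
  proof
    fix a
    have gm: "g permutes {1..m}" using g(1) by (simp add: sym_grp_iff)
    show "(w \<circ> g) a = w a"
    proof (cases "a \<in> {1..m}")
      case True
      then have "g a \<in> {1..m}" using permutes_in_image[OF gm, of a] by blast
      moreover have "f (w (g a)) = f (w a)" using fun_cong[OF g(2), of a] by simp
      ultimately show ?thesis using inj True by (auto dest: inj_onD)
    next
      case False
      then show ?thesis using permutes_not_in[OF gm] by simp
    qed
  qed
  then show ?thesis by (auto simp: stab_def simp flip: comp_assoc) (simp add: comp_assoc)
qed

text \<open>Number the cells with positive entry in the order of decreasing entries. The word then becomes one with content
  the sorted sequence of entries, and its stabilizer is unchanged.\<close>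

lemma kostka_le_dim_fixed_specht_pair_word:
  assumes l: "sorted_wrt (\<ge>) \<gamma>" and sz: "sum_list \<beta> = sum_list \<alpha>" "sum_list \<gamma> = sum_list \<alpha>"
    and w: "w \<in> pair_words \<alpha> \<beta>"
  shows "kostka \<gamma> (mat_partition (content_mat \<alpha> \<beta> w)) \<le> cfun.dim (fixed_specht \<gamma> w)"
proof -
  let ?A = "content_mat \<alpha> \<beta> w" and ?M = "{1..sum_list \<alpha>}"
  let ?cs = "List.product [0..<length \<alpha>] [0..<length \<beta>]"
  \<comment> \<open>a cell with entry \<open>0\<close> occurs neither in the word nor among the parts of the content\<close>
  let ?pos = "filter (\<lambda>c. 0 < ?A $$ c) ?cs"
  have "mset (map (($$) ?A) ?pos) = mset (mat_partition ?A)"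
    unfolding mat_partition_def mat_entries_eq by (simp add: filter_map comp_def del: mset_map)
  then obtain zs where zs: "mset zs = mset ?pos" "map (($$) ?A) zs = mat_partition ?A"
    using ex_mset_preimage by blast
  have dist: "distinct zs"
    using zs(1) distinct_filter[OF distinct_cells] by (metis mset_eq_imp_distinct_iff)
  have set_zs: "set zs = {c \<in> {..<length \<alpha>} \<times> {..<length \<beta>}. 0 < ?A $$ c}"
    using mset_eq_setD[OF zs(1)] by auto
  have range: "w a \<in> set zs" if a: "a \<in> ?M" for a
  proof -
    have c: "w a \<in> {..<length \<alpha>} \<times> {..<length \<beta>}" by (rule pair_words_range[OF sz(1) w a])
    have "a \<in> {b \<in> ?M. w b = w a}" using a by simp
    then have "0 < card {b \<in> ?M. w b = w a}" by (subst card_gt_0_iff) auto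
    then show ?thesis using c content_mat_index[OF c, of w] by (simp only: set_zs mem_Collect_eq)
  qed
  define pos where "pos c = (THE k. k < length zs \<and> zs ! k = c)" for c
  have pos: "pos c = k" if "k < length zs" "zs ! k = c" for c k
    unfolding pos_def
  proof (rule the_equality)
    show "k < length zs \<and> zs ! k = c" using that by simp
    show "k' = k" if "k' < length zs \<and> zs ! k' = c" for k'
      using nth_eq_iff_index_eq[OF dist, of k' k] that \<open>k < length zs\<close> \<open>zs ! k = c\<close> by simp
  qed
  define f where "f c = Suc (pos c)" for c
  have f_iff: "f c = Suc k \<longleftrightarrow> c = zs ! k" if "c \<in> set zs" "k < length zs" for c k
  proof -
    obtain k' where k': "k' < length zs" "zs ! k' = c" using \<open>c \<in> set zs\<close> by (metis in_set_conv_nth)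
    then have "pos c = k'" by (rule pos)
    then show ?thesis using k' that(2) nth_eq_iff_index_eq[OF dist k'(1) that(2)] by (auto simp: f_def)
  qed
  have f_range: "f c \<in> {1..length zs}" if "c \<in> set zs" for c
  proof -
    obtain k where k: "k < length zs" "zs ! k = c" using \<open>c \<in> set zs\<close> by (metis in_set_conv_nth)
    then have "pos c = k" by (rule pos)
    then show ?thesis using k(1) by (simp add: f_def)
  qed
  have "inj_on f (set zs)"
  proof (rule inj_onI)
    fix c d assume cd: "c \<in> set zs" "d \<in> set zs" "f c = f d"
    obtain k where k: "k < length zs" "zs ! k = d" using cd(2) by (metis in_set_conv_nth)
    then have "f d = Suc k" using pos[OF k] by (simp add: f_def)
    then show "c = d" using f_iff[OF cd(1) k(1)] cd(3) k(2) by simp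
  qed
  then have "inj_on f (w ` ?M)" by (rule inj_on_subset) (use range in blast)
  then have stab: "stab (sum_list \<alpha>) (f \<circ> w) = stab (sum_list \<alpha>) w" by (rule stab_relabel)
  have len: "length (mat_partition ?A) = length zs" using arg_cong[OF zs(2), of length] by simp
  have "kostka \<gamma> (mat_partition ?A) \<le> cfun.dim (fixed_specht \<gamma> (f \<circ> w))"
  proof (rule kostka_le_dim_fixed_specht[OF l])
    show "(f \<circ> w) a \<in> {1..length (mat_partition ?A)}" if "a \<in> {1..sum_list \<gamma>}" for a
      using f_range[OF range[of a]] that sz(2) len by simp
    fix k assume "k < length (mat_partition ?A)"
    then have k: "k < length zs" using len by simp
    have "{a \<in> {1..sum_list \<gamma>}. (f \<circ> w) a = Suc k} = {a \<in> ?M. w a = zs ! k}"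
      using f_iff[OF range k] sz(2) by auto
    moreover have "zs ! k \<in> {..<length \<alpha>} \<times> {..<length \<beta>}"
      using nth_mem[OF k] unfolding set_zs by blast
    ultimately have "card {a \<in> {1..sum_list \<gamma>}. (f \<circ> w) a = Suc k} = ?A $$ (zs ! k)"
      using content_mat_index by simp
    also have "\<dots> = mat_partition ?A ! k" unfolding zs(2)[symmetric] using k by simp
    finally show "card {a \<in> {1..sum_list \<gamma>}. (f \<circ> w) a = Suc k} = mat_partition ?A ! k" .
  qed
  then show ?thesis by (simp add: fixed_specht_def stab sz(2))
qed

lemma fixed_specht_pair_word_imp_majorized:
  assumes l: "sorted_wrt (\<ge>) \<gamma>" and sz: "sum_list \<gamma> = sum_list \<alpha>"
    and dim: "cfun.dim (fixed_specht \<gamma> w) > 0"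
  shows "majorized \<gamma> (content_mat \<alpha> \<beta> w)"
  unfolding majorized_def content_mat_dim
proof (intro allI impI)
  fix J assume J: "J \<subseteq> {..<length \<alpha>} \<times> {..<length \<beta>}"
  then have fin: "finite J" using finite_subset by blast
  have "card {a \<in> {1..sum_list \<alpha>}. w a \<in> J}
      = (\<Sum>c\<in>J. card {a \<in> {a \<in> {1..sum_list \<alpha>}. w a \<in> J}. w a = c})"
    using fin by (intro card_eq_sum_fibres) auto
  also have "\<dots> = (\<Sum>c\<in>J. content_mat \<alpha> \<beta> w $$ c)"
  proof (rule sum.cong[OF refl])
    fix c assume c: "c \<in> J"
    then have "{a \<in> {a \<in> {1..sum_list \<alpha>}. w a \<in> J}. w a = c} = {a \<in> {1..sum_list \<alpha>}. w a = c}" by auto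
    moreover have "content_mat \<alpha> \<beta> w $$ c = card {a \<in> {1..sum_list \<alpha>}. w a = c}"
      by (rule content_mat_index) (use c J in blast)
    ultimately show "card {a \<in> {a \<in> {1..sum_list \<alpha>}. w a \<in> J}. w a = c} = content_mat \<alpha> \<beta> w $$ c" by simp
  qed
  finally show "(\<Sum>c\<in>J. content_mat \<alpha> \<beta> w $$ c) \<le> sum_list (take (card J) \<gamma>)"
    using fixed_specht_nonzero_imp_dominated[OF l dim fin] sz by simp
qed

text \<open>The hypothesis says that the words in the cells, weighted with the order of the stabilizer and the dimension of
  its fixed space, have total weight \<open>m!\<close>. An orbit consists of words with the same content \<open>A\<close>. Its
  weight is at least \<open>m!\<close> times the Kostka number of \<open>A\<close>, which is positive if \<open>A\<close> is majorized, and it vanishes if \<open>A\<close>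
  is not majorized. So exactly one orbit contributes.\<close>

lemma multiplicity_one:
  assumes part: "is_partition \<gamma>"
    and sz: "sum_list \<beta> = sum_list \<alpha>" "sum_list \<gamma> = sum_list \<alpha>"
    and one: "char_inner (sum_list \<alpha>) (char_tensor (perm_char \<alpha>) (perm_char \<beta>)) (irr_char \<gamma>) = 1"
  shows multiplicity_one_exists: "\<exists>A\<in>margin_mats \<alpha> \<beta>. majorized \<gamma> A"
    and multiplicity_one_unique: "A \<in> margin_mats \<alpha> \<beta> \<Longrightarrow> majorized \<gamma> A \<Longrightarrow>
      B \<in> margin_mats \<alpha> \<beta> \<Longrightarrow> majorized \<gamma> B \<Longrightarrow> A = B"
    and multiplicity_one_kostka: "A \<in> margin_mats \<alpha> \<beta> \<Longrightarrow> majorized \<gamma> A \<Longrightarrow> kostka \<gamma> (mat_partition A) = 1"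
proof -
  let ?m = "sum_list \<alpha>" and ?W = "pair_words \<alpha> \<beta>" and ?d = "\<lambda>w. cfun.dim (fixed_specht \<gamma> w)"
  have sorted: "sorted_wrt (\<ge>) \<gamma>" using part by (simp add: is_partition_def)
  have "of_nat (\<Sum>w\<in>?W. card (stab ?m w) * ?d w) = (of_nat (fact ?m) :: complex)"
    using one unfolding char_inner_eq_sum_pair_words[OF sz] by (simp add: divide_simps split: if_splits)
  then have total: "(\<Sum>w\<in>?W. card (stab ?m w) * ?d w) = fact ?m" by (simp only: of_nat_eq_iff)
  have closed: "w \<circ> x \<in> ?W" if "w \<in> ?W" "x \<in> sym_grp ?m" for w x
    using pair_words_comp[OF sz(1) that] .
  have lower: "kostka \<gamma> (mat_partition (content_mat \<alpha> \<beta> w)) \<le> ?d (w \<circ> x)"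
    if "w \<in> ?W" "x \<in> sym_grp ?m" for w x
    using kostka_le_dim_fixed_specht_pair_word[OF sorted sz closed[OF that]] content_mat_comp[OF that(2)]
    by simp
  have kostka_pos: "1 \<le> kostka \<gamma> (mat_partition A)" if "A \<in> margin_mats \<alpha> \<beta>" "majorized \<gamma> A" for A
  proof -
    have "{T. is_ssyt \<gamma> (mat_partition A) T} \<noteq> {}"
      using majorized_imp_ssyt_exists[OF part that(1) sz(2) that(2)] by blast
    then have "0 < card {T. is_ssyt \<gamma> (mat_partition A) T}" using finite_ssyt by (simp add: card_gt_0_iff)
    then show ?thesis by (simp add: kostka_def)
  qed
  show "\<exists>A\<in>margin_mats \<alpha> \<beta>. majorized \<gamma> A"
  proof -
    have "\<exists>w\<in>?W. ?d w \<noteq> 0"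
    proof (rule ccontr)
      assume "\<not> ?thesis"
      then have "(\<Sum>w\<in>?W. card (stab ?m w) * ?d w) = 0" by simp
      then show False using total by simp
    qed
    then obtain w where w: "w \<in> ?W" "?d w > 0" by blast
    show ?thesis
      using content_mat_in_margin_mats[OF sz(1) w(1)]
        fixed_specht_pair_word_imp_majorized[OF sorted sz(2) w(2)] by blast
  qed
  show "kostka \<gamma> (mat_partition A) = 1" if A: "A \<in> margin_mats \<alpha> \<beta>" "majorized \<gamma> A" for A
  proof -
    obtain w where w: "w \<in> ?W" "content_mat \<alpha> \<beta> w = A"
      by (rule pair_word_with_content_exists[OF A(1) sz(1)])
    have "kostka \<gamma> (mat_partition A) \<le> 1"
      by (rule weight_one_imp_bounded[OF finite_pair_words closed total w(1)])
        (use lower[OF w(1)] w(2) in auto)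
    then show ?thesis using kostka_pos[OF A] by simp
  qed
  show "A = B" if A: "A \<in> margin_mats \<alpha> \<beta>" "majorized \<gamma> A" and B: "B \<in> margin_mats \<alpha> \<beta>" "majorized \<gamma> B" for A B
  proof -
    obtain w where w: "w \<in> ?W" "content_mat \<alpha> \<beta> w = A"
      by (rule pair_word_with_content_exists[OF A(1) sz(1)])
    obtain w' where w': "w' \<in> ?W" "content_mat \<alpha> \<beta> w' = B"
      by (rule pair_word_with_content_exists[OF B(1) sz(1)])
    have dw: "1 \<le> ?d (w \<circ> x)" if "x \<in> sym_grp ?m" for x
      using lower[OF w(1) that] kostka_pos[OF A] w(2) by simp
    have dw': "1 \<le> ?d (w' \<circ> x)" if "x \<in> sym_grp ?m" for x
      using lower[OF w'(1) that] kostka_pos[OF B] w'(2) by simp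
    obtain x where x: "x \<in> sym_grp ?m" "w' = w \<circ> x"
      using weight_one_imp_same_orbit[OF finite_pair_words closed total w(1) dw w'(1) dw'] by blast
    have "B = content_mat \<alpha> \<beta> (w \<circ> x)" using w'(2) x(2) by simp
    also have "\<dots> = A" using content_mat_comp[OF x(1)] w(2) by simp
    finally show ?thesis ..
  qed
qed

lemma sum_list_scale_partition: "sum_list (scale_partition n l) = n * sum_list l"
  by (simp add: scale_partition_def sum_list_const_mult)

lemma is_partition_scale: "1 \<le> n \<Longrightarrow> is_partition l \<Longrightarrow> is_partition (scale_partition n l)"
  by (auto simp: is_partition_def scale_partition_def sorted_wrt_map elim: sorted_wrt_mono_rel[rotated])

lemma smult_margin_mats:
  assumes "A \<in> margin_mats \<alpha> \<beta>"
  shows "n \<cdot>\<^sub>m A \<in> margin_mats (scale_partition n \<alpha>) (scale_partition n \<beta>)"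
  using assms by (auto simp: margin_mats_def scale_partition_def simp flip: sum_distrib_left)

lemma smult_majorized:
  assumes "majorized \<gamma> A" shows "majorized (scale_partition n \<gamma>) (n \<cdot>\<^sub>m A)"
  unfolding majorized_def
proof (intro allI impI)
  fix J assume "J \<subseteq> {..<dim_row (n \<cdot>\<^sub>m A)} \<times> {..<dim_col (n \<cdot>\<^sub>m A)}"
  then have J: "J \<subseteq> {..<dim_row A} \<times> {..<dim_col A}" by simp
  have "(\<Sum>c\<in>J. (n \<cdot>\<^sub>m A) $$ c) = (\<Sum>c\<in>J. n * A $$ c)"
    using J by (intro sum.cong) auto
  also have "\<dots> = n * (\<Sum>c\<in>J. A $$ c)" by (simp add: sum_distrib_left)
  also have "\<dots> \<le> n * sum_list (take (card J) \<gamma>)"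
    using assms J by (intro mult_left_mono) (simp_all add: majorized_def)
  finally show "(\<Sum>c\<in>J. (n \<cdot>\<^sub>m A) $$ c) \<le> sum_list (take (card J) (scale_partition n \<gamma>))"
    by (simp only: sum_list_take_scale)
qed

text \<open>Multiplicity one for \<open>n = 1\<close> yields the matrix \<open>A\<close>, and for each \<open>n\<close> it makes \<open>n A\<close> the only integral matrix with
  its margins that is majorized by \<open>n \<gamma>\<close>. So there is no rational competitor of \<open>A\<close> either, which forces additivity.\<close>

theorem theorem6p2:
  fixes \<alpha> \<beta> \<gamma> :: "nat list"
  assumes "is_partition \<alpha>" and "is_partition \<beta>" and "is_partition \<gamma>"
    and "sum_list \<beta> = sum_list \<alpha>" and "sum_list \<gamma> = sum_list \<alpha>"
    and "\<And>n::nat. n \<ge> 1 \<Longrightarrow>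
      char_inner (n * sum_list \<alpha>)
        (char_tensor (perm_char (scale_partition n \<alpha>)) (perm_char (scale_partition n \<beta>)))
        (irr_char (scale_partition n \<gamma>)) = 1"
  shows "(\<exists>!A. A \<in> permutohedron_mats \<gamma> \<alpha> \<beta>) \<and>
    (\<forall>A \<in> permutohedron_mats \<gamma> \<alpha> \<beta>. additive_mat A \<and>
      (\<forall>n::nat. n \<ge> 1 \<longrightarrow> kostka (scale_partition n \<gamma>) (mat_partition (n \<cdot>\<^sub>m A)) = 1))"
proof -
  have iff: "A \<in> permutohedron_mats \<gamma> \<alpha> \<beta> \<longleftrightarrow> A \<in> margin_mats \<alpha> \<beta> \<and> majorized \<gamma> A" for A
    by (rule permutohedron_mats_iff[OF assms(3,5)])
  have part: "is_partition (scale_partition n \<gamma>)"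
    and sz: "sum_list (scale_partition n \<beta>) = sum_list (scale_partition n \<alpha>)"
      "sum_list (scale_partition n \<gamma>) = sum_list (scale_partition n \<alpha>)"
    and one: "char_inner (sum_list (scale_partition n \<alpha>))
        (char_tensor (perm_char (scale_partition n \<alpha>)) (perm_char (scale_partition n \<beta>)))
        (irr_char (scale_partition n \<gamma>)) = 1" if "1 \<le> n" for n
    using is_partition_scale[OF that assms(3)] assms(4,5) assms(6)[OF that]
    by (simp_all add: sum_list_scale_partition)
  have scale1: "scale_partition 1 l = l" for l by (simp add: scale_partition_def)
  note one1 = part[OF order_refl, unfolded scale1] sz[OF order_refl, unfolded scale1] one[OF order_refl, unfolded scale1]
  have "\<exists>!A. A \<in> permutohedron_mats \<gamma> \<alpha> \<beta>"
    unfolding iff using multiplicity_one_exists[OF one1] multiplicity_one_unique[OF one1] by blast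
  moreover have "additive_mat A \<and>
      (\<forall>n\<ge>1. kostka (scale_partition n \<gamma>) (mat_partition (n \<cdot>\<^sub>m A)) = 1)"
    if "A \<in> permutohedron_mats \<gamma> \<alpha> \<beta>" for A
  proof (intro conjI allI impI)
    have A: "A \<in> margin_mats \<alpha> \<beta>" "majorized \<gamma> A" using that unfolding iff by auto
    show "kostka (scale_partition n \<gamma>) (mat_partition (n \<cdot>\<^sub>m A)) = 1" if n: "1 \<le> n" for n
      by (rule multiplicity_one_kostka[OF part[OF n] sz[OF n] one[OF n] smult_margin_mats[OF A(1)] smult_majorized[OF A(2)]])
    show "additive_mat A"
    proof (rule ccontr)
      assume "\<not> additive_mat A"
      then obtain C B where C: "1 \<le> C" and
        B: "B \<in> margin_mats (scale_partition C \<alpha>) (scale_partition C \<beta>)" "majorized (scale_partition C \<gamma>) B"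
        and ne: "B \<noteq> C \<cdot>\<^sub>m A"
        using non_additive_imp_other_majorized_mat[OF A] by blast
      have "B = C \<cdot>\<^sub>m A"
        by (rule multiplicity_one_unique[OF part[OF C] sz[OF C] one[OF C] B smult_margin_mats[OF A(1)] smult_majorized[OF A(2)]])
      then show False using ne by simp
    qed
  qed
  ultimately show ?thesis by blast
qed

end
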